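(* Let $n\ge2$ and let $(q,\eta)$ satisfy the Bernoulli condition \[ q_t+\tfrac12|\nabla_xq|^2+g\eta-\frac{(\eta_t+\nabla_x\eta\cdot\nabla_xq)^2}{2(1+|\nabla_x\eta|^2)}=\frac{\sigma}{\rho}\nabla_x\cdot\left(\frac{\nabla_x\eta}{\sqrt{1+|\nabla_x\eta|^2}}\right). \] Let $s_1\ge\frac n2$, $s_2>n-\frac12$, and let the norms $\|\nabla\phi\|_{H^{s_1}(\Omega)}$ and $\|\eta\|_{H^{s_2}(\mathbf R^{n-1})}$ be (finite and) such that \[ \max\{\|\eta_t\|_{L^2},\ \|\eta\|_{H^2},\ \|\nabla_xq\|_{L^2}\}<\epsilon . \] Then \[ \hat q_t+g\hat\eta+\frac{\sigma}{\rho}\kappa^2\hat\eta=O(\epsilon^2) \] uniformly in $\kappa$, where $\kappa=|k|$.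
   Context: Irrotational water waves in $n$ spatial dimensions over a flat bottom. $x\in\mathbf R^{n-1}$, $y\in\mathbf R$, $\nabla_x$ is the gradient in $x$ and $\nabla=(\nabla_x,\partial_y)$; $\eta(x,t)$ is the height of the free surface $y=\eta(x,t)$; $\Omega$ is the region between the flat bottom $y=-h_0$ ($h_0>0$) and the free surface; $\phi$ is the velocity potential (harmonic in $\Omega$, with zero normal derivative on the bottom and $\nabla\phi\cdot(-\nabla_x\eta,1)=\eta_t$ on the free surface) and $q(x,t)=\phi(x,\eta(x,t),t)$. The constants are $g>0$ (gravity), $\sigma\ge0$ (surface tension), $\rho>0$ (density). Norms of $\eta,\eta_t,\nabla_xq$ are over $\mathbf R^{n-1}$ at a given time $t$. The Fourier transform on $\mathcal S'(\mathbf R^{n-1})$ is $\hat f(k)=\int e^{-\mathrm ik\cdot x}f(x)\,\mathrm dx$, and $\kappa=\sqrt{k_1^2+\cdots+k_{n-1}^2}$; $\hat q_t$ is the Fourier transform of $q_t$. $O(\epsilon^2)$ is understood for small $\epsilon$. *)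

theory Defs
  imports "HOL-Analysis.Analysis"
begin

section \<open>Smooth functions, test functions and Schwartz functions\<close>

definition pd :: "'a \<Rightarrow> ('a::euclidean_space \<Rightarrow> 'b::real_normed_vector) \<Rightarrow> 'a \<Rightarrow> 'b" where
  "pd b f x = frechet_derivative f (at x) b"

text \<open>A list of basis vectors plays the role of a multi-index.\<close>

fun pds :: "'a list \<Rightarrow> ('a::euclidean_space \<Rightarrow> 'b::real_normed_vector) \<Rightarrow> 'a \<Rightarrow> 'b" where
  "pds [] f = f"
| "pds (b # bs) f = pd b (pds bs f)"

definition indices :: "nat \<Rightarrow> 'a::euclidean_space list set" where
  "indices j = {bs. set bs \<subseteq> Basis \<and> length bs = j}"

definition smooth :: "('a::euclidean_space \<Rightarrow> 'b::real_normed_vector) \<Rightarrow> bool" where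
  "smooth f \<longleftrightarrow> (\<forall>bs. set bs \<subseteq> Basis \<longrightarrow> (\<forall>x. pds bs f differentiable (at x)))"

definition test_functions :: "'a::euclidean_space set \<Rightarrow> ('a \<Rightarrow> real) set" where
  "test_functions U = {\<psi>. smooth \<psi> \<and> (\<exists>K. compact K \<and> K \<subseteq> U \<and> (\<forall>x. x \<notin> K \<longrightarrow> \<psi> x = 0))}"

definition schwartz :: "('a::euclidean_space \<Rightarrow> complex) set" where
  "schwartz = {\<psi>. smooth \<psi> \<and>
     (\<forall>bs N. set bs \<subseteq> Basis \<longrightarrow> bounded (range (\<lambda>x. (1 + norm x) ^ N *\<^sub>R pds bs \<psi> x)))}"

definition schwartz_seminorm :: "nat \<Rightarrow> 'a list \<Rightarrow> ('a::euclidean_space \<Rightarrow> complex) \<Rightarrow> real" where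
  "schwartz_seminorm N bs \<psi> = (SUP x. (1 + norm x) ^ N * cmod (pds bs \<psi> x))"


section \<open>Tempered distributions and the Fourier transform\<close>

text \<open>Functionals are only ever evaluated at Schwartz functions; their values elsewhere are
  irrelevant.\<close>

definition tempered_distribution :: "(('a::euclidean_space \<Rightarrow> complex) \<Rightarrow> complex) \<Rightarrow> bool" where
  "tempered_distribution u \<longleftrightarrow>
     (\<forall>\<psi>\<in>schwartz. \<forall>\<omega>\<in>schwartz. \<forall>c. u (\<lambda>x. c * \<psi> x + \<omega> x) = c * u \<psi> + u \<omega>) \<and>
     (\<exists>C N. \<forall>\<psi>\<in>schwartz.
        cmod (u \<psi>) \<le> C * (\<Sum>j\<le>N. \<Sum>bs\<in>indices j. schwartz_seminorm N bs \<psi>))"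

definition dist_of :: "('a::euclidean_space \<Rightarrow> complex) \<Rightarrow> ('a \<Rightarrow> complex) \<Rightarrow> complex" where
  "dist_of f \<psi> = (LINT x|lebesgue. f x * \<psi> x)"

text \<open>The integrability requirement excludes the junk value 0 of divergent integrals.\<close>

definition is_tempered_function :: "('a::euclidean_space \<Rightarrow> complex) \<Rightarrow> bool" where
  "is_tempered_function f \<longleftrightarrow>
     (\<forall>\<psi>\<in>schwartz. integrable lebesgue (\<lambda>x. f x * \<psi> x)) \<and> tempered_distribution (dist_of f)"

definition fourier :: "('a::euclidean_space \<Rightarrow> complex) \<Rightarrow> 'a \<Rightarrow> complex" where
  "fourier f k = (LINT x|lebesgue. exp (- (\<i> * complex_of_real (k \<bullet> x))) * f x)"

definition fourier_dist ::
  "(('a::euclidean_space \<Rightarrow> complex) \<Rightarrow> complex) \<Rightarrow> ('a \<Rightarrow> complex) \<Rightarrow> complex" where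
  "fourier_dist u \<psi> = u (fourier \<psi>)"

definition mult_dist ::
  "('a \<Rightarrow> complex) \<Rightarrow> (('a::euclidean_space \<Rightarrow> complex) \<Rightarrow> complex) \<Rightarrow> ('a \<Rightarrow> complex) \<Rightarrow> complex" where
  "mult_dist m u \<psi> = u (\<lambda>k. m k * \<psi> k)"


section \<open>Weak derivatives\<close>

definition locally_integrable :: "'a::euclidean_space set \<Rightarrow> ('a \<Rightarrow> real) \<Rightarrow> bool" where
  "locally_integrable U f \<longleftrightarrow> (\<forall>K. compact K \<and> K \<subseteq> U \<longrightarrow> set_integrable lebesgue K f)"

definition has_weak_deriv ::
  "'a::euclidean_space set \<Rightarrow> 'a list \<Rightarrow> ('a \<Rightarrow> real) \<Rightarrow> ('a \<Rightarrow> real) \<Rightarrow> bool" where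
  "has_weak_deriv U bs f h \<longleftrightarrow> locally_integrable U f \<and> locally_integrable U h \<and>
     (\<forall>\<psi>\<in>test_functions U.
        (LINT x:U|lebesgue. f x * pds bs \<psi> x) = (-1) ^ length bs * (LINT x:U|lebesgue. h x * \<psi> x))"

definition has_weak_grad :: "('a::euclidean_space \<Rightarrow> real) \<Rightarrow> ('a \<Rightarrow> 'a) \<Rightarrow> bool" where
  "has_weak_grad f G \<longleftrightarrow> (\<forall>b\<in>Basis. has_weak_deriv UNIV [b] f (\<lambda>x. G x \<bullet> b))"

definition has_weak_div :: "('a::euclidean_space \<Rightarrow> 'a) \<Rightarrow> ('a \<Rightarrow> real) \<Rightarrow> bool" where
  "has_weak_div V r \<longleftrightarrow> (\<forall>b\<in>Basis. locally_integrable UNIV (\<lambda>x. V x \<bullet> b)) \<and>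
     locally_integrable UNIV r \<and>
     (\<forall>\<psi>\<in>test_functions UNIV.
        (LINT x|lebesgue. (\<Sum>b\<in>Basis. (V x \<bullet> b) * pd b \<psi> x)) = - (LINT x|lebesgue. r x * \<psi> x))"

text \<open>Weak gradients and divergences are unique up to null sets, so it does not matter which
  representative is chosen; existence always has to be stated separately.\<close>

definition weak_grad :: "('a::euclidean_space \<Rightarrow> real) \<Rightarrow> 'a \<Rightarrow> 'a" where
  "weak_grad f = (SOME G. has_weak_grad f G)"

definition weak_div :: "('a::euclidean_space \<Rightarrow> 'a) \<Rightarrow> 'a \<Rightarrow> real" where
  "weak_div V = (SOME r. has_weak_div V r)"


section \<open>Lebesgue and Sobolev norms\<close>

definition square_integrable :: "('a::euclidean_space \<Rightarrow> 'b::euclidean_space) \<Rightarrow> bool" where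
  "square_integrable f \<longleftrightarrow>
     f \<in> borel_measurable lebesgue \<and> integrable lebesgue (\<lambda>x. (norm (f x))\<^sup>2)"

definition L2_norm :: "('a::euclidean_space \<Rightarrow> 'b::euclidean_space) \<Rightarrow> real" where
  "L2_norm f = sqrt (LINT x|lebesgue. (norm (f x))\<^sup>2)"

definition gagliardo_sq :: "'a::euclidean_space set \<Rightarrow> real \<Rightarrow> ('a \<Rightarrow> real) \<Rightarrow> ennreal" where
  "gagliardo_sq U \<theta> h =
     (\<integral>\<^sup>+x\<in>U. (\<integral>\<^sup>+y\<in>U. ennreal ((h x - h y)\<^sup>2 / dist x y powr (real DIM('a) + 2 * \<theta>))
        \<partial>lebesgue) \<partial>lebesgue)"

text \<open>The Sobolev space of real order \<open>s \<ge> 0\<close> on an open set \<open>U\<close> is the Sobolev--Slobodeckij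
  space \<open>W\<close> of order \<open>s\<close> and exponent 2: with \<open>m\<close> the integer part of \<open>s\<close>, all weak derivatives
  up to order \<open>m\<close> are square integrable on \<open>U\<close>, and those of order \<open>m\<close> have a finite Gagliardo
  seminorm of order \<open>frac s\<close> if \<open>s\<close> is not an integer.  Since weak derivatives are unique up to
  null sets, the infimum is over a single value, or over the empty set (giving \<open>\<infinity>\<close>) if one of them
  does not exist.\<close>

definition sobolev_norm_sq :: "real \<Rightarrow> 'a::euclidean_space set \<Rightarrow> ('a \<Rightarrow> real) \<Rightarrow> ennreal" where
  "sobolev_norm_sq s U f = (let m = nat \<lfloor>s\<rfloor> in
     INF D \<in> {D. \<forall>j\<le>m. \<forall>bs\<in>indices j. has_weak_deriv U bs f (D bs)}.
       (\<Sum>j\<le>m. \<Sum>bs\<in>indices j. \<integral>\<^sup>+x\<in>U. ennreal ((D bs x)\<^sup>2) \<partial>lebesgue) +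
       (if frac s = 0 then 0 else (\<Sum>bs\<in>indices m. gagliardo_sq U (frac s) (D bs))))"

definition sobolev_space :: "real \<Rightarrow> 'a::euclidean_space set \<Rightarrow> ('a \<Rightarrow> real) set" where
  "sobolev_space s U = {f. sobolev_norm_sq s U f < \<infinity>}"

definition sobolev_norm :: "real \<Rightarrow> 'a::euclidean_space set \<Rightarrow> ('a \<Rightarrow> real) \<Rightarrow> real" where
  "sobolev_norm s U f = sqrt (enn2real (sobolev_norm_sq s U f))"


section \<open>The water wave problem\<close>

text \<open>Points of space are pairs \<open>(x, y)\<close> of a horizontal position and a height.\<close>

definition fluid_domain :: "real \<Rightarrow> ('x::euclidean_space \<Rightarrow> real) \<Rightarrow> ('x \<times> real) set" where
  "fluid_domain h0 \<zeta> = {(x, y). - h0 < y \<and> y < \<zeta> x}"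

definition harmonic_on :: "'a::euclidean_space set \<Rightarrow> ('a \<Rightarrow> real) \<Rightarrow> bool" where
  "harmonic_on U u \<longleftrightarrow> open U \<and>
     (\<forall>z\<in>U. u differentiable (at z) \<and> (\<forall>b\<in>Basis. pd b u differentiable (at z))) \<and>
     (\<forall>b\<in>Basis. \<forall>c\<in>Basis. continuous_on U (pd c (pd b u))) \<and>
     (\<forall>z\<in>U. (\<Sum>b\<in>Basis. pd b (pd b u) z) = 0)"

text \<open>Trace of a function on \<open>U\<close> on the graph of \<open>\<gamma>\<close>: the extension by continuity, from the
  Sobolev space of order 1 on \<open>U\<close> to square integrable functions of \<open>x\<close>, of the restriction
  operator on smooth functions.\<close>

definition has_trace ::
  "('x::euclidean_space \<times> real) set \<Rightarrow> ('x \<Rightarrow> real) \<Rightarrow> ('x \<times> real \<Rightarrow> real) \<Rightarrow> ('x \<Rightarrow> real) \<Rightarrow> bool" where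
  "has_trace U \<gamma> u v \<longleftrightarrow> square_integrable v \<and>
     (\<exists>w::nat \<Rightarrow> 'x \<times> real \<Rightarrow> real. (\<forall>j. w j \<in> test_functions UNIV) \<and>
        (\<lambda>j. sobolev_norm_sq 1 U (\<lambda>z. w j z - u z)) \<longlonglongrightarrow> 0 \<and>
        (\<lambda>j. \<integral>\<^sup>+x. ennreal ((w j (x, \<gamma> x) - v x)\<^sup>2) \<partial>lebesgue) \<longlonglongrightarrow> 0)"

text \<open>Over an open set \<open>T\<close> of times: \<open>\<phi>\<close> is harmonic in the fluid and \<open>q\<close> is its boundary value
  at the free surface.  The profile \<open>\<eta>\<close> is the continuous representative and stays above the
  bottom.\<close>

definition free_surface_flow ::
  "real set \<Rightarrow> real \<Rightarrow> ('x::euclidean_space \<Rightarrow> real \<Rightarrow> real) \<Rightarrow> ('x \<times> real \<Rightarrow> real \<Rightarrow> real)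
     \<Rightarrow> ('x \<Rightarrow> real \<Rightarrow> real) \<Rightarrow> bool" where
  "free_surface_flow T h0 \<eta> \<phi> q \<longleftrightarrow> open T \<and> (\<forall>t\<in>T.
     continuous_on UNIV (\<lambda>x. \<eta> x t) \<and> (\<forall>x. - h0 < \<eta> x t) \<and>
     harmonic_on (fluid_domain h0 (\<lambda>x. \<eta> x t)) (\<lambda>z. \<phi> z t) \<and>
     (\<forall>x. ((\<lambda>z. \<phi> z t) \<longlongrightarrow> q x t)
        (at (x, \<eta> x t) within fluid_domain h0 (\<lambda>x. \<eta> x t))))"

definition bottom_condition ::
  "real \<Rightarrow> ('x::euclidean_space \<Rightarrow> real \<Rightarrow> real) \<Rightarrow> ('x \<times> real \<Rightarrow> real \<Rightarrow> real) \<Rightarrow> real \<Rightarrow> bool" where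
  "bottom_condition h0 \<eta> \<phi> t \<longleftrightarrow>
     has_trace (fluid_domain h0 (\<lambda>x. \<eta> x t)) (\<lambda>_. - h0) (pd (0, 1) (\<lambda>z. \<phi> z t)) (\<lambda>_. 0)"

text \<open>Below, \<open>V x\<close> is the velocity at the surface point above \<open>x\<close>.\<close>

definition kinematic_condition ::
  "real \<Rightarrow> ('x::euclidean_space \<Rightarrow> real \<Rightarrow> real) \<Rightarrow> ('x \<times> real \<Rightarrow> real \<Rightarrow> real) \<Rightarrow> real \<Rightarrow> bool" where
  "kinematic_condition h0 \<eta> \<phi> t \<longleftrightarrow>
     (\<exists>G. has_weak_grad (\<lambda>x. \<eta> x t) G) \<and>
     (AE x in lebesgue. (\<lambda>s. \<eta> x s) differentiable (at t)) \<and>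
     (\<exists>V::'x \<Rightarrow> 'x \<times> real.
        (\<forall>b\<in>Basis. has_trace (fluid_domain h0 (\<lambda>x. \<eta> x t)) (\<lambda>x. \<eta> x t)
           (pd b (\<lambda>z. \<phi> z t)) (\<lambda>x. V x \<bullet> b)) \<and>
        (AE x in lebesgue. V x \<bullet> (- weak_grad (\<lambda>x. \<eta> x t) x, 1) = deriv (\<lambda>s. \<eta> x s) t))"

definition bernoulli_condition ::
  "real \<Rightarrow> real \<Rightarrow> real \<Rightarrow> ('x::euclidean_space \<Rightarrow> real \<Rightarrow> real) \<Rightarrow> ('x \<Rightarrow> real \<Rightarrow> real) \<Rightarrow> real \<Rightarrow> bool" where
  "bernoulli_condition g \<sigma> \<rho> q \<eta> t \<longleftrightarrow>
     (let Dq = weak_grad (\<lambda>x. q x t); D\<eta> = weak_grad (\<lambda>x. \<eta> x t);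
          qt = (\<lambda>x. deriv (\<lambda>s. q x s) t); \<eta>t = (\<lambda>x. deriv (\<lambda>s. \<eta> x s) t);
          N = (\<lambda>x. (1 / sqrt (1 + (norm (D\<eta> x))\<^sup>2)) *\<^sub>R D\<eta> x)
      in (\<exists>G. has_weak_grad (\<lambda>x. q x t) G) \<and> (\<exists>G. has_weak_grad (\<lambda>x. \<eta> x t) G) \<and>
         (\<exists>r. has_weak_div N r) \<and>
         (AE x in lebesgue. (\<lambda>s. q x s) differentiable (at t) \<and>
            (\<lambda>s. \<eta> x s) differentiable (at t)) \<and>
         (AE x in lebesgue.
            qt x + 1/2 * (norm (Dq x))\<^sup>2 + g * \<eta> x t
              - (\<eta>t x + D\<eta> x \<bullet> Dq x)\<^sup>2 / (2 * (1 + (norm (D\<eta> x))\<^sup>2))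
            = \<sigma> / \<rho> * weak_div N x))"

end

theory Submission
  imports Defs
begin

text \<open>
  The error consists of the nonlinear terms of the Bernoulli condition, and these are bounded in
  \<open>L\<^sup>1\<close> by a multiple of \<open>\<epsilon>\<^sup>2\<close>; the Fourier transform of an integrable function is bounded by its
  \<open>L\<^sup>1\<close> norm, uniformly in the frequency.

  The kinetic terms are harmless: by the Cauchy-Schwarz inequality
  \<open>(\<eta>\<^sub>t + \<nabla>\<eta> \<bullet> \<nabla>q)\<^sup>2 \<le> (1 + \<bar>\<nabla>\<eta>\<bar>\<^sup>2) (\<eta>\<^sub>t\<^sup>2 + \<bar>\<nabla>q\<bar>\<^sup>2)\<close>, so the denominator cancels
  (\<open>kinetic_term_le\<close>).  The curvature is the divergence of \<open>N(\<nabla>\<eta>)\<close> with \<open>N(p) = p / \<surd>(1 + \<bar>p\<bar>\<^sup>2)\<close>,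
  and \<open>\<bar>DN(p) v - v\<bar> \<le> 2 \<bar>p\<bar> \<bar>v\<bar>\<close>.  By the chain rule, the curvature minus the Laplacian of
  \<open>\<eta>\<close> is at most a sum of products of first and second derivatives of \<open>\<eta>\<close>, whose \<open>L\<^sup>1\<close> norm is
  controlled by the square of the \<open>H\<^sup>2\<close> norm (\<open>curvature_remainder_le\<close>).

  All derivatives are weak, so the substance lies in the chain rule for weak derivatives
  (\<open>weak_chain_rule\<close>).  It rests on difference quotients: a function with a weak derivative in
  direction \<open>b\<close> satisfies the fundamental theorem of calculus on almost every segment
  (\<open>weak_increment\<close>), and translation is continuous in the mean
  (\<open>integrable_mean_continuous\<close>), hence difference quotients converge to the weak derivative locally
  in \<open>L\<^sup>1\<close> (\<open>difference_quotient_mean\<close>).  The du Bois-Reymond lemma, proved with explicit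
  test functions on boxes, identifies the chosen weak gradients and divergences almost everywhere with
  the functions so computed.

  The equation thus reads \<open>q\<^sub>t + g \<eta> - (\<sigma>/\<rho>) \<Delta>\<eta> = F\<close> almost everywhere, with \<open>F\<close> small in \<open>L\<^sup>1\<close>.
  Passing to Fourier transforms of tempered distributions requires that the Fourier transform
  preserves Schwartz functions (\<open>fourier_schwartz\<close>) and that weak derivatives of square
  integrable functions may be tested against Schwartz functions (\<open>weak_deriv_schwartz\<close>).
\<close>

section \<open>Smooth functions\<close>

lemma pds_append: "pds (bs @ cs) f = pds bs (pds cs f)"
  by (induct bs) auto

lemma pd_eqI: "(f has_derivative f') (at x) \<Longrightarrow> pd b f x = f' b"
  unfolding pd_def using frechet_derivative_at by metis

lemma has_derivative_pd: "f differentiable (at x) \<Longrightarrow> (f has_derivative (\<lambda>h. pd h f x)) (at x)"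
  unfolding pd_def using frechet_derivative_works by metis

lemma pd_add:
  assumes "\<And>x. f differentiable (at x)" "\<And>x. g differentiable (at x)"
  shows "pd b (\<lambda>x. f x + g x) = (\<lambda>x. pd b f x + pd b g x)"
  by (rule ext, rule pd_eqI) (intro has_derivative_add has_derivative_pd assms)

lemma differentiable_bounded_linear:
  fixes f :: "'a::euclidean_space \<Rightarrow> 'b::real_normed_vector"
  assumes "bounded_linear L" "f differentiable (at x)"
  shows "(\<lambda>x. L (f x)) differentiable (at x)"
  using bounded_linear.has_derivative[OF assms(1) has_derivative_pd[OF assms(2)]]
  by (auto simp: differentiable_def)

lemma pd_bounded_linear:
  assumes "bounded_linear L" "\<And>x. f differentiable (at x)"
  shows "pd b (\<lambda>x. L (f x)) = (\<lambda>x. L (pd b f x))"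
  by (rule ext, rule pd_eqI, rule bounded_linear.has_derivative[OF assms(1)],
      rule has_derivative_pd, rule assms(2))

lemma pd_mult:
  fixes f g :: "'a::euclidean_space \<Rightarrow> 'b::real_normed_algebra"
  assumes "\<And>x. f differentiable (at x)" "\<And>x. g differentiable (at x)"
  shows "pd b (\<lambda>x. f x * g x) = (\<lambda>x. pd b f x * g x + f x * pd b g x)"
proof (rule ext)
  fix x
  have "((\<lambda>x. f x * g x) has_derivative (\<lambda>h. f x * pd h g x + pd h f x * g x)) (at x)"
    by (intro has_derivative_mult has_derivative_pd assms)
  from pd_eqI[OF this, of b] show "pd b (\<lambda>x. f x * g x) x = pd b f x * g x + f x * pd b g x"
    by simp
qed

lemma smooth_differentiable: "smooth f \<Longrightarrow> f differentiable (at x)"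
  unfolding smooth_def by (metis empty_set empty_subsetI pds.simps(1))

lemma smooth_pd:
  fixes f :: "'a::euclidean_space \<Rightarrow> 'b::real_normed_vector"
  shows "smooth f \<Longrightarrow> b \<in> Basis \<Longrightarrow> smooth (pd b f)"
  unfolding smooth_def
proof (intro allI impI)
  fix bs :: "'a list" and x :: 'a
  assume *: "\<forall>bs. set bs \<subseteq> Basis \<longrightarrow> (\<forall>x. pds bs f differentiable (at x))" "b \<in> Basis" "set bs \<subseteq> Basis"
  have "pds bs (pd b f) = pds (bs @ [b]) f" by (simp add: pds_append)
  then show "pds bs (pd b f) differentiable (at x)" using * by simp
qed

lemma smooth_pds: "smooth f \<Longrightarrow> set bs \<subseteq> Basis \<Longrightarrow> smooth (pds bs f)"
  by (induct bs) (simp_all add: smooth_pd)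

text \<open>A coinduction principle up to sums: the Leibniz rule turns a product into a sum of two
  products, so a class of products is closed under differentiation only up to sums.  The predicate
  \<open>Q\<close> is differentiability for smoothness, and differentiability with rapid decay for Schwartz
  functions.\<close>

lemma derivatives_coinduct:
  fixes f :: "'a::euclidean_space \<Rightarrow> 'b::real_normed_vector"
  assumes Qd: "\<And>f x. Q f \<Longrightarrow> f differentiable (at x)"
    and Qadd: "\<And>f g. Q f \<Longrightarrow> Q g \<Longrightarrow> Q (\<lambda>x. f x + g x)"
    and PQ: "\<And>f. P f \<Longrightarrow> Q f"
    and step: "\<And>f b. P f \<Longrightarrow> b \<in> Basis \<Longrightarrow> \<exists>g h. P g \<and> P h \<and> pd b f = (\<lambda>x. g x + h x)"
    and "P f" "set bs \<subseteq> Basis"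
  shows "Q (pds bs f)"
proof -
  define L where "L n f \<longleftrightarrow> (\<forall>bs. length bs \<le> n \<longrightarrow> set bs \<subseteq> Basis \<longrightarrow> Q (pds bs f))"
    for n and f :: "'a \<Rightarrow> 'b"
  have add: "pds bs (\<lambda>x. f x + g x) = (\<lambda>x. pds bs f x + pds bs g x)"
    if "L n f" "L n g" "length bs \<le> n" "set bs \<subseteq> Basis" for n bs f g
    using that(3,4)
  proof (induct bs)
    case (Cons b bs)
    then have "Q (pds bs f)" "Q (pds bs g)" using that(1,2) by (auto simp: L_def)
    then show ?case using Cons by (simp add: pd_add Qd)
  qed simp
  have Ladd: "L n (\<lambda>x. f x + g x)" if "L n f" "L n g" for n f g
    using add[OF that] that Qadd by (simp add: L_def)
  have "L n f" if "P f" for n f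
    using that
  proof (induct n arbitrary: f)
    case 0
    then show ?case using PQ by (simp add: L_def)
  next
    case (Suc n)
    have "Q (pds bs f)" if bs: "length bs \<le> Suc n" "set bs \<subseteq> Basis" for bs
    proof (cases bs rule: rev_cases)
      case Nil
      then show ?thesis using PQ Suc by simp
    next
      case (snoc cs b)
      then obtain g h where gh: "P g" "P h" "pd b f = (\<lambda>x. g x + h x)"
        using step[of f b] Suc bs by auto
      have "L n (pd b f)" unfolding gh by (intro Ladd Suc gh)
      then show ?thesis using snoc bs by (simp add: pds_append L_def)
    qed
    then show ?case by (simp add: L_def)
  qed
  then show ?thesis using assms(5,6) by (auto simp: L_def)
qed

lemma smooth_coinduct:
  fixes f :: "'a::euclidean_space \<Rightarrow> 'b::real_normed_vector"
  assumes "P f" and "\<And>f x. P f \<Longrightarrow> f differentiable (at x)"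
    and "\<And>f b. P f \<Longrightarrow> b \<in> Basis \<Longrightarrow> \<exists>g h. P g \<and> P h \<and> pd b f = (\<lambda>x. g x + h x)"
  shows "smooth f"
  unfolding smooth_def
proof (intro allI impI)
  fix bs :: "'a list" and x
  assume bs: "set bs \<subseteq> Basis"
  have "\<forall>x. pds bs f differentiable (at x)"
    by (rule derivatives_coinduct[where Q="\<lambda>f. \<forall>x. f differentiable (at x)" and P=P])
      (use assms bs in \<open>auto intro: differentiable_add\<close>)
  then show "pds bs f differentiable (at x)" ..
qed

lemma smooth_mult:
  fixes f g :: "'a::euclidean_space \<Rightarrow> 'b::real_normed_algebra"
  assumes "smooth f" "smooth g"
  shows "smooth (\<lambda>x. f x * g x)"
proof (rule smooth_coinduct[where P="\<lambda>F. \<exists>f g. smooth f \<and> smooth g \<and> F = (\<lambda>x. f x * g x)"])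
  fix F :: "'a \<Rightarrow> 'b" and b :: 'a
  assume "\<exists>f g. smooth f \<and> smooth g \<and> F = (\<lambda>x. f x * g x)" "b \<in> Basis"
  then obtain f g where fg: "smooth f" "smooth g" "F = (\<lambda>x. f x * g x)" by blast
  have "pd b F = (\<lambda>x. pd b f x * g x + f x * pd b g x)"
    unfolding fg by (rule pd_mult) (auto intro: smooth_differentiable fg)
  then show "\<exists>g h. (\<exists>f ga. smooth f \<and> smooth ga \<and> g = (\<lambda>x. f x * ga x)) \<and>
             (\<exists>f g. smooth f \<and> smooth g \<and> h = (\<lambda>x. f x * g x)) \<and> pd b F = (\<lambda>x. g x + h x)"
    using smooth_pd[OF fg(1) \<open>b \<in> Basis\<close>] smooth_pd[OF fg(2) \<open>b \<in> Basis\<close>] fg(1,2) by blast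
qed (use assms in \<open>auto intro: differentiable_mult smooth_differentiable\<close>)

lemma pds_bounded_linear:
  assumes "bounded_linear L" "smooth f" "set bs \<subseteq> Basis"
  shows "pds bs (\<lambda>x. L (f x)) = (\<lambda>x. L (pds bs f x))"
  using assms(3)
  by (induct bs) (auto intro!: pd_bounded_linear assms smooth_differentiable smooth_pds)

lemma smooth_bounded_linear:
  assumes "bounded_linear L" "smooth f"
  shows "smooth (\<lambda>x. L (f x))"
  unfolding smooth_def
  using assms
  by (auto simp: pds_bounded_linear
      intro!: differentiable_bounded_linear[OF assms(1) smooth_differentiable[OF smooth_pds]])

lemma pd_const [simp]: "pd b (\<lambda>x. c) = (\<lambda>x. 0)"
  by (rule ext, rule pd_eqI[where f'="\<lambda>_. 0"]) simp

lemma smooth_const [simp]: "smooth (\<lambda>x::'a::euclidean_space. c::'b::real_normed_vector)"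
proof (rule smooth_coinduct[where P="\<lambda>f. \<exists>c. f = (\<lambda>x. c)"])
  fix f :: "'a \<Rightarrow> 'b" and b
  assume "\<exists>c. f = (\<lambda>x. c)"
  then have "pd b f = (\<lambda>x. 0 + 0)" by auto
  then show "\<exists>g h. (\<exists>c. g = (\<lambda>x. c)) \<and> (\<exists>c. h = (\<lambda>x. c)) \<and> pd b f = (\<lambda>x. g x + h x)" by blast
qed auto

lemma smooth_prod:
  fixes f :: "'i \<Rightarrow> 'a::euclidean_space \<Rightarrow> real"
  assumes "finite I" "\<And>i. i \<in> I \<Longrightarrow> smooth (f i)"
  shows "smooth (\<lambda>x. \<Prod>i\<in>I. f i x)"
  using assms by (induct I rule: finite_induct) (auto intro: smooth_mult)

lemma pd_affine:
  fixes f :: "'a::euclidean_space \<Rightarrow> 'b::real_normed_vector"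
  assumes "\<And>x. f differentiable (at x)"
  shows "pd b (\<lambda>x. f (c *\<^sub>R x + a)) = (\<lambda>x. c *\<^sub>R pd b f (c *\<^sub>R x + a))"
proof (rule ext)
  fix x
  have "((\<lambda>x. c *\<^sub>R x + a) has_derivative (\<lambda>h. c *\<^sub>R h)) (at x)"
    by (auto intro!: derivative_eq_intros)
  from has_derivative_compose[OF this has_derivative_pd[OF assms]]
  have *: "((\<lambda>x. f (c *\<^sub>R x + a)) has_derivative (\<lambda>h. pd (c *\<^sub>R h) f (c *\<^sub>R x + a))) (at x)"
    by simp
  have "pd (c *\<^sub>R b) f y = c *\<^sub>R pd b f y" for y
    using linear_scale[OF bounded_linear.linear[OF
          has_derivative_bounded_linear[OF has_derivative_pd[OF assms, of y]]], of c b] .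
  with pd_eqI[OF *, of b] show "pd b (\<lambda>x. f (c *\<^sub>R x + a)) x = c *\<^sub>R pd b f (c *\<^sub>R x + a)"
    by simp
qed

lemma differentiable_affine:
  fixes f :: "'a::euclidean_space \<Rightarrow> 'b::real_normed_vector"
  assumes "\<And>x. f differentiable (at x)"
  shows "(\<lambda>x. f (c *\<^sub>R x + a)) differentiable (at x)"
proof -
  have "(f \<circ> (\<lambda>x. c *\<^sub>R x + a)) differentiable (at x)"
    by (rule differentiable_chain_at) (auto intro!: assms derivative_intros)
  then show ?thesis by (simp add: o_def)
qed

lemma smooth_affine:
  fixes f :: "'a::euclidean_space \<Rightarrow> 'b::real_normed_vector"
  assumes "smooth f"
  shows "smooth (\<lambda>x. f (c *\<^sub>R x + a))"
proof (rule smooth_coinduct[where P="\<lambda>F. \<exists>k f. smooth f \<and> F = (\<lambda>x. k *\<^sub>R f (c *\<^sub>R x + a))"])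
  show "\<exists>k g. smooth g \<and> (\<lambda>x. f (c *\<^sub>R x + a)) = (\<lambda>x. k *\<^sub>R g (c *\<^sub>R x + a))"
    by (rule exI[of _ 1]) (use assms in auto)
next
  fix F :: "'a \<Rightarrow> 'b" and b :: 'a
  assume "\<exists>k f. smooth f \<and> F = (\<lambda>x. k *\<^sub>R f (c *\<^sub>R x + a))" and b: "b \<in> Basis"
  then obtain k f where f: "smooth f" and F: "F = (\<lambda>x. k *\<^sub>R f (c *\<^sub>R x + a))" by blast
  have "pd b F = (\<lambda>x. k *\<^sub>R pd b (\<lambda>x. f (c *\<^sub>R x + a)) x)"
    unfolding F by (rule pd_bounded_linear) (auto intro: bounded_linear_scaleR_right
        differentiable_affine smooth_differentiable f)
  then have "pd b F = (\<lambda>x. (k * c) *\<^sub>R pd b f (c *\<^sub>R x + a) + 0 *\<^sub>R f (c *\<^sub>R x + a))"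
    by (simp add: pd_affine smooth_differentiable f)
  then show "\<exists>g h. (\<exists>k f. smooth f \<and> g = (\<lambda>x. k *\<^sub>R f (c *\<^sub>R x + a))) \<and>
        (\<exists>k f. smooth f \<and> h = (\<lambda>x. k *\<^sub>R f (c *\<^sub>R x + a))) \<and> pd b F = (\<lambda>x. g x + h x)"
    using f smooth_pd[OF f b] by blast
next
  fix F :: "'a \<Rightarrow> 'b" and x
  assume "\<exists>k f. smooth f \<and> F = (\<lambda>x. k *\<^sub>R f (c *\<^sub>R x + a))"
  then show "F differentiable (at x)"
    by (auto intro!: differentiable_bounded_linear[OF bounded_linear_scaleR_right
          differentiable_affine[OF smooth_differentiable]])
qed

section \<open>Smooth functions of compact support\<close>

text \<open>The functions \<open>p(1/t) exp(-1/t)\<close>, extended by 0 to \<open>t \<le> 0\<close>, form a class that is closed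
  under differentiation, which makes \<open>exp(-1/t)\<close> smooth at the origin.\<close>

definition flat :: "real poly \<Rightarrow> real \<Rightarrow> real" where
  "flat p t = (if t > 0 then poly p (1 / t) * exp (- (1 / t)) else 0)"

lemma flat_tendsto_0: "((\<lambda>t. flat p t / t) \<longlongrightarrow> 0) (at 0)"
proof -
  have A: "((\<lambda>x. poly q x * exp (- x)) \<longlongrightarrow> 0) at_top" for q :: "real poly"
  proof -
    have "((\<lambda>x. \<Sum>i\<le>degree q. coeff q i * (x ^ i / exp x)) \<longlongrightarrow> (\<Sum>i\<le>degree q. coeff q i * 0)) at_top"
      by (intro tendsto_intros tendsto_power_div_exp_0)
    then show ?thesis
      by (simp add: poly_altdef sum_distrib_right exp_minus divide_inverse mult.assoc)
  qed
  have "((\<lambda>t. poly ([:0,1:] * p) (inverse t) * exp (- inverse t)) \<longlongrightarrow> 0) (at_right 0)"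
    by (rule filterlim_compose[OF A filterlim_inverse_at_top_right])
  moreover have "\<forall>\<^sub>F t in at_right 0. poly ([:0,1:] * p) (inverse t) * exp (- inverse t) = flat p t / t"
    by (rule eventually_at_rightI[of 0 1]) (auto simp: flat_def field_simps)
  ultimately have "((\<lambda>t. flat p t / t) \<longlongrightarrow> 0) (at_right 0)"
    by (rule Lim_transform_eventually)
  moreover have "((\<lambda>t. flat p t / t) \<longlongrightarrow> 0) (at_left 0)"
    by (rule Lim_transform_eventually[of "\<lambda>_. 0"])
      (auto intro!: eventually_at_leftI[of "-1" 0] simp: flat_def)
  ultimately show ?thesis by (simp add: filterlim_split_at)
qed

lemma DERIV_flat: "(flat p has_real_derivative flat (monom 1 2 * (p - pderiv p)) t) (at t)"
proof -
  consider "t > 0" | "t < 0" | "t = 0" by linarith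
  then show ?thesis
  proof cases
    case 1
    have "((\<lambda>t. poly p (1 / t) * exp (- (1 / t))) has_real_derivative
        flat (monom 1 2 * (p - pderiv p)) t) (at t)"
      using 1 by (auto intro!: derivative_eq_intros DERIV_chain2[OF poly_DERIV]
          simp: flat_def poly_monom field_simps power2_eq_square)
    then show ?thesis
      by (rule has_field_derivative_transform_within_open[where S="{0<..}"]) (use 1 in \<open>auto simp: flat_def\<close>)
  next
    case 2
    have "((\<lambda>t. 0) has_real_derivative flat (monom 1 2 * (p - pderiv p)) t) (at t)"
      using 2 by (auto simp: flat_def)
    then show ?thesis
      by (rule has_field_derivative_transform_within_open[where S="{..<0}"]) (use 2 in \<open>auto simp: flat_def\<close>)
  next
    case 3
    then show ?thesis
      using flat_tendsto_0[of p] by (simp add: has_field_derivative_iff) (simp add: flat_def)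
  qed
qed

lemma smooth_flat_affine: "smooth (\<lambda>x::'a::euclidean_space. flat p (x \<bullet> v + c))"
proof (rule smooth_coinduct[where P="\<lambda>F. \<exists>k p. F = (\<lambda>x. k * flat p (x \<bullet> v + c))"])
  show "\<exists>k q. (\<lambda>x. flat p (x \<bullet> v + c)) = (\<lambda>x. k * flat q (x \<bullet> v + c))"
    by (rule exI[of _ 1]) auto
next
  have *: "((\<lambda>x::'a. k * flat p (x \<bullet> v + c)) has_derivative
      (\<lambda>h. k * ((h \<bullet> v) * flat (monom 1 2 * (p - pderiv p)) (x \<bullet> v + c)))) (at x)" for k p x
  proof -
    have "((\<lambda>x. x \<bullet> v + c) has_derivative (\<lambda>h. h \<bullet> v)) (at x)"
      by (auto intro!: derivative_eq_intros)
    from has_derivative_compose[OF this DERIV_flat[unfolded has_field_derivative_def]]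
    have "((\<lambda>x. flat p (x \<bullet> v + c)) has_derivative
        (\<lambda>h. (h \<bullet> v) * flat (monom 1 2 * (p - pderiv p)) (x \<bullet> v + c))) (at x)"
      by (simp add: mult.commute)
    then show ?thesis by (rule has_derivative_mult_right)
  qed
  fix F :: "'a \<Rightarrow> real" and b x :: 'a
  assume F: "\<exists>k p. F = (\<lambda>x. k * flat p (x \<bullet> v + c))"
  then show "F differentiable (at x)" using * by (auto simp: differentiable_def)
  from F obtain k p where F: "F = (\<lambda>x. k * flat p (x \<bullet> v + c))" by blast
  have "pd b F = (\<lambda>x. (k * (b \<bullet> v)) * flat (monom 1 2 * (p - pderiv p)) (x \<bullet> v + c)
         + 0 * flat p (x \<bullet> v + c))"
    unfolding F by (rule ext, subst pd_eqI[OF *]) simp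
  then show "\<exists>g h. (\<exists>k p. g = (\<lambda>x. k * flat p (x \<bullet> v + c))) \<and>
         (\<exists>k p. h = (\<lambda>x. k * flat p (x \<bullet> v + c))) \<and> pd b F = (\<lambda>x. g x + h x)" by blast
qed

text \<open>The product vanishes exactly off the open box, and inside it every factor tends to 1, so these
  test functions converge boundedly to the indicator of the box.\<close>

definition box_bump :: "'a::euclidean_space \<Rightarrow> 'a \<Rightarrow> nat \<Rightarrow> 'a \<Rightarrow> real" where
  "box_bump a c m x = (\<Prod>b\<in>Basis. flat 1 (x \<bullet> (real (Suc m) *\<^sub>R b) + - real (Suc m) * (a \<bullet> b)) *
     flat 1 (x \<bullet> (- real (Suc m) *\<^sub>R b) + real (Suc m) * (c \<bullet> b)))"

lemma flat_1_bounds: "0 \<le> flat 1 t" "flat 1 t \<le> 1" "flat 1 t = 0 \<longleftrightarrow> t \<le> 0"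
  by (auto simp: flat_def)

lemma box_bump_bounds: "0 \<le> box_bump a c m x" "box_bump a c m x \<le> 1"
  unfolding box_bump_def by (auto intro!: prod_nonneg prod_le_1 mult_le_one simp: flat_1_bounds)

lemma box_bump_nonzero_iff: "box_bump a c m x \<noteq> 0 \<longleftrightarrow> x \<in> box a c"
proof -
  have "0 < real (Suc m) * s + - real (Suc m) * r \<longleftrightarrow> r < s" for r s
  proof -
    have "real (Suc m) * s + - real (Suc m) * r = real (Suc m) * (s - r)"
      by (simp only: right_diff_distrib)
    then show ?thesis by (simp only: zero_less_mult_iff) auto
  qed
  from this this[where s="- s" and r="- r" for r s]
  show ?thesis
    by (auto simp: box_bump_def flat_1_bounds mem_box not_le simp del: of_nat_Suc)
qed

lemma box_bump_test_function: "box_bump a c m \<in> test_functions UNIV"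
  unfolding test_functions_def
proof (safe intro!: exI[of _ "cbox a c"])
  show "smooth (box_bump a c m)"
    unfolding box_bump_def by (intro smooth_prod smooth_mult smooth_flat_affine finite_Basis)
  show "box_bump a c m x = 0" if "x \<notin> cbox a c" for x
    using box_bump_nonzero_iff[of a c m x] box_subset_cbox[of a c] that by auto
qed auto

lemma flat_1_tendsto:
  assumes "s > 0" shows "(\<lambda>m. flat 1 (real (Suc m) * s)) \<longlonglongrightarrow> 1"
proof -
  have "(\<lambda>m. exp (- (inverse (real (Suc m)) * (1 / s)))) \<longlonglongrightarrow> exp (- (0 * (1 / s)))"
    by (intro tendsto_intros LIMSEQ_inverse_real_of_nat)
  moreover have "flat 1 (real (Suc m) * s) = exp (- (inverse (real (Suc m)) * (1 / s)))" for m
    using assms by (simp add: flat_def divide_inverse)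
  ultimately show ?thesis by simp
qed

lemma box_bump_tendsto: "(\<lambda>m. box_bump a c m x) \<longlonglongrightarrow> indicator (box a c) x"
proof (cases "x \<in> box a c")
  case True
  have "(\<lambda>m. \<Prod>b\<in>Basis. flat 1 (real (Suc m) * (x \<bullet> b - a \<bullet> b)) *
      flat 1 (real (Suc m) * (c \<bullet> b - x \<bullet> b))) \<longlonglongrightarrow> (\<Prod>b\<in>(Basis::'a set). 1 * 1)"
    using True by (intro tendsto_intros flat_1_tendsto) (auto simp: mem_box)
  then show ?thesis using True by (simp add: box_bump_def right_diff_distrib del: of_nat_Suc)
next
  case False
  then have "box_bump a c m x = 0" for m using box_bump_nonzero_iff[of a c m x] by auto
  then show ?thesis using False by simp
qed

section \<open>Lebesgue integration\<close>

lemma locally_integrable_measurable: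
  fixes f :: "'a::euclidean_space \<Rightarrow> real"
  assumes "locally_integrable UNIV f"
  shows "f \<in> borel_measurable lebesgue"
proof (rule borel_measurable_LIMSEQ_real)
  fix x :: 'a
  obtain N where "norm x \<le> real N" using real_arch_simple by blast
  then have "\<forall>\<^sub>F n in sequentially. indicator (cball 0 (real n)) x *\<^sub>R f x = f x"
    by (auto intro!: eventually_sequentiallyI[of N] simp: indicator_def)
  then show "(\<lambda>n. indicator (cball 0 (real n)) x *\<^sub>R f x) \<longlonglongrightarrow> f x"
    by (rule tendsto_eventually)
next
  fix n
  have "set_integrable lebesgue (cball 0 (real n)) f"
    using assms by (simp add: locally_integrable_def)
  then show "(\<lambda>x. indicator (cball 0 (real n)) x *\<^sub>R f x) \<in> borel_measurable lebesgue"
    by (simp add: set_integrable_def)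
qed

lemma borel_representative:
  fixes f :: "'a::euclidean_space \<Rightarrow> real"
  assumes "f \<in> borel_measurable lebesgue"
  obtains f' where "f' \<in> borel_measurable borel" "AE x in lebesgue. f x = f' x"
proof -
  obtain f' where "f' \<in> borel_measurable lborel" "AE x in lborel. f x = f' x"
    using completion_ex_borel_measurable_real[OF assms] by blast
  then show thesis by (intro that[of f']) (auto intro: AE_completion)
qed

text \<open>Boxes form an intersection-stable generator of the Borel sets, so the integral vanishes over
  every Borel subset of a large box, in particular over those where \<open>f\<close> is positive or negative.\<close>

lemma AE_zero_of_box_integrals:
  fixes f :: "'a::euclidean_space \<Rightarrow> real"
  assumes f: "locally_integrable UNIV f"
    and zero: "\<And>a c. (LINT x:box a c|lebesgue. f x) = 0"
  shows "AE x in lebesgue. f x = 0"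
proof -
  obtain f' where f'[measurable]: "f' \<in> borel_measurable borel" and eq: "AE x in lebesgue. f x = f' x"
    using borel_representative[OF locally_integrable_measurable[OF f]] .
  have "AE x in lborel. x \<in> box (- (real n *\<^sub>R One)) (real n *\<^sub>R One) \<longrightarrow> f' x = 0" for n
  proof -
    define B :: "'a set" where "B = box (- (real n *\<^sub>R One)) (real n *\<^sub>R One)"
    have [measurable]: "B \<in> sets borel" by (simp add: B_def)
    define g where "g x = indicator B x * f' x" for x
    have [measurable]: "g \<in> borel_measurable borel" unfolding g_def[abs_def] by measurable
    have "set_integrable lebesgue (cbox (- (real n *\<^sub>R One)) (real n *\<^sub>R One)) f"
      using f by (simp add: locally_integrable_def)
    then have "set_integrable lebesgue B f"
      by (rule set_integrable_subset) (auto simp: B_def box_subset_cbox)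
    then have "integrable lebesgue g"
      unfolding set_integrable_def
      by (rule integrable_cong_AE_imp) (use eq in \<open>auto simp: g_def elim!: eventually_mono intro: measurable_completion\<close>)
    then have ig: "integrable lborel g" by (simp add: integrable_completion)
    have iA: "integrable lborel (\<lambda>x. indicator A x * g x)" if "A \<in> sets borel" for A
      using integrable_real_mult_indicator[of A lborel g] ig that by (simp add: mult.commute)
    have Z: "(LINT x|lborel. indicator (box a c) x * g x) = 0" for a c
    proof -
      obtain a' c' where bx: "box a c \<inter> B = box a' c'"
        unfolding B_def box_Int_box by blast
      have "(LINT x|lborel. indicator (box a c) x * g x) = (LINT x|lebesgue. indicator (box a c) x * g x)"
        by (subst integral_completion) auto
      also have "\<dots> = (LINT x|lebesgue. indicator (box a' c') x *\<^sub>R f x)"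
      proof (rule integral_cong_AE)
        show "(\<lambda>x. indicator (box a c) x * g x) \<in> borel_measurable lebesgue"
          by (rule measurable_completion) simp
        show "(\<lambda>x. indicator (box a' c') x *\<^sub>R f x) \<in> borel_measurable lebesgue"
          by (rule borel_measurable_scaleR[OF borel_measurable_indicator locally_integrable_measurable[OF f]]) simp
        show "AE x in lebesgue. indicator (box a c) x * g x = indicator (box a' c') x *\<^sub>R f x"
          using eq by eventually_elim (simp add: g_def bx[symmetric] indicator_inter_arith)
      qed
      also have "\<dots> = 0" using zero[of a' c'] by (simp add: set_lebesgue_integral_def)
      finally show ?thesis .
    qed
    have tot: "(LINT x|lborel. g x) = 0"
    proof -
      have "(\<lambda>x. indicator B x * g x) = g" by (auto simp: g_def indicator_def fun_eq_iff)
      then show ?thesis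
        using Z[of "- (real n *\<^sub>R One)" "real n *\<^sub>R One"] unfolding B_def[symmetric] by simp
    qed
    have ZA: "(LINT x|lborel. indicator A x * g x) = 0" if "A \<in> sets borel" for A
    proof -
      have st: "Int_stable (range (\<lambda>(a, c). box a c :: 'a set))"
        by (auto simp: Int_stable_def box_Int_box)
      moreover have "range (\<lambda>(a, c). box a c :: 'a set) \<subseteq> Pow UNIV" by auto
      moreover have "A \<in> sigma_sets UNIV (range (\<lambda>(a, c). box a c :: 'a set))"
        using that by (simp add: borel_eq_box)
      ultimately show ?thesis
      proof (induct A rule: sigma_sets_induct_disjoint)
        case (compl A)
        have A: "A \<in> sets borel" using compl by (simp add: borel_eq_box)
        have "indicator (UNIV - A) x * g x = g x - indicator A x * g x" for x
          by (simp add: indicator_def)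
        then show ?case using A compl by (simp add: iA ig tot)
      next
        case (union A)
        have A: "A i \<in> sets borel" for i using union by (auto simp: borel_eq_box)
        have "(LINT x:(\<Union>i. A i)|lborel. g x) = (\<Sum>i. (LINT x:A i|lborel. g x))"
          by (rule lebesgue_integral_countable_add)
            (use union A iA in \<open>auto simp: disjoint_family_on_def set_integrable_def\<close>)
        then show ?case using union by (simp add: set_lebesgue_integral_def)
      qed (use Z in auto)
    qed
    have pos: "AE x in lborel. indicator {x. s * g x > 0} x * (s * g x) = 0" for s
    proof -
      have [measurable]: "{x. s * g x > 0} \<in> sets borel" by measurable
      have "(LINT x|lborel. s * (indicator {x. s * g x > 0} x * g x)) = 0"
        using ZA[of "{x. s * g x > 0}"] by simp
      then have "(LINT x|lborel. indicator {x. s * g x > 0} x * (s * g x)) = 0"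
        by (simp add: mult.left_commute)
      moreover have "integrable lborel (\<lambda>x. indicator {x. s * g x > 0} x * (s * g x))"
        using integrable_mult_right[OF iA[of "{x. s * g x > 0}"], of s] by (simp add: mult.left_commute)
      ultimately show ?thesis
        by (subst (asm) integral_nonneg_eq_0_iff_AE) (auto simp: indicator_def)
    qed
    show ?thesis
      using pos[of 1] pos[of "-1"]
      by eventually_elim (auto simp: g_def B_def indicator_def split: if_splits)
  qed
  then have "AE x in lborel. \<forall>n. x \<in> box (- (real n *\<^sub>R One)) (real n *\<^sub>R One) \<longrightarrow> f' x = 0"
    unfolding AE_all_countable by blast
  then have "AE x in lborel. f' x = 0"
  proof eventually_elim
    case (elim x)
    obtain n where "norm x < real n" using reals_Archimedean2 by blast
    then have "x \<in> box (- (real n *\<^sub>R One)) (real n *\<^sub>R One)"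
      using Basis_le_norm[of _ x] by (fastforce simp: mem_box abs_le_iff)
    then show ?case using elim by blast
  qed
  then have "AE x in lebesgue. f' x = 0" by (rule AE_completion)
  with eq show ?thesis by eventually_elim simp
qed

lemma test_function_continuous: "\<psi> \<in> test_functions U \<Longrightarrow> continuous_on S \<psi>"
  by (auto simp: test_functions_def intro!: continuous_at_imp_continuous_on
      differentiable_imp_continuous_within smooth_differentiable)

lemma test_function_measurable:
  assumes "\<psi> \<in> test_functions U"
  shows "\<psi> \<in> borel_measurable borel"
  by (rule borel_measurable_continuous_onI[OF test_function_continuous[OF assms]])

lemma test_function_measurable_lebesgue:
  assumes "\<psi> \<in> test_functions U"
  shows "\<psi> \<in> borel_measurable lebesgue"
  by (rule measurable_completion) (simp add: test_function_measurable[OF assms])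

lemma test_function_support:
  assumes "\<psi> \<in> test_functions U"
  obtains K C where "compact K" "K \<subseteq> U" "\<And>x. x \<notin> K \<Longrightarrow> \<psi> x = 0" "\<And>x. \<bar>\<psi> x\<bar> \<le> C" "C \<ge> 0"
proof -
  obtain K where K: "compact K" "K \<subseteq> U" "\<And>x. x \<notin> K \<Longrightarrow> \<psi> x = 0"
    using assms by (auto simp: test_functions_def)
  have "bounded (\<psi> ` K)"
    by (intro compact_imp_bounded compact_continuous_image test_function_continuous[OF assms] K)
  then obtain C where C: "\<And>x. x \<in> K \<Longrightarrow> \<bar>\<psi> x\<bar> \<le> C" by (auto simp: bounded_iff)
  have "\<bar>\<psi> x\<bar> \<le> max C 0" for x using C[of x] K(3)[of x] by (cases "x \<in> K") auto
  then show thesis using K that by (metis max.cobounded2)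
qed

lemma pd_test_function:
  assumes "\<psi> \<in> test_functions UNIV" "b \<in> Basis"
  shows "pd b \<psi> \<in> test_functions UNIV"
proof -
  obtain K where K: "compact K" "\<And>x. x \<notin> K \<Longrightarrow> \<psi> x = 0" and sm: "smooth \<psi>"
    using assms by (auto simp: test_functions_def)
  have "pd b \<psi> x = 0" if "x \<notin> K" for x
  proof -
    have "((\<lambda>_. 0) has_derivative (\<lambda>_. 0)) (at x)" by simp
    then have "(\<psi> has_derivative (\<lambda>_. 0)) (at x)"
      by (rule has_derivative_transform_within_open[of _ _ _ _ "- K"])
        (use K that in \<open>auto simp: open_Compl compact_imp_closed\<close>)
    then show ?thesis by (rule pd_eqI)
  qed
  with K sm assms(2) show ?thesis by (auto simp: test_functions_def smooth_pd)
qed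

lemma integrable_locally_integrable_mult:
  fixes f \<psi> :: "'a::euclidean_space \<Rightarrow> real"
  assumes f: "locally_integrable UNIV f" and \<psi>: "\<psi> \<in> borel_measurable lebesgue"
    and "compact K" "\<And>x. x \<notin> K \<Longrightarrow> \<psi> x = 0" "\<And>x. \<bar>\<psi> x\<bar> \<le> C"
  shows "integrable lebesgue (\<lambda>x. f x * \<psi> x)"
proof (rule Bochner_Integration.integrable_bound)
  show "integrable lebesgue (\<lambda>x. C * (indicator K x * f x))"
    using f assms(3) by (intro integrable_mult_right) (auto simp: locally_integrable_def set_integrable_def)
  show "(\<lambda>x. f x * \<psi> x) \<in> borel_measurable lebesgue"
    using locally_integrable_measurable[OF f] \<psi> by simp
  have "\<bar>f x * \<psi> x\<bar> \<le> \<bar>C * (indicator K x * f x)\<bar>" for x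
    using assms(4)[of x] mult_mono[OF order_trans[OF assms(5)[of x] abs_ge_self] order_refl, of "\<bar>f x\<bar>"]
    by (cases "x \<in> K") (auto simp: abs_mult mult.commute)
  then show "AE x in lebesgue. norm (f x * \<psi> x) \<le> norm (C * (indicator K x * f x))" by simp
qed

lemma integrable_mult_test_function:
  fixes f :: "'a::euclidean_space \<Rightarrow> real"
  assumes "locally_integrable UNIV f" "\<psi> \<in> test_functions UNIV"
  shows "integrable lebesgue (\<lambda>x. f x * \<psi> x)"
proof -
  obtain K C where "compact K" "\<And>x. x \<notin> K \<Longrightarrow> \<psi> x = 0" "\<And>x. \<bar>\<psi> x\<bar> \<le> C"
    using test_function_support[OF assms(2)] by metis
  then show ?thesis
    using assms by (intro integrable_locally_integrable_mult) (auto intro: test_function_measurable_lebesgue)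
qed

lemma locally_integrable_diff:
  "locally_integrable U f \<Longrightarrow> locally_integrable U g \<Longrightarrow> locally_integrable U (\<lambda>x. f x - g x)"
  by (auto simp: locally_integrable_def intro: set_integral_diff)

text \<open>The du Bois-Reymond lemma: a locally integrable function that is orthogonal to all test
  functions has vanishing integral over every box, because test functions converge boundedly to
  the indicator of the box.\<close>

lemma du_Bois_Reymond:
  fixes f :: "'a::euclidean_space \<Rightarrow> real"
  assumes f: "locally_integrable UNIV f"
    and zero: "\<And>\<psi>. \<psi> \<in> test_functions UNIV \<Longrightarrow> (LINT x|lebesgue. f x * \<psi> x) = 0"
  shows "AE x in lebesgue. f x = 0"
proof (rule AE_zero_of_box_integrals[OF f])
  fix a c :: 'a
  note [measurable] = locally_integrable_measurable[OF f]
  have "(\<lambda>m. LINT x|lebesgue. f x * box_bump a c m x) \<longlonglongrightarrow> (LINT x|lebesgue. f x * indicator (box a c) x)"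
  proof (rule integral_dominated_convergence[where w="\<lambda>x. \<bar>indicator (cbox a c) x * f x\<bar>"])
    show "integrable lebesgue (\<lambda>x. \<bar>indicator (cbox a c) x * f x\<bar>)"
      using f by (intro integrable_abs) (auto simp: locally_integrable_def set_integrable_def)
    show "AE x in lebesgue. (\<lambda>m. f x * box_bump a c m x) \<longlonglongrightarrow> f x * indicator (box a c) x"
      by (intro AE_I2 tendsto_intros box_bump_tendsto)
    show "AE x in lebesgue. norm (f x * box_bump a c m x) \<le> \<bar>indicator (cbox a c) x * f x\<bar>" for m
    proof (intro AE_I2)
      fix x
      show "norm (f x * box_bump a c m x) \<le> \<bar>indicator (cbox a c) x * f x\<bar>"
      proof (cases "x \<in> cbox a c")
        case True
        then show ?thesis
          using box_bump_bounds[where a=a and c=c and m=m and x=x]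
          by (simp add: abs_mult mult_left_le)
      next
        case False
        then have "box_bump a c m x = 0"
          using box_bump_nonzero_iff[of a c m x] box_subset_cbox[of a c] by auto
        then show ?thesis by simp
      qed
    qed
    show "(\<lambda>x. f x * indicator (box a c) x) \<in> borel_measurable lebesgue"
      by (intro borel_measurable_times) (auto intro: measurable_completion)
    show "(\<lambda>x. f x * box_bump a c m x) \<in> borel_measurable lebesgue" for m
      using integrable_mult_test_function[OF f box_bump_test_function] by auto
  qed
  then have "(LINT x|lebesgue. f x * indicator (box a c) x) = 0"
    using zero[OF box_bump_test_function] by (simp add: LIMSEQ_const_iff)
  then show "(LINT x:box a c|lebesgue. f x) = 0"
    by (simp add: set_lebesgue_integral_def mult.commute)
qed

lemma du_Bois_Reymond_eq:
  fixes f g :: "'a::euclidean_space \<Rightarrow> real"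
  assumes "locally_integrable UNIV f" "locally_integrable UNIV g"
    and "\<And>\<psi>. \<psi> \<in> test_functions UNIV \<Longrightarrow>
      (LINT x|lebesgue. f x * \<psi> x) = (LINT x|lebesgue. g x * \<psi> x)"
  shows "AE x in lebesgue. f x = g x"
proof -
  have "AE x in lebesgue. f x - g x = 0"
    by (rule du_Bois_Reymond)
      (use assms in \<open>auto intro!: locally_integrable_diff
        simp: left_diff_distrib integrable_mult_test_function\<close>)
  then show ?thesis by simp
qed

subsection \<open>Translations\<close>

lemma integrable_translate:
  fixes f :: "'a::euclidean_space \<Rightarrow> 'b::{banach, second_countable_topology}"
  assumes "integrable lborel f"
  shows "integrable lborel (\<lambda>x. f (x + c))"
  using assms
  by (subst (asm) lborel_distr_plus[of c, symmetric], subst (asm) integrable_distr_eq)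
    (auto simp: add.commute)

lemma integral_translate:
  fixes f :: "'a::euclidean_space \<Rightarrow> 'b::{banach, second_countable_topology}"
  assumes "f \<in> borel_measurable borel"
  shows "(LINT x|lborel. f (x + c)) = (LINT x|lborel. f x)"
  using assms
  by (subst (2) lborel_distr_plus[of c, symmetric]) (simp add: integral_distr add.commute)

definition mean_continuous :: "('a::euclidean_space \<Rightarrow> real) \<Rightarrow> bool" where
  "mean_continuous f \<longleftrightarrow> integrable lborel f \<and>
     (\<forall>h. h \<longlonglongrightarrow> 0 \<longrightarrow> (\<lambda>n::nat. LINT x|lborel. \<bar>f (x + h n) - f x\<bar>) \<longlonglongrightarrow> 0)"

lemma mean_continuous_approx:
  fixes f :: "'a::euclidean_space \<Rightarrow> real"
  assumes f: "integrable lborel f"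
    and approx: "\<And>e. e > 0 \<Longrightarrow> \<exists>g. mean_continuous g \<and> (LINT x|lborel. \<bar>f x - g x\<bar>) < e"
  shows "mean_continuous f"
  unfolding mean_continuous_def
proof (intro conjI f allI impI)
  fix h :: "nat \<Rightarrow> 'a" assume h: "h \<longlonglongrightarrow> 0"
  show "(\<lambda>n. LINT x|lborel. \<bar>f (x + h n) - f x\<bar>) \<longlonglongrightarrow> 0"
  proof (rule LIMSEQ_I)
    fix e :: real assume "e > 0"
    then obtain g where g: "mean_continuous g" "(LINT x|lborel. \<bar>f x - g x\<bar>) < e / 3"
      using approx[of "e/3"] by auto
    then have ig: "integrable lborel g" and
      lim: "(\<lambda>n. LINT x|lborel. \<bar>g (x + h n) - g x\<bar>) \<longlonglongrightarrow> 0"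
      using h by (auto simp: mean_continuous_def)
    from LIMSEQ_D[OF lim, of "e/3"] \<open>e > 0\<close> obtain N where
      N: "\<And>n. n \<ge> N \<Longrightarrow> (LINT x|lborel. \<bar>g (x + h n) - g x\<bar>) < e / 3" by force
    have "(LINT x|lborel. \<bar>f (x + h n) - f x\<bar>) < e" if "n \<ge> N" for n
    proof -
      have tr: "(LINT x|lborel. \<bar>f (x + h n) - g (x + h n)\<bar>) = (LINT x|lborel. \<bar>f x - g x\<bar>)"
        by (rule integral_translate[where f="\<lambda>x. \<bar>f x - g x\<bar>"]) (use f ig in auto)
      have "(LINT x|lborel. \<bar>f (x + h n) - f x\<bar>) \<le>
        (LINT x|lborel. \<bar>f (x + h n) - g (x + h n)\<bar> + \<bar>g (x + h n) - g x\<bar> + \<bar>f x - g x\<bar>)"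
        by (rule integral_mono)
          (use f ig in \<open>auto intro!: Bochner_Integration.integrable_add integrable_abs
             Bochner_Integration.integrable_diff integrable_translate\<close>)
      also have "\<dots> = (LINT x|lborel. \<bar>f (x + h n) - g (x + h n)\<bar>) +
          (LINT x|lborel. \<bar>g (x + h n) - g x\<bar>) + (LINT x|lborel. \<bar>f x - g x\<bar>)"
        using f ig by (simp add: integrable_translate)
      also have "\<dots> < e" using tr g(2) N[OF that] by simp
      finally show ?thesis .
    qed
    then show "\<exists>no. \<forall>n\<ge>no. norm ((LINT x|lborel. \<bar>f (x + h n) - f x\<bar>) - 0) < e" by auto
  qed
qed

text \<open>The difference \<open>\<bar>1\<^sub>U(x + h) - 1\<^sub>U(x)\<bar>\<close> has the same integral as twice its part where
  \<open>1\<^sub>U(x) = 1\<close>, by translation invariance; that part tends to 0 pointwise since \<open>U\<close> is open, and it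
  is dominated by \<open>1\<^sub>U\<close>.\<close>

lemma mean_continuous_open:
  fixes U :: "'a::euclidean_space set"
  assumes "open U" "emeasure lborel U < \<infinity>"
  shows "mean_continuous (indicator U)"
  unfolding mean_continuous_def
proof (intro conjI allI impI)
  have [measurable]: "U \<in> sets borel" using assms by simp
  show iU: "integrable lborel (indicator U :: 'a \<Rightarrow> real)"
    using assms by (simp add: integrable_indicator_iff)
  fix h :: "nat \<Rightarrow> 'a" assume h: "h \<longlonglongrightarrow> 0"
  have eq: "(LINT x|lborel. \<bar>indicator U (x + h n) - indicator U x\<bar>) =
      2 * (LINT x|lborel. indicator U x * (1 - indicator U (x + h n)) :: real)" for n
  proof -
    have "(LINT x|lborel. \<bar>indicator U (x + h n) - indicator U x\<bar>) =
      (LINT x|lborel. 2 * (indicator U x * (1 - indicator U (x + h n))) +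
        (indicator U (x + h n) - indicator U x) :: real)"
      by (rule Bochner_Integration.integral_cong) (auto simp: indicator_def)
    also have "\<dots> = (LINT x|lborel. 2 * (indicator U x * (1 - indicator U (x + h n))) :: real) +
        (LINT x|lborel. (indicator U (x + h n) - indicator U x) :: real)"
    proof (rule Bochner_Integration.integral_add)
      show "integrable lborel (\<lambda>x. 2 * (indicator U x * (1 - indicator U (x + h n))) :: real)"
        by (rule Bochner_Integration.integrable_bound[OF integrable_mult_right[OF iU, of 2]])
          (auto simp: indicator_def)
      show "integrable lborel (\<lambda>x. (indicator U (x + h n) - indicator U x) :: real)"
        by (intro Bochner_Integration.integrable_diff iU integrable_translate)
    qed
    also have "(LINT x|lborel. (indicator U (x + h n) - indicator U x) :: real) = 0"
      by (subst Bochner_Integration.integral_diff)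
        (auto intro!: iU integrable_translate integral_translate simp: integral_translate[of "indicator U"])
    finally show ?thesis by simp
  qed
  have "(\<lambda>n. LINT x|lborel. indicator U x * (1 - indicator U (x + h n)) :: real) \<longlonglongrightarrow> (LINT x::'a|lborel. (0::real))" 
  proof (rule integral_dominated_convergence[where w="indicator U"])
    show "AE x in lborel. (\<lambda>n. indicator U x * (1 - indicator U (x + h n)) :: real) \<longlonglongrightarrow> 0"
    proof (intro AE_I2)
      fix x
      show "(\<lambda>n. indicator U x * (1 - indicator U (x + h n)) :: real) \<longlonglongrightarrow> 0"
      proof (cases "x \<in> U")
        case True
        have "(\<lambda>n. x + h n) \<longlonglongrightarrow> x + 0" by (intro tendsto_intros h)
        then have "\<forall>\<^sub>F n in sequentially. x + h n \<in> U"
          using assms(1) True topological_tendstoD by fastforce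
        then have "\<forall>\<^sub>F n in sequentially. indicator U x * (1 - indicator U (x + h n)) = (0::real)"
          by (rule eventually_mono) simp
        then show ?thesis by (rule tendsto_eventually)
      qed simp
    qed
  qed (use iU in \<open>auto simp: indicator_def\<close>)
  then have "(\<lambda>n. 2 * (LINT x|lborel. indicator U x * (1 - indicator U (x + h n)) :: real)) \<longlonglongrightarrow> 2 * 0"
    by (intro tendsto_intros) simp
  then show "(\<lambda>n. LINT x|lborel. \<bar>indicator U (x + h n) - indicator U x :: real\<bar>) \<longlonglongrightarrow> 0"
    by (simp add: eq)
qed

lemma mean_continuous_add:
  assumes "mean_continuous f" "mean_continuous g"
  shows "mean_continuous (\<lambda>x. f x + g x)"
  unfolding mean_continuous_def
proof (intro conjI allI impI)
  have i: "integrable lborel f" "integrable lborel g" using assms by (auto simp: mean_continuous_def)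
  then show "integrable lborel (\<lambda>x. f x + g x)" by simp
  fix h :: "nat \<Rightarrow> 'a" assume h: "h \<longlonglongrightarrow> 0"
  show "(\<lambda>n. LINT x|lborel. \<bar>f (x + h n) + g (x + h n) - (f x + g x)\<bar>) \<longlonglongrightarrow> 0"
  proof (rule tendsto_sandwich[OF _ _ tendsto_const])
    show "(\<lambda>n. (LINT x|lborel. \<bar>f (x + h n) - f x\<bar>) + (LINT x|lborel. \<bar>g (x + h n) - g x\<bar>)) \<longlonglongrightarrow> 0"
      using assms h by (auto simp: mean_continuous_def intro!: tendsto_add_zero)
    have "(LINT x|lborel. \<bar>f (x + h n) + g (x + h n) - (f x + g x)\<bar>) \<le>
       (LINT x|lborel. \<bar>f (x + h n) - f x\<bar> + \<bar>g (x + h n) - g x\<bar>)" for n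
      by (rule integral_mono) (use i in \<open>auto intro!: Bochner_Integration.integrable_add integrable_abs
             Bochner_Integration.integrable_diff integrable_translate\<close>)
    then show "\<forall>\<^sub>F n in sequentially. (LINT x|lborel. \<bar>f (x + h n) + g (x + h n) - (f x + g x)\<bar>)
       \<le> (LINT x|lborel. \<bar>f (x + h n) - f x\<bar>) + (LINT x|lborel. \<bar>g (x + h n) - g x\<bar>)"
      using i by (simp add: integrable_translate)
  qed simp
qed

lemma mean_continuous_scale:
  assumes "mean_continuous f"
  shows "mean_continuous (\<lambda>x. c * f x)"
proof -
  have "\<bar>c * f (x + k) - c * f x\<bar> = \<bar>c\<bar> * \<bar>f (x + k) - f x\<bar>" for x k
    by (simp add: abs_mult flip: right_diff_distrib)
  then show ?thesis
    using assms by (auto simp: mean_continuous_def intro!: tendsto_mult_right_zero)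
qed

text \<open>Outer regularity passes from open sets to measurable sets, and approximation in the mean by
  simple functions gives the general case.\<close>

lemma integrable_mean_continuous:
  fixes f :: "'a::euclidean_space \<Rightarrow> real"
  assumes "integrable lborel f"
  shows "mean_continuous f"
  using assms
proof (induct f rule: integrable_induct)
  case (base A c)
  then have A[measurable]: "A \<in> sets borel" by simp
  have "mean_continuous (indicator A)"
  proof (rule mean_continuous_approx)
    show iA: "integrable lborel (indicator A :: 'a \<Rightarrow> real)"
      using base by (simp add: integrable_indicator_iff)
    fix e :: real assume "e > 0"
    then obtain U where U: "open U" "A \<subseteq> U" "emeasure lborel (U - A) < e"
      using outer_regular_lborel[OF A] by metis
    have [measurable]: "U \<in> sets borel" using U by simp
    have "emeasure lborel U = emeasure lborel A + emeasure lborel (U - A)"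
      using U by (subst plus_emeasure) (auto intro!: arg_cong[where f="emeasure lborel"])
    also have "\<dots> < \<infinity>" using base U(3) by (auto simp: less_top intro: order.strict_trans)
    finally have fin: "emeasure lborel U < \<infinity>" .
    have "(LINT x|lborel. \<bar>indicator A x - indicator U x :: real\<bar>) = (LINT x|lborel. indicator (U - A) x)"
      by (rule Bochner_Integration.integral_cong) (use U in \<open>auto simp: indicator_def\<close>)
    also have "\<dots> < e"
    proof -
      have "emeasure lborel (U - A) = ennreal (measure lborel (U - A))"
        using U(3) by (intro emeasure_eq_ennreal_measure) (auto simp: top_unique)
      with U(3) \<open>e > 0\<close> show ?thesis by (simp add: ennreal_less_iff)
    qed
    finally show "\<exists>g. mean_continuous g \<and> (LINT x|lborel. \<bar>indicator A x - g x\<bar>) < e"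
      using mean_continuous_open[OF U(1) fin] by blast
  qed
  from mean_continuous_scale[OF this, of c] show ?case by (simp add: mult.commute)
next
  case (add f g)
  then show ?case by (intro mean_continuous_add) auto
next
  case (lim f s)
  show ?case
  proof (rule mean_continuous_approx)
    fix e :: real assume "e > 0"
    have "(\<lambda>i. LINT x|lborel. \<bar>f x - s i x\<bar>) \<longlonglongrightarrow> (LINT x::'a|lborel. (0::real))"
    proof (rule integral_dominated_convergence[where w="\<lambda>x. 3 * \<bar>f x\<bar>"])
      show "AE x in lborel. (\<lambda>i. \<bar>f x - s i x\<bar>) \<longlonglongrightarrow> 0"
        proof (intro AE_I2)
        fix x :: 'a
        have "(\<lambda>i. s i x) \<longlonglongrightarrow> f x" using lim(3) by simp
        then have "(\<lambda>i. \<bar>f x - s i x\<bar>) \<longlonglongrightarrow> \<bar>f x - f x\<bar>" by (intro tendsto_intros)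
        then show "(\<lambda>i. \<bar>f x - s i x\<bar>) \<longlonglongrightarrow> 0" by simp
      qed
      show "AE x in lborel. norm \<bar>f x - s i x\<bar> \<le> 3 * \<bar>f x\<bar>" for i
      proof (intro AE_I2)
        fix x :: 'a
        show "norm \<bar>f x - s i x\<bar> \<le> 3 * \<bar>f x\<bar>" using lim(4)[of x i] by simp
      qed
    qed (use lim in auto)
    then have "(\<lambda>i. LINT x|lborel. \<bar>f x - s i x\<bar>) \<longlonglongrightarrow> 0" by simp
    from LIMSEQ_D[OF this \<open>e > 0\<close>] obtain i where "(LINT x|lborel. \<bar>f x - s i x\<bar>) < e" by fastforce
    then show "\<exists>g. mean_continuous g \<and> (LINT x|lborel. \<bar>f x - g x\<bar>) < e" using lim by blast
  qed (use lim in auto)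
qed

subsection \<open>Polynomial weights\<close>

text \<open>The function is at most the sum over \<open>k\<close> of \<open>(k + 1)\<close> to the power \<open>-(d + 2)\<close> times the
  indicator of the ball of radius \<open>k + 1\<close>, whose volume is a multiple of \<open>(k + 1)\<close> to the power
  \<open>d\<close>.\<close>

lemma integrable_polynomial_decay:
  "integrable lborel (\<lambda>x::'a::euclidean_space. 1 / (1 + norm x) ^ (DIM('a) + 2))"
proof (rule integrableI_bounded)
  let ?N = "DIM('a) + 2" and ?V = "measure lborel (ball (0::'a) 1)"
  have "(\<integral>\<^sup>+x. ennreal (norm (1 / (1 + norm (x::'a)) ^ ?N)) \<partial>lborel) \<le>
    (\<integral>\<^sup>+x. (\<Sum>k. ennreal (1 / real (Suc k) ^ ?N) * indicator (ball (0::'a) (real (Suc k))) x) \<partial>lborel)"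
  proof (rule nn_integral_mono)
    fix x :: 'a
    define k where "k = nat \<lfloor>norm x\<rfloor>"
    have k: "real k \<le> norm x" "norm x < real (Suc k)" by (auto simp: k_def) linarith+
    have "norm (1 / (1 + norm x) ^ ?N) \<le> 1 / real (Suc k) ^ ?N"
    proof -
      have "real (Suc k) ^ ?N \<le> (1 + norm x) ^ ?N" using k by (intro power_mono) auto
      then have "1 / (1 + norm x) ^ ?N \<le> 1 / real (Suc k) ^ ?N" by (intro frac_le) auto
      then show ?thesis by simp
    qed
    then have "ennreal (norm (1 / (1 + norm x) ^ ?N)) \<le>
        ennreal (1 / real (Suc k) ^ ?N) * indicator (ball (0::'a) (real (Suc k))) x"
      using k by (simp add: ennreal_leI)
    also have "\<dots> \<le> (\<Sum>k. ennreal (1 / real (Suc k) ^ ?N) * indicator (ball (0::'a) (real (Suc k))) x)"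
    proof -
      define F where "F k = ennreal (1 / real (Suc k) ^ ?N) * indicator (ball (0::'a) (real (Suc k))) x" for k
      have "F k \<le> suminf F" using sum_le_suminf[of F "{k}"] by simp
      then show ?thesis by (simp add: F_def[abs_def] del: of_nat_Suc)
    qed
    finally show "ennreal (norm (1 / (1 + norm x) ^ ?N)) \<le>
      (\<Sum>k. ennreal (1 / real (Suc k) ^ ?N) * indicator (ball (0::'a) (real (Suc k))) x)" .
  qed
  also have "\<dots> = (\<Sum>k. ennreal (1 / real (Suc k) ^ ?N) * emeasure lborel (ball (0::'a) (real (Suc k))))"
  proof (subst nn_integral_suminf)
    show "(\<lambda>x. ennreal (1 / real (Suc k) ^ ?N) * indicator (ball (0::'a) (real (Suc k))) x)
        \<in> borel_measurable lborel" for k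
      by (intro borel_measurable_times_ennreal borel_measurable_const borel_measurable_indicator) simp_all
  qed (simp add: nn_integral_cmult_indicator del: of_nat_Suc)
  also have "\<dots> = (\<Sum>k. ennreal (?V * inverse (real (Suc k) ^ 2)))"
  proof (rule arg_cong[where f=suminf], rule ext)
    fix k
    have "emeasure lborel (ball (0::'a) (real (Suc k))) = ennreal (real (Suc k) ^ DIM('a) * ?V)"
    proof -
      have "measure lborel (ball (0::'a) (real (Suc k))) = real (Suc k) ^ DIM('a) * ?V"
        by (rule content_ball_conv_unit_ball) simp
      moreover have "emeasure lborel (ball (0::'a) (real (Suc k))) =
          ennreal (measure lborel (ball (0::'a) (real (Suc k))))"
        by (rule emeasure_eq_ennreal_measure)
          (use emeasure_lborel_ball_finite[of "0::'a" "real (Suc k)"] in \<open>auto simp del: of_nat_Suc\<close>)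
      ultimately show ?thesis by simp
    qed
    then show "ennreal (1 / real (Suc k) ^ ?N) * emeasure lborel (ball (0::'a) (real (Suc k))) =
        ennreal (?V * inverse (real (Suc k) ^ 2))"
      by (simp add: ennreal_mult[symmetric] power_add power2_eq_square field_simps del: of_nat_Suc)
  qed
  also have "\<dots> < \<infinity>"
  proof -
    have "summable (\<lambda>k. ?V * inverse (real (Suc k) ^ 2))"
      using inverse_power_summable[of 2, where 'a=real]
      by (intro summable_mult) (subst summable_Suc_iff, simp)
    then show ?thesis by (simp add: less_top ennreal_suminf_neq_top del: of_nat_Suc)
  qed
  finally show "(\<integral>\<^sup>+x. ennreal (norm (1 / (1 + norm (x::'a)) ^ ?N)) \<partial>lborel) < \<infinity>" .
qed measurable

section \<open>Integration by parts for rapidly decaying functions\<close>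

lemma pd_scaleR:
  assumes "f differentiable (at x)"
  shows "pd (c *\<^sub>R b) f x = c *\<^sub>R pd b f x"
  using linear_scale[OF bounded_linear.linear[OF has_derivative_bounded_linear[OF has_derivative_pd[OF assms]]],
      of c b] .

lemma weight_pos: "0 < (1 + norm x) ^ N"
  by (intro zero_less_power add_pos_nonneg) auto

lemma increment_bound:
  fixes f :: "'a::euclidean_space \<Rightarrow> 'b::real_normed_vector"
  assumes f: "\<And>x. f differentiable (at x)" and "0 \<le> h"
    and B: "\<And>s. 0 \<le> s \<Longrightarrow> s \<le> h \<Longrightarrow> norm (pd b f (x + s *\<^sub>R b)) \<le> B"
  shows "norm (f (x + h *\<^sub>R b) - f x) \<le> B * h"
proof -
  have "norm (f (x + h *\<^sub>R b) - f (x + 0 *\<^sub>R b)) \<le> B * norm (h - 0)"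
  proof (rule differentiable_bound[where S="{0..h}" and f'="\<lambda>s t. t *\<^sub>R pd b f (x + s *\<^sub>R b)"])
    fix s assume s: "s \<in> {0..h}"
    have "((\<lambda>s. x + s *\<^sub>R b) has_derivative (\<lambda>t. t *\<^sub>R b)) (at s within {0..h})"
      by (auto intro!: derivative_eq_intros)
    from has_derivative_compose[OF this has_derivative_pd[OF f]]
    show "((\<lambda>s. f (x + s *\<^sub>R b)) has_derivative (\<lambda>t. t *\<^sub>R pd b f (x + s *\<^sub>R b))) (at s within {0..h})"
      by (simp add: pd_scaleR f)
    show "onorm (\<lambda>t. t *\<^sub>R pd b f (x + s *\<^sub>R b)) \<le> B"
      using B[of s] s order_trans[OF norm_ge_zero B[of s]]
      by (intro onorm_bound) (auto simp: mult.commute[of B] intro: mult_left_mono)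
  qed (use assms(2) in auto)
  then show ?thesis using assms(2) by simp
qed

lemma difference_quotient_tendsto:
  fixes f :: "'a::euclidean_space \<Rightarrow> 'b::real_normed_vector" and h :: "nat \<Rightarrow> real"
  assumes f: "f differentiable (at x)" and h: "h \<longlonglongrightarrow> 0" "\<And>n. h n \<noteq> 0"
  shows "(\<lambda>n. (1 / h n) *\<^sub>R (f (x + h n *\<^sub>R b) - f x)) \<longlonglongrightarrow> pd b f x"
proof (cases "b = 0")
  case True
  then have "pd b f x = 0" using pd_scaleR[OF f, of 0 b] by simp
  then show ?thesis using True by simp
next
  case False
  have lim: "(\<lambda>k. norm (f (x + k) - f x - pd k f x) / norm k) \<midarrow>0\<rightarrow> 0"
    using has_derivative_pd[OF f] by (simp add: has_derivative_at)
  have "(\<lambda>n. h n *\<^sub>R b) \<longlonglongrightarrow> 0 *\<^sub>R b" by (intro tendsto_intros h)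
  moreover have "h n *\<^sub>R b \<noteq> 0" for n using False h(2)[of n] by auto
  ultimately have "filterlim (\<lambda>n. h n *\<^sub>R b) (at 0) sequentially"
    by (simp add: filterlim_at)
  from filterlim_compose[OF lim this]
  have "(\<lambda>n. norm (f (x + h n *\<^sub>R b) - f x - h n *\<^sub>R pd b f x) / (\<bar>h n\<bar> * norm b)) \<longlonglongrightarrow> 0"
    by (simp add: pd_scaleR f)
  from tendsto_mult_right_zero[OF this, of "norm b"]
  have "(\<lambda>n. norm (f (x + h n *\<^sub>R b) - f x - h n *\<^sub>R pd b f x) / \<bar>h n\<bar>) \<longlonglongrightarrow> 0"
    using False by (simp add: field_simps)
  moreover have "norm (f (x + h n *\<^sub>R b) - f x - h n *\<^sub>R pd b f x) / \<bar>h n\<bar> =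
      norm ((1 / h n) *\<^sub>R (f (x + h n *\<^sub>R b) - f x) - pd b f x)" for n
  proof -
    have "(1 / h n) *\<^sub>R (f (x + h n *\<^sub>R b) - f x) - pd b f x =
        (1 / h n) *\<^sub>R (f (x + h n *\<^sub>R b) - f x - h n *\<^sub>R pd b f x)"
      using h(2)[of n] by (simp add: scaleR_right_diff_distrib)
    then show ?thesis by simp
  qed
  ultimately have "(\<lambda>n. norm ((1 / h n) *\<^sub>R (f (x + h n *\<^sub>R b) - f x) - pd b f x)) \<longlonglongrightarrow> 0" by simp
  then show ?thesis using tendsto_norm_zero_iff LIM_zero_iff by blast
qed

lemma integrable_of_decay:
  fixes f :: "'a::euclidean_space \<Rightarrow> 'b::{banach, second_countable_topology}"
  assumes "f \<in> borel_measurable borel" "\<And>x. norm (f x) \<le> C / (1 + norm x) ^ (DIM('a) + 2)"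
  shows "integrable lborel f"
proof (rule Bochner_Integration.integrable_bound)
  show "integrable lborel (\<lambda>x::'a. C * (1 / (1 + norm x) ^ (DIM('a) + 2)))"
    by (intro integrable_mult_right integrable_polynomial_decay)
  show "AE x in lborel. norm (f x) \<le> norm (C * (1 / (1 + norm x) ^ (DIM('a) + 2)))"
  proof (intro AE_I2)
    fix x :: 'a
    have "norm (f x) \<le> C * (1 / (1 + norm x) ^ (DIM('a) + 2))" using assms(2)[of x] by simp
    then show "norm (f x) \<le> norm (C * (1 / (1 + norm x) ^ (DIM('a) + 2)))"
      unfolding real_norm_def by linarith
  qed
qed (use assms in auto)

lemma decay_translate:
  fixes x b :: "'a::real_normed_vector"
  assumes "norm b \<le> 1" "C \<ge> 0"
  shows "C / (1 + norm (x + b)) ^ N \<le> C * 2 ^ N / (1 + norm x) ^ N"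
proof -
  have "norm x \<le> norm (x + b) + norm b" using norm_triangle_ineq4[of "x + b" b] by simp
  then have "1 + norm x \<le> 2 * (1 + norm (x + b))" using assms(1) norm_ge_zero[of "x + b"]
    unfolding distrib_left by linarith
  then have "(1 + norm x) ^ N \<le> (2 * (1 + norm (x + b))) ^ N" by (intro power_mono) auto
  then have "(1 + norm x) ^ N \<le> 2 ^ N * (1 + norm (x + b)) ^ N" by (simp only: power_mult_distrib)
  then have "C * (1 + norm x) ^ N \<le> C * (2 ^ N * (1 + norm (x + b)) ^ N)"
    using assms(2) by (intro mult_left_mono) auto
  then show ?thesis
    using weight_pos[of x N] weight_pos[of "x + b" N] by (simp add: divide_simps ac_simps)
qed

text \<open>The integral of the difference quotient vanishes by translation invariance; decay of the
  derivative dominates the difference quotients.\<close>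

lemma integral_pd_eq_0:
  fixes f :: "'a::euclidean_space \<Rightarrow> 'b::{banach, second_countable_topology}"
  assumes f: "\<And>x. f differentiable (at x)" and b: "norm b = 1" and "integrable lborel f"
    and decay: "\<And>x. norm (pd b f x) \<le> C / (1 + norm x) ^ (DIM('a) + 2)"
  shows "(LINT x|lborel. pd b f x) = 0"
proof -
  let ?N = "DIM('a) + 2"
  let ?h = "\<lambda>n. inverse (real (Suc n))"
  have C: "C \<ge> 0" using order_trans[OF norm_ge_zero decay[of 0]] by simp
  have h: "?h \<longlonglongrightarrow> 0" by (rule LIMSEQ_inverse_real_of_nat)
  have hb: "0 < ?h n" "?h n \<le> 1" for n by (auto simp: field_simps)
  have meas: "f \<in> borel_measurable borel" using assms(3) by auto
  have q: "(\<lambda>n. (1 / ?h n) *\<^sub>R (f (x + ?h n *\<^sub>R b) - f x)) \<longlonglongrightarrow> pd b f x" for x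
    by (rule difference_quotient_tendsto) (use f b h in auto)
  have mq: "(\<lambda>x. (1 / ?h n) *\<^sub>R (f (x + ?h n *\<^sub>R b) - f x)) \<in> borel_measurable lborel" for n
    using meas by measurable
  have "(\<lambda>n. LINT x|lborel. (1 / ?h n) *\<^sub>R (f (x + ?h n *\<^sub>R b) - f x)) \<longlonglongrightarrow> (LINT x|lborel. pd b f x)"
  proof (rule integral_dominated_convergence[where w="\<lambda>x. (C * 2 ^ ?N) * (1 / (1 + norm x) ^ ?N)"])
    show "pd b f \<in> borel_measurable lborel"
      by (rule borel_measurable_LIMSEQ_metric[OF mq]) (use q in auto)
    show "integrable lborel (\<lambda>x::'a. (C * 2 ^ ?N) * (1 / (1 + norm x) ^ ?N))"
      by (intro integrable_mult_right integrable_polynomial_decay)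
    show "AE x in lborel. norm ((1 / ?h n) *\<^sub>R (f (x + ?h n *\<^sub>R b) - f x)) \<le>
        (C * 2 ^ ?N) * (1 / (1 + norm x) ^ ?N)" for n
    proof (intro AE_I2)
      fix x
      have "norm (f (x + ?h n *\<^sub>R b) - f x) \<le> (C * 2 ^ ?N / (1 + norm x) ^ ?N) * ?h n"
      proof (rule increment_bound[OF f])
        fix s assume "0 \<le> s" "s \<le> ?h n"
        then have "norm (s *\<^sub>R b) \<le> 1" using b hb[of n] by simp
        then show "norm (pd b f (x + s *\<^sub>R b)) \<le> C * 2 ^ ?N / (1 + norm x) ^ ?N"
          using decay[of "x + s *\<^sub>R b"] decay_translate[OF _ C] order_trans by blast
      qed (use hb[of n] in simp)
      then show "norm ((1 / ?h n) *\<^sub>R (f (x + ?h n *\<^sub>R b) - f x)) \<le>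
        (C * 2 ^ ?N) * (1 / (1 + norm x) ^ ?N)"
      proof -
        assume le: "norm (f (x + ?h n *\<^sub>R b) - f x) \<le> (C * 2 ^ ?N / (1 + norm x) ^ ?N) * ?h n"
        have "norm ((1 / ?h n) *\<^sub>R (f (x + ?h n *\<^sub>R b) - f x)) =
            norm (f (x + ?h n *\<^sub>R b) - f x) / ?h n"
          using hb[of n] by (simp add: divide_inverse mult.commute)
        also have "\<dots> \<le> C * 2 ^ ?N / (1 + norm x) ^ ?N"
          using le hb(1)[of n] by (simp only: pos_divide_le_eq)
        finally show ?thesis by simp
      qed
    qed
  qed (use mq q in auto)
  moreover have "(LINT x|lborel. (1 / ?h n) *\<^sub>R (f (x + ?h n *\<^sub>R b) - f x)) = 0" for n
    using assms(3) meas
    by (simp add: integrable_translate integral_translate del: of_nat_Suc)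
  ultimately show ?thesis by (simp add: LIMSEQ_const_iff)
qed

section \<open>Schwartz functions and their Fourier transforms\<close>

definition rapid :: "('a::real_normed_vector \<Rightarrow> 'b::real_normed_vector) \<Rightarrow> bool" where
  "rapid f \<longleftrightarrow> (\<forall>N. bounded (range (\<lambda>x. (1 + norm x) ^ N *\<^sub>R f x)))"

lemma rapidI:
  assumes "\<And>N. \<exists>C. \<forall>x. (1 + norm x) ^ N * norm (f x) \<le> C"
  shows "rapid f"
  using assms by (auto simp: rapid_def bounded_iff)

lemma rapidD:
  assumes "rapid f"
  obtains C where "C \<ge> 0" "\<And>x. norm (f x) \<le> C / (1 + norm x) ^ N"
proof -
  obtain C where C: "\<And>x. norm ((1 + norm x) ^ N *\<^sub>R f x) \<le> C"
    using assms by (auto simp: rapid_def bounded_iff)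
  have "norm (f x) \<le> C / (1 + norm x) ^ N" for x
    using C[of x] weight_pos[of x N] by (simp add: pos_le_divide_eq mult.commute)
  moreover have "C \<ge> 0" using order_trans[OF norm_ge_zero C] .
  ultimately show thesis using that by blast
qed

lemma rapid_add: "rapid f \<Longrightarrow> rapid g \<Longrightarrow> rapid (\<lambda>x. f x + g x)"
  by (auto simp: rapid_def scaleR_add_right intro: bounded_plus_comp)

lemma schwartz_iff: "\<psi> \<in> schwartz \<longleftrightarrow>
    (\<forall>bs. set bs \<subseteq> Basis \<longrightarrow> (\<forall>x. pds bs \<psi> differentiable (at x)) \<and> rapid (pds bs \<psi>))"
  by (auto simp: schwartz_def smooth_def rapid_def)

lemma schwartz_smooth: "\<psi> \<in> schwartz \<Longrightarrow> smooth \<psi>"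
  by (simp add: schwartz_def)

lemma schwartz_rapid: "\<psi> \<in> schwartz \<Longrightarrow> rapid \<psi>"
  unfolding schwartz_iff by (metis empty_set empty_subsetI pds.simps(1))

lemma schwartz_pd: 
  fixes \<psi> :: "'a::euclidean_space \<Rightarrow> complex"
  assumes "\<psi> \<in> schwartz" "b \<in> Basis"
  shows "pd b \<psi> \<in> schwartz"
  unfolding schwartz_iff
proof (intro allI impI)
  fix bs :: "'a list" assume "set bs \<subseteq> Basis"
  moreover have "pds bs (pd b \<psi>) = pds (bs @ [b]) \<psi>" by (simp add: pds_append)
  ultimately show "(\<forall>x. pds bs (pd b \<psi>) differentiable (at x)) \<and> rapid (pds bs (pd b \<psi>))"
    using assms by (simp add: schwartz_iff)
qed

lemma schwartz_differentiable: "\<psi> \<in> schwartz \<Longrightarrow> \<psi> differentiable (at x)"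
  by (intro smooth_differentiable schwartz_smooth)

lemma schwartz_continuous: "\<psi> \<in> schwartz \<Longrightarrow> continuous_on S \<psi>"
  by (intro continuous_at_imp_continuous_on ballI differentiable_imp_continuous_within
      schwartz_differentiable)

lemma schwartz_measurable: "\<psi> \<in> schwartz \<Longrightarrow> \<psi> \<in> borel_measurable borel"
  by (intro borel_measurable_continuous_onI schwartz_continuous)

lemma schwartz_integrable:
  fixes \<psi> :: "'a::euclidean_space \<Rightarrow> complex"
  assumes "\<psi> \<in> schwartz" shows "integrable lborel \<psi>"
proof -
  obtain C where "\<And>x. norm (\<psi> x) \<le> C / (1 + norm x) ^ (DIM('a) + 2)"
    using rapidD[OF schwartz_rapid[OF assms]] by metis
  then show ?thesis by (rule integrable_of_decay[OF schwartz_measurable[OF assms]])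
qed

lemma schwartz_const_mult:
  assumes "\<psi> \<in> schwartz" shows "(\<lambda>x. c * \<psi> x) \<in> schwartz"
  unfolding schwartz_iff
proof (intro allI impI)
  fix bs :: "'a list" assume bs: "set bs \<subseteq> Basis"
  have eq: "pds bs (\<lambda>x. c * \<psi> x) = (\<lambda>x. c * pds bs \<psi> x)"
    by (rule pds_bounded_linear[OF bounded_linear_mult_right]) (use assms bs in \<open>auto intro: schwartz_smooth\<close>)
  have "rapid (\<lambda>x. c * pds bs \<psi> x)"
  proof (rule rapidI)
    fix N
    obtain C where C: "\<And>x. norm (pds bs \<psi> x) \<le> C / (1 + norm x) ^ N"
      using assms bs rapidD unfolding schwartz_iff by metis
    have "(1 + norm x) ^ N * norm (c * pds bs \<psi> x) \<le> norm c * C" for x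
    proof -
      have "(1 + norm x) ^ N * norm (pds bs \<psi> x) \<le> C"
        using C[of x] weight_pos[of x N] by (simp add: pos_le_divide_eq mult.commute)
      from mult_left_mono[OF this, of "norm c"] show ?thesis
        by (simp add: norm_mult ac_simps)
    qed
    then show "\<exists>C. \<forall>x. (1 + norm x) ^ N * norm (c * pds bs \<psi> x) \<le> C" by blast
  qed
  then show "(\<forall>x. pds bs (\<lambda>x. c * \<psi> x) differentiable (at x)) \<and> rapid (pds bs (\<lambda>x. c * \<psi> x))"
    using assms bs by (auto simp: eq schwartz_iff intro!: derivative_intros)
qed

text \<open>An affine rather than a linear factor, because the derivative of a linear factor is a
  constant: with affine factors the class of products is closed under differentiation up to sums.\<close>

lemma schwartz_affine_mult:
  fixes \<psi> :: "'a::euclidean_space \<Rightarrow> complex"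
  assumes "\<psi> \<in> schwartz" shows "(\<lambda>x. (c + x \<bullet> a) *\<^sub>R \<psi> x) \<in> schwartz"
proof -
  define Q :: "('a \<Rightarrow> complex) \<Rightarrow> bool" where "Q f \<longleftrightarrow> (\<forall>x. f differentiable (at x)) \<and> rapid f" for f
  define P :: "('a \<Rightarrow> complex) \<Rightarrow> bool" where
    "P f \<longleftrightarrow> (\<exists>\<psi>\<in>schwartz. \<exists>c a. f = (\<lambda>x. (c + x \<bullet> a) *\<^sub>R \<psi> x))" for f
  have der: "((\<lambda>x. (c + x \<bullet> a) *\<^sub>R \<psi> x) has_derivative
      (\<lambda>h. (c + x \<bullet> a) *\<^sub>R pd h \<psi> x + (h \<bullet> a) *\<^sub>R \<psi> x)) (at x)"
    if "\<psi> \<in> schwartz" for \<psi> :: "'a \<Rightarrow> complex" and c a x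
    by (rule has_derivative_scaleR[OF _ has_derivative_pd[OF schwartz_differentiable[OF that]]])
      (auto intro!: derivative_eq_intros)
  have "Q (pds bs (\<lambda>x. (c + x \<bullet> a) *\<^sub>R \<psi> x))" if bs: "set bs \<subseteq> Basis" for bs
  proof (rule derivatives_coinduct[where P=P])
    show "P (\<lambda>x. (c + x \<bullet> a) *\<^sub>R \<psi> x)" using assms by (auto simp: P_def)
  next
    fix f assume "P f"
    then obtain \<psi> c a where \<psi>: "\<psi> \<in> schwartz" and f: "f = (\<lambda>x. (c + x \<bullet> a) *\<^sub>R \<psi> x)"
      by (auto simp: P_def)
    have "rapid f"
    proof (rule rapidI)
      fix N
      obtain C where C: "\<And>x. norm (\<psi> x) \<le> C / (1 + norm x) ^ Suc N"
        using rapidD[OF schwartz_rapid[OF \<psi>]] by metis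
      have "(1 + norm x) ^ N * norm (f x) \<le> (\<bar>c\<bar> + norm a) * C" for x
      proof -
        have "\<bar>c + x \<bullet> a\<bar> \<le> \<bar>c\<bar> + norm x * norm a"
          using Cauchy_Schwarz_ineq2[of x a] by linarith
        also have "\<dots> \<le> (\<bar>c\<bar> + norm a) * (1 + norm x)"
          by (simp add: algebra_simps)
        finally have le: "\<bar>c + x \<bullet> a\<bar> \<le> (\<bar>c\<bar> + norm a) * (1 + norm x)" .
        have pos: "0 < (1 + norm x) ^ Suc N" by (rule weight_pos)
        have "(1 + norm x) ^ N * norm (f x) \<le>
           (1 + norm x) ^ N * (((\<bar>c\<bar> + norm a) * (1 + norm x)) * norm (\<psi> x))"
          unfolding f norm_scaleR using le by (intro mult_left_mono mult_right_mono) auto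
        also have "\<dots> = (\<bar>c\<bar> + norm a) * ((1 + norm x) ^ Suc N * norm (\<psi> x))" by simp
        also have "\<dots> \<le> (\<bar>c\<bar> + norm a) * C"
          using C[of x] pos by (intro mult_left_mono) (auto simp: pos_le_divide_eq mult.commute)
        finally show ?thesis .
      qed
      then show "\<exists>C. \<forall>x. (1 + norm x) ^ N * norm (f x) \<le> C" by blast
    qed
    moreover have "f differentiable (at x)" for x
      using der[OF \<psi>] unfolding f differentiable_def by blast
    ultimately show "Q f" by (simp add: Q_def)
    fix b :: 'a assume b: "b \<in> Basis"
    have "pd b f = (\<lambda>x. (c + x \<bullet> a) *\<^sub>R pd b \<psi> x + (b \<bullet> a + x \<bullet> 0) *\<^sub>R \<psi> x)"
      unfolding f by (rule ext, subst pd_eqI[OF der[OF \<psi>]]) simp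
    moreover have "P (\<lambda>x. (c + x \<bullet> a) *\<^sub>R pd b \<psi> x)" "P (\<lambda>x. (b \<bullet> a + x \<bullet> 0) *\<^sub>R \<psi> x)"
      unfolding P_def using schwartz_pd[OF \<psi> b] \<psi> by blast+
    ultimately show "\<exists>g h. P g \<and> P h \<and> pd b f = (\<lambda>x. g x + h x)" by blast
  qed (use bs in \<open>auto simp: Q_def intro: rapid_add\<close>)
  then show ?thesis by (auto simp: schwartz_iff Q_def)
qed

lemma schwartz_coordinate_mult:
  fixes \<psi> :: "'a::euclidean_space \<Rightarrow> complex"
  assumes "\<psi> \<in> schwartz" shows "(\<lambda>x. complex_of_real (x \<bullet> a) * \<psi> x) \<in> schwartz"
  using schwartz_affine_mult[OF assms, of 0 a] by (simp add: scaleR_conv_of_real)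

lemma norm_exp_character [simp]: "cmod (exp (- (\<i> * complex_of_real r))) = 1"
  by (simp add: norm_exp_eq_Re)

lemma fourier_lborel:
  assumes "f \<in> borel_measurable borel"
  shows "fourier f k = (LINT x|lborel. exp (- (\<i> * complex_of_real (k \<bullet> x))) * f x)"
  unfolding fourier_def using assms by (intro integral_completion) simp

lemma integrable_character_mult:
  assumes "integrable lborel f"
  shows "integrable lborel (\<lambda>x::'a::euclidean_space. exp (- (\<i> * complex_of_real (k \<bullet> x))) * f x)"
  by (rule Bochner_Integration.integrable_bound[OF assms])
    (use assms in \<open>auto simp: norm_mult\<close>)

lemma norm_fourier_le:
  assumes "integrable lborel f"
  shows "cmod (fourier f k) \<le> (LINT x|lborel. cmod (f x))"
proof -
  have "cmod (fourier f k) \<le> (LINT x|lborel. cmod (exp (- (\<i> * complex_of_real (k \<bullet> x))) * f x))"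
    using assms by (subst fourier_lborel) (auto intro: integral_norm_bound)
  then show ?thesis by (simp add: norm_mult)
qed

text \<open>Differentiation under the integral sign; the remainder of the exponential is quadratic in the
  increment and is absorbed by the second moment of \<open>\<psi>\<close>.\<close>

lemma has_derivative_fourier:
  fixes \<psi> :: "'a::euclidean_space \<Rightarrow> complex"
  assumes \<psi>: "\<psi> \<in> schwartz"
  shows "(fourier \<psi> has_derivative
     (\<lambda>h. fourier (\<lambda>x. - \<i> * (complex_of_real (x \<bullet> h) * \<psi> x)) k)) (at k)"
proof (rule has_derivativeI_sandwich[where e=1])
  let ?D = "\<lambda>h. fourier (\<lambda>x. - \<i> * (complex_of_real (x \<bullet> h) * \<psi> x)) k"
  let ?e = "\<lambda>k x. exp (- (\<i> * complex_of_real (k \<bullet> x)))"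
  have S: "(\<lambda>x. - \<i> * (complex_of_real (x \<bullet> h) * \<psi> x)) \<in> schwartz" for h
    by (intro schwartz_const_mult schwartz_coordinate_mult \<psi>)
  have D: "?D h = (LINT x|lborel. ?e k x * (- \<i> * (complex_of_real (x \<bullet> h) * \<psi> x)))" for h
    by (rule fourier_lborel[OF schwartz_measurable[OF S]])
  have I: "integrable lborel (\<lambda>x. ?e k x * (- \<i> * (complex_of_real (x \<bullet> h) * \<psi> x)))" for h
    by (rule integrable_character_mult[OF schwartz_integrable[OF S]])
  have "linear ?D"
  proof (rule linearI)
    fix h1 h2 r
    show "?D (h1 + h2) = ?D h1 + ?D h2"
      unfolding D by (subst Bochner_Integration.integral_add[OF I I, symmetric])
        (simp add: inner_add_right algebra_simps)
    show "?D (r *\<^sub>R h1) = r *\<^sub>R ?D h1"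
      unfolding D by (subst integral_scaleR_right[symmetric])
        (simp add: scaleR_conv_of_real algebra_simps)
  qed
  then show "bounded_linear ?D" by (simp add: linear_conv_bounded_linear)
  define M where "M = (LINT x|lborel. norm x ^ 2 * cmod (\<psi> x))"
  have iM: "integrable lborel (\<lambda>x. norm x ^ 2 * cmod (\<psi> x))"
  proof -
    obtain C where C: "\<And>x. norm (\<psi> x) \<le> C / (1 + norm x) ^ (2 + (DIM('a) + 2))"
      using rapidD[OF schwartz_rapid[OF \<psi>]] by metis
    show ?thesis
    proof (rule integrable_of_decay)
      show "(\<lambda>x. norm x ^ 2 * cmod (\<psi> x)) \<in> borel_measurable borel"
        using schwartz_measurable[OF \<psi>] by measurable
      fix x :: 'a
      have "norm x ^ 2 * cmod (\<psi> x) \<le> (1 + norm x) ^ 2 * (C / (1 + norm x) ^ (2 + (DIM('a) + 2)))"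
        by (intro mult_mono power_mono C) auto
      also have "\<dots> = C / (1 + norm x) ^ (DIM('a) + 2)"
        using weight_pos[of x 2] unfolding power_add[of _ 2]
        by (simp only: times_divide_eq_right mult_divide_mult_cancel_left less_imp_neq[symmetric]
            mult_divide_mult_cancel_left[OF less_imp_neq[OF weight_pos, symmetric]])
      finally show "norm (norm x ^ 2 * cmod (\<psi> x)) \<le> C / (1 + norm x) ^ (DIM('a) + 2)" by simp
    qed
  qed
  have "((\<lambda>l. norm (l - k) * M) \<longlongrightarrow> norm (k - k) * M) (at k)"
    by (intro tendsto_intros)
  then show "((\<lambda>l. norm (l - k) * M) \<longlongrightarrow> 0) (at k)" by simp
  fix l :: 'a assume l: "l \<noteq> k"
  define h where "h = l - k"
  have hl: "l = k + h" "h \<noteq> 0" using l by (auto simp: h_def)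
  have eq: "fourier \<psi> l - fourier \<psi> k - ?D (l - k) =
     (LINT x|lborel. ?e l x * \<psi> x - ?e k x * \<psi> x - ?e k x * (- \<i> * (complex_of_real (x \<bullet> h) * \<psi> x)))"
    unfolding D h_def[symmetric] fourier_lborel[OF schwartz_measurable[OF \<psi>]]
    using I integrable_character_mult[OF schwartz_integrable[OF \<psi>]] by simp
  have "norm (fourier \<psi> l - fourier \<psi> k - ?D (l - k)) \<le> (LINT x|lborel. norm h ^ 2 * (norm x ^ 2 * cmod (\<psi> x)))"
    unfolding eq
  proof (rule order_trans[OF integral_norm_bound integral_mono])
    show "integrable lborel (\<lambda>x. norm (?e l x * \<psi> x - ?e k x * \<psi> x - ?e k x * (- \<i> * (complex_of_real (x \<bullet> h) * \<psi> x))))"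
      using I integrable_character_mult[OF schwartz_integrable[OF \<psi>]] by simp
    show "integrable lborel (\<lambda>x. norm h ^ 2 * (norm x ^ 2 * cmod (\<psi> x)))" using iM by simp
    fix x
    define z where "z = - (\<i> * complex_of_real (h \<bullet> x))"
    have "?e l x * \<psi> x - ?e k x * \<psi> x - ?e k x * (- \<i> * (complex_of_real (x \<bullet> h) * \<psi> x)) =
        ?e k x * (exp z - (1 + z)) * \<psi> x"
    proof -
      have "?e l x = ?e k x * exp z"
        by (simp add: hl z_def inner_add_left mult_exp_exp algebra_simps)
      then show ?thesis by (simp add: z_def inner_commute algebra_simps)
    qed
    then have "norm (?e l x * \<psi> x - ?e k x * \<psi> x - ?e k x * (- \<i> * (complex_of_real (x \<bullet> h) * \<psi> x))) =
        cmod (exp z - (1 + z)) * cmod (\<psi> x)" by (simp add: norm_mult)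
    also have "\<dots> \<le> (norm h * norm x) ^ 2 * cmod (\<psi> x)"
    proof (rule mult_right_mono)
      have "cmod (exp z - (1 + z)) \<le> cmod z ^ 2"
        using Taylor_exp[of z 1] by (simp add: z_def power2_eq_square)
      also have "cmod z = \<bar>h \<bullet> x\<bar>" by (simp add: z_def norm_mult)
      also have "\<bar>h \<bullet> x\<bar> ^ 2 \<le> (norm h * norm x) ^ 2"
        by (intro power_mono Cauchy_Schwarz_ineq2) simp
      finally show "cmod (exp z - (1 + z)) \<le> (norm h * norm x) ^ 2" .
    qed simp
    finally show "norm (?e l x * \<psi> x - ?e k x * \<psi> x - ?e k x * (- \<i> * (complex_of_real (x \<bullet> h) * \<psi> x)))
       \<le> norm h ^ 2 * (norm x ^ 2 * cmod (\<psi> x))" by (simp add: power_mult_distrib ac_simps)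
  qed
  also have "\<dots> = norm h ^ 2 * M" by (simp add: M_def)
  finally show "norm (fourier \<psi> l - fourier \<psi> k - ?D (l - k)) / norm (l - k) \<le> norm (l - k) * M"
    using hl(2) by (simp add: h_def[symmetric] divide_le_eq power2_eq_square ac_simps)
qed simp

lemma pd_fourier:
  assumes "\<psi> \<in> schwartz"
  shows "pd b (fourier \<psi>) = fourier (\<lambda>x. - \<i> * (complex_of_real (x \<bullet> b) * \<psi> x))"
  by (rule ext, rule pd_eqI, rule has_derivative_fourier[OF assms])

lemma fourier_pd:
  fixes \<psi> :: "'a::euclidean_space \<Rightarrow> complex"
  assumes \<psi>: "\<psi> \<in> schwartz" and b: "b \<in> Basis"
  shows "fourier (pd b \<psi>) k = \<i> * complex_of_real (k \<bullet> b) * fourier \<psi> k"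
proof -
  let ?e = "\<lambda>x. exp (- (\<i> * complex_of_real (k \<bullet> x)))"
  have der: "((\<lambda>x. ?e x * \<psi> x) has_derivative
      (\<lambda>h. ?e x * pd h \<psi> x + (- (\<i> * complex_of_real (k \<bullet> h)) * ?e x) * \<psi> x)) (at x)" for x
  proof (rule has_derivative_mult[OF _ has_derivative_pd[OF schwartz_differentiable[OF \<psi>]]])
    have "((\<lambda>x. k \<bullet> x) has_derivative (\<lambda>h. k \<bullet> h)) (at x)"
      by (auto intro!: derivative_eq_intros)
    then have "((\<lambda>x. - (\<i> * complex_of_real (k \<bullet> x))) has_derivative
        (\<lambda>h. - (\<i> * complex_of_real (k \<bullet> h)))) (at x)"
      by (intro has_derivative_minus has_derivative_mult_right has_derivative_of_real)
    from has_derivative_compose[OF this DERIV_exp[unfolded has_field_derivative_def]]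
    show "(?e has_derivative (\<lambda>h. - (\<i> * complex_of_real (k \<bullet> h)) * ?e x)) (at x)"
      by (simp add: mult.commute)
  qed
  have pd: "pd b (\<lambda>x. ?e x * \<psi> x) = (\<lambda>x. ?e x * pd b \<psi> x + - (\<i> * complex_of_real (k \<bullet> b)) * (?e x * \<psi> x))"
    by (rule ext, subst pd_eqI[OF der]) (simp only: mult.assoc)
  obtain C1 where C1: "\<And>x. norm (\<psi> x) \<le> C1 / (1 + norm x) ^ (DIM('a) + 2)"
    using rapidD[OF schwartz_rapid[OF \<psi>]] by metis
  obtain C2 where C2: "\<And>x. norm (pd b \<psi> x) \<le> C2 / (1 + norm x) ^ (DIM('a) + 2)"
    using rapidD[OF schwartz_rapid[OF schwartz_pd[OF \<psi> b]]] by metis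
  have I: "integrable lborel (\<lambda>x. ?e x * \<psi> x)" "integrable lborel (\<lambda>x. ?e x * pd b \<psi> x)"
    by (intro integrable_character_mult schwartz_integrable schwartz_pd \<psi> b)+
  have "(LINT x|lborel. pd b (\<lambda>x. ?e x * \<psi> x) x) = 0"
  proof (rule integral_pd_eq_0[where C="C2 + \<bar>k \<bullet> b\<bar> * C1"])
    fix x
    show "(\<lambda>x. ?e x * \<psi> x) differentiable (at x)" using der unfolding differentiable_def by blast
    have "norm (pd b (\<lambda>x. ?e x * \<psi> x) x) \<le> norm (?e x * pd b \<psi> x) + norm (- (\<i> * complex_of_real (k \<bullet> b)) * (?e x * \<psi> x))"
      unfolding pd by (rule norm_triangle_ineq)
    also have "\<dots> = norm (pd b \<psi> x) + \<bar>k \<bullet> b\<bar> * norm (\<psi> x)" by (simp add: norm_mult)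
    also have "\<dots> \<le> C2 / (1 + norm x) ^ (DIM('a) + 2) + \<bar>k \<bullet> b\<bar> * (C1 / (1 + norm x) ^ (DIM('a) + 2))"
      by (intro add_mono mult_left_mono C1 C2) auto
    finally show "norm (pd b (\<lambda>x. ?e x * \<psi> x) x) \<le> (C2 + \<bar>k \<bullet> b\<bar> * C1) / (1 + norm x) ^ (DIM('a) + 2)"
      by (simp add: add_divide_distrib)
  qed (use I b in auto)
  then have "(LINT x|lborel. ?e x * pd b \<psi> x) = \<i> * complex_of_real (k \<bullet> b) * (LINT x|lborel. ?e x * \<psi> x)"
    unfolding pd using I by (simp add: Bochner_Integration.integral_add)
  then show ?thesis
    by (simp add: fourier_lborel schwartz_measurable \<psi> schwartz_pd b)
qed

text \<open>Each power of \<open>1 + \<bar>k\<bar> \<le> 1 + \<Sum>\<^sub>b \<bar>k\<^sub>b\<bar>\<close> is traded for a derivative of \<open>\<psi>\<close>, since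
  multiplication by \<open>k\<^sub>b\<close> is differentiation before the transform.\<close>

lemma rapid_fourier:
  fixes \<psi> :: "'a::euclidean_space \<Rightarrow> complex"
  assumes "\<psi> \<in> schwartz" shows "rapid (fourier \<psi>)"
proof (rule rapidI)
  fix N
  show "\<exists>C. \<forall>k. (1 + norm k) ^ N * norm (fourier \<psi> k) \<le> C" using assms
  proof (induct N arbitrary: \<psi>)
    case 0
    then show ?case using norm_fourier_le[OF schwartz_integrable] by auto
  next
    case (Suc N)
    obtain C where C: "\<And>k. (1 + norm k) ^ N * norm (fourier \<psi> k) \<le> C" using Suc by blast
    have "\<forall>b\<in>Basis. \<exists>C. \<forall>k. (1 + norm k) ^ N * norm (fourier (pd b \<psi>) k) \<le> C"
      using Suc schwartz_pd by blast
    then obtain D where D: "\<And>b k. b \<in> Basis \<Longrightarrow> (1 + norm k) ^ N * norm (fourier (pd b \<psi>) k) \<le> D b"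
      by metis
    have "(1 + norm k) ^ Suc N * norm (fourier \<psi> k) \<le> C + (\<Sum>b\<in>Basis. D b)" for k
    proof -
      have "norm k \<le> (\<Sum>b\<in>Basis. \<bar>k \<bullet> b\<bar>)" by (rule norm_le_l1)
      then have "(1 + norm k) * norm (fourier \<psi> k) \<le> (1 + (\<Sum>b\<in>Basis. \<bar>k \<bullet> b\<bar>)) * norm (fourier \<psi> k)"
        by (intro mult_right_mono) auto
      also have "\<dots> = norm (fourier \<psi> k) + (\<Sum>b\<in>Basis. norm (fourier (pd b \<psi>) k))"
        by (simp add: fourier_pd Suc norm_mult distrib_right sum_distrib_right)
      finally have "(1 + norm k) ^ N * ((1 + norm k) * norm (fourier \<psi> k)) \<le>
          (1 + norm k) ^ N * (norm (fourier \<psi> k) + (\<Sum>b\<in>Basis. norm (fourier (pd b \<psi>) k)))"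
        by (intro mult_left_mono) auto
      also have "\<dots> = (1 + norm k) ^ N * norm (fourier \<psi> k) +
          (\<Sum>b\<in>Basis. (1 + norm k) ^ N * norm (fourier (pd b \<psi>) k))"
        by (simp add: distrib_left sum_distrib_left)
      also have "\<dots> \<le> C + (\<Sum>b\<in>Basis. D b)"
        by (intro add_mono sum_mono C D)
      finally show ?thesis by (simp add: mult.assoc mult.left_commute)
    qed
    then show ?case by blast
  qed
qed

text \<open>Derivatives of transforms are transforms, so smoothness and decay need only be known for
  transforms themselves.\<close>

lemma pds_fourier:
  assumes "\<psi> \<in> schwartz" "set bs \<subseteq> Basis"
  shows "\<exists>\<omega>\<in>schwartz. pds bs (fourier \<psi>) = fourier \<omega>"
  using assms(2)
proof (induct bs)
  case Nil
  then show ?case using assms by auto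
next
  case (Cons b bs)
  then obtain \<omega> where "\<omega> \<in> schwartz" "pds bs (fourier \<psi>) = fourier \<omega>" by auto
  then show ?case
    by (auto simp: pd_fourier intro!: schwartz_const_mult[of _ "- \<i>", simplified]
        schwartz_coordinate_mult bexI[of _ "\<lambda>x. - \<i> * (complex_of_real (x \<bullet> b) * \<omega> x)"])
qed

lemma fourier_schwartz:
  fixes \<psi> :: "'a::euclidean_space \<Rightarrow> complex"
  assumes "\<psi> \<in> schwartz" shows "fourier \<psi> \<in> schwartz"
  unfolding schwartz_iff
proof (intro allI impI)
  fix bs :: "'a list" assume "set bs \<subseteq> Basis"
  then obtain \<omega> where "\<omega> \<in> schwartz" "pds bs (fourier \<psi>) = fourier \<omega>"
    using pds_fourier[OF assms] by blast
  then show "(\<forall>x. pds bs (fourier \<psi>) differentiable (at x)) \<and> rapid (pds bs (fourier \<psi>))"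
    using has_derivative_fourier rapid_fourier by (auto simp: differentiable_def)
qed

text \<open>The multiplier \<open>\<kappa>\<^sup>2\<close> corresponds to minus the Laplacian.\<close>

lemma fourier_norm_sq_mult:
  fixes \<psi> :: "'a::euclidean_space \<Rightarrow> complex"
  assumes \<psi>: "\<psi> \<in> schwartz"
  shows "fourier (\<lambda>k. complex_of_real ((norm k)\<^sup>2) * \<psi> k) x = - (\<Sum>b\<in>Basis. pd b (pd b (fourier \<psi>)) x)"
proof -
  have S: "(\<lambda>k. complex_of_real (k \<bullet> b) * (complex_of_real (k \<bullet> b) * \<psi> k)) \<in> schwartz" for b
    by (intro schwartz_coordinate_mult \<psi>)
  have S1: "(\<lambda>k. - \<i> * (complex_of_real (k \<bullet> b) * \<psi> k)) \<in> schwartz" for b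
    by (intro schwartz_const_mult schwartz_coordinate_mult \<psi>)
  let ?e = "\<lambda>k. exp (- (\<i> * complex_of_real (x \<bullet> k)))"
  have I: "integrable lborel (\<lambda>k. ?e k * (complex_of_real (k \<bullet> b) * (complex_of_real (k \<bullet> b) * \<psi> k)))" for b
    by (rule integrable_character_mult[OF schwartz_integrable[OF S]])
  have "pd b (pd b (fourier \<psi>)) x = - (LINT k|lborel. ?e k * (complex_of_real (k \<bullet> b) * (complex_of_real (k \<bullet> b) * \<psi> k)))" for b
  proof -
    have "pd b (pd b (fourier \<psi>)) x =
      fourier (\<lambda>k. - \<i> * (complex_of_real (k \<bullet> b) * (- \<i> * (complex_of_real (k \<bullet> b) * \<psi> k)))) x"
      by (simp only: pd_fourier[OF \<psi>] pd_fourier[OF S1])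
    also have "(\<lambda>k. - \<i> * (complex_of_real (k \<bullet> b) * (- \<i> * (complex_of_real (k \<bullet> b) * \<psi> k)))) =
      (\<lambda>k. (-1) * (complex_of_real (k \<bullet> b) * (complex_of_real (k \<bullet> b) * \<psi> k)))"
      by (rule ext) (simp add: algebra_simps)
    also have "fourier \<dots> x = (LINT k|lborel. ?e k * ((-1) * (complex_of_real (k \<bullet> b) * (complex_of_real (k \<bullet> b) * \<psi> k))))"
      by (rule fourier_lborel[OF schwartz_measurable[OF schwartz_const_mult[OF S]]])
    finally show ?thesis by simp
  qed
  moreover have "fourier (\<lambda>k. complex_of_real ((norm k)\<^sup>2) * \<psi> k) x =
      (LINT k|lborel. (\<Sum>b\<in>Basis. ?e k * (complex_of_real (k \<bullet> b) * (complex_of_real (k \<bullet> b) * \<psi> k))))"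
  proof -
    have eq: "complex_of_real ((norm k)\<^sup>2) * \<psi> k = (\<Sum>b\<in>Basis. complex_of_real (k \<bullet> b) * (complex_of_real (k \<bullet> b) * \<psi> k))" for k
    proof -
      have "(norm k)\<^sup>2 = (\<Sum>b\<in>Basis. (k \<bullet> b) * (k \<bullet> b))"
        by (simp add: power2_norm_eq_inner euclidean_inner[of k k])
      then show ?thesis by (simp add: sum_distrib_right mult.assoc)
    qed
    have "(\<lambda>k. complex_of_real ((norm k)\<^sup>2) * \<psi> k) \<in> borel_measurable borel"
      using schwartz_measurable[OF \<psi>] by measurable
    from fourier_lborel[OF this, of x] show ?thesis unfolding eq sum_distrib_left .
  qed
  ultimately show ?thesis using I by (simp add: sum_negf Bochner_Integration.integral_sum)
qed

lemma fourier_swap: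
  fixes f g :: "'a::euclidean_space \<Rightarrow> complex"
  assumes f: "integrable lborel f" and g: "integrable lborel g"
  shows "(LINT x|lborel. f x * fourier g x) = (LINT k|lborel. fourier f k * g k)"
proof -
  have [measurable]: "f \<in> borel_measurable borel" "g \<in> borel_measurable borel" using f g by auto
  let ?F = "\<lambda>x k. exp (- (\<i> * complex_of_real (x \<bullet> k))) * f x * g k"
  have "integrable (lborel \<Otimes>\<^sub>M lborel) (case_prod ?F)"
  proof (rule lborel_pair.Fubini_integrable)
    show "case_prod ?F \<in> borel_measurable (lborel \<Otimes>\<^sub>M lborel)" by measurable
    show "integrable lborel (\<lambda>x. LINT y|lborel. norm (case_prod ?F (x, y)))"
      using f by (simp add: norm_mult)
    show "AE x in lborel. integrable lborel (\<lambda>y. case_prod ?F (x, y))"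
      using integrable_character_mult[OF g] by (intro AE_I2) (simp add: mult.left_commute mult.assoc)
  qed
  from lborel_pair.Fubini_integral[OF this]
  have "(LINT k|lborel. LINT x|lborel. ?F x k) = (LINT x|lborel. LINT k|lborel. ?F x k)" .
  moreover have "(LINT x|lborel. ?F x k) = fourier f k * g k" for k
    by (simp add: fourier_lborel inner_commute del: mult_cancel_right)
  moreover have "(LINT k|lborel. ?F x k) = f x * fourier g x" for x
    by (simp add: fourier_lborel mult.left_commute mult.assoc flip: integral_mult_right_zero)
  ultimately show ?thesis by (simp only:)
qed

lemma fourier_measurable:
  fixes f :: "'a::euclidean_space \<Rightarrow> complex"
  assumes [measurable]: "f \<in> borel_measurable borel"
  shows "fourier f \<in> borel_measurable borel"
proof -
  have "(\<lambda>k. LINT x|lborel. exp (- (\<i> * complex_of_real (k \<bullet> x))) * f x) \<in> borel_measurable borel"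
    by measurable
  then show ?thesis using fourier_lborel[OF assms] by (simp cong: measurable_cong)
qed

section \<open>Weak derivatives and difference quotients\<close>

lemma has_weak_deriv_iff:
  "has_weak_deriv UNIV bs f h \<longleftrightarrow> locally_integrable UNIV f \<and> locally_integrable UNIV h \<and>
     (\<forall>\<psi>\<in>test_functions UNIV.
        (LINT x|lebesgue. f x * pds bs \<psi> x) = (-1) ^ length bs * (LINT x|lebesgue. h x * \<psi> x))"
  by (simp add: has_weak_deriv_def set_lebesgue_integral_def)

lemma locally_integrable_cong_AE:
  fixes f g :: "'a::euclidean_space \<Rightarrow> real"
  assumes f: "locally_integrable UNIV f" and g: "g \<in> borel_measurable lebesgue"
    and eq: "AE x in lebesgue. f x = g x"
  shows "locally_integrable UNIV g"
  unfolding locally_integrable_def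
proof (intro allI impI, elim conjE)
  fix K :: "'a set" assume "compact K"
  then have int: "integrable lebesgue (\<lambda>x. indicator K x *\<^sub>R f x)" and K: "K \<in> sets lebesgue"
    using f by (auto simp: locally_integrable_def set_integrable_def intro: fmeasurableD lmeasurable_compact)
  from int show "set_integrable lebesgue K g"
    unfolding set_integrable_def
    by (rule integrable_cong_AE_imp)
      (use eq g K in \<open>auto elim!: eventually_mono intro!: borel_measurable_scaleR borel_measurable_indicator\<close>)
qed

lemma integral_mult_cong_AE:
  fixes f g \<psi> :: "'a::euclidean_space \<Rightarrow> real"
  assumes "f \<in> borel_measurable lebesgue" "g \<in> borel_measurable lebesgue" "AE x in lebesgue. f x = g x"
    and "\<psi> \<in> borel_measurable lebesgue"
  shows "(LINT x|lebesgue. f x * \<psi> x) = (LINT x|lebesgue. g x * \<psi> x)"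
  by (rule integral_cong_AE) (use assms in \<open>auto elim!: eventually_mono\<close>)

lemma has_weak_deriv_cong_AE:
  assumes "has_weak_deriv UNIV [b] u w" "b \<in> Basis"
    and "u' \<in> borel_measurable lebesgue" "AE x in lebesgue. u x = u' x"
    and "w' \<in> borel_measurable lebesgue" "AE x in lebesgue. w x = w' x"
  shows "has_weak_deriv UNIV [b] u' w'"
proof -
  have u: "locally_integrable UNIV u" and w: "locally_integrable UNIV w"
    using assms(1) by (auto simp: has_weak_deriv_iff)
  note m = locally_integrable_measurable[OF u] locally_integrable_measurable[OF w]
  have "(LINT x|lebesgue. u' x * pds [b] \<psi> x) = (-1) ^ length [b] * (LINT x|lebesgue. w' x * \<psi> x)"
    if \<psi>: "\<psi> \<in> test_functions UNIV" for \<psi>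
  proof -
    have "(LINT x|lebesgue. u x * pds [b] \<psi> x) = (LINT x|lebesgue. u' x * pds [b] \<psi> x)"
      by (rule integral_mult_cong_AE) (use assms m in \<open>auto intro!: test_function_measurable_lebesgue pd_test_function \<psi>\<close>)
    moreover have "(LINT x|lebesgue. w x * \<psi> x) = (LINT x|lebesgue. w' x * \<psi> x)"
      by (rule integral_mult_cong_AE) (use assms m in \<open>auto intro!: test_function_measurable_lebesgue \<psi>\<close>)
    ultimately show ?thesis using assms(1) \<psi> by (simp add: has_weak_deriv_iff)
  qed
  then show ?thesis
    using locally_integrable_cong_AE[OF u] locally_integrable_cong_AE[OF w] assms
    by (simp add: has_weak_deriv_iff)
qed

lemma locally_integrable_lborel:
  fixes f :: "'a::euclidean_space \<Rightarrow> real"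
  assumes "locally_integrable UNIV f" "f \<in> borel_measurable borel" "compact K"
  shows "integrable lborel (\<lambda>x. indicator K x * f x)"
proof -
  have [measurable]: "K \<in> sets borel" using assms(3) by (simp add: compact_imp_closed)
  have "integrable lebesgue (\<lambda>x. indicator K x * f x)"
    using assms by (auto simp: locally_integrable_def set_integrable_def)
  then show ?thesis using assms(2) by (subst (asm) integrable_completion) auto
qed

lemma compact_sweep:
  fixes K :: "'a::euclidean_space set"
  assumes "compact K" shows "compact ((\<lambda>(s, x). x + s *\<^sub>R b) ` ({0..h::real} \<times> K))"
  by (intro compact_continuous_image compact_Times assms compact_Icc)
    (auto simp: case_prod_beta intro!: continuous_intros)

lemma sweep_mem: "0 \<le> s \<Longrightarrow> s \<le> h \<Longrightarrow> x \<in> K \<Longrightarrow> x + s *\<^sub>R b \<in> (\<lambda>(s, x). x + s *\<^sub>R b) ` ({0..h::real} \<times> K)"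
  by (auto intro!: image_eqI[of _ _ "(s, x)"])

text \<open>The two integrands below differ by the shear \<open>(s, x) \<mapsto> (s, x + s b)\<close>; Fubini's
  theorem applies to both.\<close>

lemma shear_integrable:
  fixes w g :: "'a::euclidean_space \<Rightarrow> real"
  assumes w: "locally_integrable UNIV w" and [measurable]: "w \<in> borel_measurable borel" "g \<in> borel_measurable borel"
    and K: "compact K" "\<And>x. x \<notin> K \<Longrightarrow> g x = 0" "\<And>x. \<bar>g x\<bar> \<le> C"
  shows "integrable (lborel \<Otimes>\<^sub>M lborel) (\<lambda>(s, x). indicator {0..h::real} s * (w x * g (x - s *\<^sub>R b)))" (is ?G)
    and "integrable (lborel \<Otimes>\<^sub>M lborel) (\<lambda>(s, x). indicator {0..h::real} s * (w (x + s *\<^sub>R b) * g x))" (is ?F)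
proof -
  define K' where "K' = (\<lambda>(s, x). x + s *\<^sub>R b) ` ({0..h} \<times> K)"
  define I where "I = (LINT x|lborel. C * \<bar>indicator K' x * w x\<bar>)"
  have C: "C \<ge> 0" using order_trans[OF abs_ge_zero K(3)] .
  have iK: "integrable lborel (\<lambda>x. C * \<bar>indicator K' x * w x\<bar>)"
    unfolding K'_def by (intro integrable_mult_right integrable_abs locally_integrable_lborel w assms(2) compact_sweep K)
  have le: "\<bar>w x * g (x - s *\<^sub>R b)\<bar> \<le> C * \<bar>indicator K' x * w x\<bar>" if "s \<in> {0..h}" for s x
  proof (cases "g (x - s *\<^sub>R b) = 0")
    case False
    then have "x - s *\<^sub>R b \<in> K" using K(2) by blast
    then have "x \<in> K'" using sweep_mem[of s h "x - s *\<^sub>R b" K b] that by (simp add: K'_def)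
    then show ?thesis using mult_left_mono[OF K(3)[of "x - s *\<^sub>R b"], of "\<bar>w x\<bar>"] by (simp add: abs_mult mult.commute)
  qed (use C in simp)
  have J: "integrable lborel (\<lambda>x. w x * g (x - s *\<^sub>R b))" if "s \<in> {0..h}" for s
    by (rule Bochner_Integration.integrable_bound[OF iK]) (use le[OF that] C in auto)
  have JI: "(LINT x|lborel. \<bar>w x * g (x - s *\<^sub>R b)\<bar>) \<le> I" if "s \<in> {0..h}" for s
    unfolding I_def by (rule integral_mono[OF _ iK]) (use J le that in auto)
  have I0: "I \<ge> 0" unfolding I_def using C by (intro Bochner_Integration.integral_nonneg) auto
  have b: "integrable lborel (\<lambda>s. I * indicator {0..h} s)"
    by (intro integrable_mult_right integrable_real_indicator) (auto simp: emeasure_lborel_Icc_eq)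
  show ?G
  proof (rule lborel_pair.Fubini_integrable)
    show "integrable lborel (\<lambda>s. LINT x|lborel. norm (case (s, x) of (s, x) \<Rightarrow> indicator {0..h} s * (w x * g (x - s *\<^sub>R b))))"
    proof (rule Bochner_Integration.integrable_bound[OF b])
      show "AE s in lborel. norm (LINT x|lborel. norm (case (s, x) of (s, x) \<Rightarrow> indicator {0..h} s * (w x * g (x - s *\<^sub>R b)))) \<le> norm (I * indicator {0..h} s)"
        using JI I0 by (intro AE_I2) (auto simp: indicator_def abs_of_nonneg)
    qed measurable
    show "AE s in lborel. integrable lborel (\<lambda>x. case (s, x) of (s, x) \<Rightarrow> indicator {0..h} s * (w x * g (x - s *\<^sub>R b)))"
      using J by (intro AE_I2) (auto simp: indicator_def)
  qed measurable
  have tr: "integrable lborel (\<lambda>x. w (x + s *\<^sub>R b) * g x)" if "s \<in> {0..h}" for s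
    using integrable_translate[OF J[OF that], of "s *\<^sub>R b"] by simp
  show ?F
  proof (rule lborel_pair.Fubini_integrable)
    have JI': "(LINT x|lborel. \<bar>w (x + s *\<^sub>R b) * g x\<bar>) \<le> I" if "s \<in> {0..h}" for s
      using JI[OF that] integral_translate[of "\<lambda>y. \<bar>w y * g (y - s *\<^sub>R b)\<bar>" "s *\<^sub>R b"] by simp
    show "integrable lborel (\<lambda>s. LINT x|lborel. norm (case (s, x) of (s, x) \<Rightarrow> indicator {0..h} s * (w (x + s *\<^sub>R b) * g x)))"
    proof (rule Bochner_Integration.integrable_bound[OF b])
      show "AE s in lborel. norm (LINT x|lborel. norm (case (s, x) of (s, x) \<Rightarrow> indicator {0..h} s * (w (x + s *\<^sub>R b) * g x))) \<le> norm (I * indicator {0..h} s)"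
        using JI' I0 by (intro AE_I2) (auto simp: indicator_def abs_of_nonneg)
    qed measurable
    show "AE s in lborel. integrable lborel (\<lambda>x. case (s, x) of (s, x) \<Rightarrow> indicator {0..h} s * (w (x + s *\<^sub>R b) * g x))"
      using tr by (intro AE_I2) (auto simp: indicator_def)
  qed measurable
qed

text \<open>The fundamental theorem of calculus along almost every segment of length \<open>h\<close>.  Tested
  against \<open>\<psi>\<close>, the increment of \<open>u\<close> becomes the integral of \<open>u\<close> times an increment of \<open>\<psi>\<close>,
  which is an integral of translates of the derivative of \<open>\<psi>\<close>; the weak derivative is applied
  under the integral over the translations.\<close>

lemma weak_increment:
  fixes u w :: "'a::euclidean_space \<Rightarrow> real"
  assumes wd: "has_weak_deriv UNIV [b] u w" and b: "b \<in> Basis"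
    and [measurable]: "u \<in> borel_measurable borel" "w \<in> borel_measurable borel" and h: "0 \<le> h"
  shows "AE x in lborel. integrable lborel (\<lambda>s. indicator {0..h} s * w (x + s *\<^sub>R b)) \<and>
      u (x + h *\<^sub>R b) - u x = (LINT s|lborel. indicator {0..h} s * w (x + s *\<^sub>R b))"
proof -
  have u: "locally_integrable UNIV u" and w: "locally_integrable UNIV w"
    using wd by (auto simp: has_weak_deriv_iff)
  define W where "W x = (LINT s|lborel. indicator {0..h} s * w (x + s *\<^sub>R b))" for x
  have [measurable]: "W \<in> borel_measurable borel" unfolding W_def[abs_def] by measurable
  have "AE x in lborel. integrable lborel (\<lambda>s. indicator {0..h} s * (w (x + s *\<^sub>R b) * indicator (cball 0 (real n)) x))" for n
    by (rule lborel_pair.AE_integrable_snd,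
        rule shear_integrable(2)[OF w assms(4) _ compact_cball[of 0 "real n"], where C=1])
      (auto simp: indicator_def)
  then have "AE x in lborel. \<forall>n. integrable lborel (\<lambda>s. indicator {0..h} s * (w (x + s *\<^sub>R b) * indicator (cball 0 (real n)) x))"
    unfolding AE_all_countable by blast
  then have int: "AE x in lborel. integrable lborel (\<lambda>s. indicator {0..h} s * w (x + s *\<^sub>R b))"
  proof eventually_elim
    case (elim x)
    obtain n where "norm x \<le> real n" using real_arch_simple by blast
    then show ?case using elim[rule_format, of n] by simp
  qed
  have Wint: "integrable lborel (\<lambda>x. W x * g x)"
    if "g \<in> borel_measurable borel" "compact K" "\<And>x. x \<notin> K \<Longrightarrow> g x = 0" "\<And>x. \<bar>g x\<bar> \<le> C" for g K C
    using lborel_pair.integrable_snd[OF shear_integrable(2)[OF w assms(4) that]]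
    unfolding W_def by (simp add: mult.assoc[symmetric])
  have locW: "locally_integrable UNIV W"
    unfolding locally_integrable_def
  proof (intro allI impI, elim conjE)
    fix K :: "'a set" assume K: "compact K"
    then have [measurable]: "K \<in> sets borel" by (simp add: compact_imp_closed)
    have "integrable lborel (\<lambda>x. W x * indicator K x)"
      by (rule Wint[OF _ K, of _ 1]) (auto simp: indicator_def)
    then show "set_integrable lebesgue K W"
      unfolding set_integrable_def by (subst integrable_completion) (auto simp: mult.commute)
  qed
  have locu: "locally_integrable UNIV (\<lambda>x. u (x + h *\<^sub>R b))"
    unfolding locally_integrable_def
  proof (intro allI impI, elim conjE)
    fix K :: "'a set" assume K: "compact K"
    then have [measurable]: "K \<in> sets borel" by (simp add: compact_imp_closed)
    have "integrable lborel (\<lambda>x. indicator ((\<lambda>(s, x). x + s *\<^sub>R b) ` ({0..h} \<times> K)) (x + h *\<^sub>R b) * u (x + h *\<^sub>R b))"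
      by (rule integrable_translate[OF locally_integrable_lborel[OF u assms(3) compact_sweep[OF K]]])
    then have "integrable lborel (\<lambda>x. indicator K x * u (x + h *\<^sub>R b))"
      by (rule Bochner_Integration.integrable_bound)
        (use sweep_mem[of h h _ K b] h in \<open>auto simp: indicator_def\<close>)
    then show "set_integrable lebesgue K (\<lambda>x. u (x + h *\<^sub>R b))"
      unfolding set_integrable_def by (subst integrable_completion) auto
  qed
  have "AE x in lebesgue. u (x + h *\<^sub>R b) - u x = W x"
  proof (rule du_Bois_Reymond_eq[OF locally_integrable_diff[OF locu u] locW])
    fix \<psi> :: "'a \<Rightarrow> real" assume \<psi>: "\<psi> \<in> test_functions UNIV"
    note [measurable] = test_function_measurable[OF \<psi>] test_function_measurable[OF pd_test_function[OF \<psi> b]]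
    obtain K C where K: "compact K" "\<And>x. x \<notin> K \<Longrightarrow> \<psi> x = 0" "\<And>x. \<bar>\<psi> x\<bar> \<le> C"
      using test_function_support[OF \<psi>] by metis
    obtain K1 C1 where K1: "compact K1" "\<And>x. x \<notin> K1 \<Longrightarrow> pd b \<psi> x = 0" "\<And>x. \<bar>pd b \<psi> x\<bar> \<le> C1"
      using test_function_support[OF pd_test_function[OF \<psi> b]] by metis
    have sm: "\<psi> differentiable (at x)" for x using \<psi> by (auto simp: test_functions_def smooth_differentiable)
    have dpsi: "(LINT s|lborel. indicator {0..h} s * pd b \<psi> (x - s *\<^sub>R b)) = \<psi> x - \<psi> (x - h *\<^sub>R b)" for x
    proof -
      have "(LINT s|lborel. indicator {0..h} s *\<^sub>R pd b \<psi> (x - s *\<^sub>R b)) = - \<psi> (x - h *\<^sub>R b) - (- \<psi> (x - 0 *\<^sub>R b))"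
      proof (rule integral_FTC_Icc[OF h])
        fix s
        have "((\<lambda>s. x - s *\<^sub>R b) has_derivative (\<lambda>t. (- t) *\<^sub>R b)) (at s within {0..h})"
          by (auto intro!: derivative_eq_intros)
        from has_derivative_compose[OF this has_derivative_pd[OF sm]]
        have "((\<lambda>s. \<psi> (x - s *\<^sub>R b)) has_derivative (\<lambda>t. - t * pd b \<psi> (x - s *\<^sub>R b))) (at s within {0..h})"
          by (simp only: pd_scaleR[OF sm] real_scaleR_def)
        from has_derivative_minus[OF this]
        show "((\<lambda>s. - \<psi> (x - s *\<^sub>R b)) has_vector_derivative pd b \<psi> (x - s *\<^sub>R b)) (at s within {0..h})"
          by (simp add: has_vector_derivative_def)
      next
        show "continuous_on {0..h} (\<lambda>s. pd b \<psi> (x - s *\<^sub>R b))"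
          by (rule continuous_on_compose2[OF test_function_continuous[OF pd_test_function[OF \<psi> b], of UNIV]])
            (auto intro!: continuous_intros)
      qed
      then show ?thesis by simp
    qed
    have W\<psi>: "(LINT x|lborel. W x * \<psi> x) = (LINT s|lborel. indicator {0..h} s * (LINT x|lborel. w x * \<psi> (x - s *\<^sub>R b)))"
    proof -
      have "(LINT x|lborel. W x * \<psi> x) = (LINT x|lborel. LINT s|lborel. indicator {0..h} s * (w (x + s *\<^sub>R b) * \<psi> x))"
        unfolding W_def by (simp add: mult.assoc[symmetric])
      also have "\<dots> = (LINT s|lborel. LINT x|lborel. indicator {0..h} s * (w (x + s *\<^sub>R b) * \<psi> x))"
        by (rule lborel_pair.Fubini_integral[OF shear_integrable(2)[OF w assms(4) _ K]]) simp
      also have "\<dots> = (LINT s|lborel. indicator {0..h} s * (LINT x|lborel. w x * \<psi> (x - s *\<^sub>R b)))"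
        using integral_translate[of "\<lambda>x. w x * \<psi> (x - s *\<^sub>R b)" "s *\<^sub>R b" for s] by simp
      finally show ?thesis .
    qed
    have weak: "(LINT x|lborel. u x * pd b \<psi> (x - s *\<^sub>R b)) = - (LINT x|lborel. w x * \<psi> (x - s *\<^sub>R b))" for s
    proof -
      have t: "(\<lambda>x. \<psi> (x - s *\<^sub>R b)) \<in> test_functions UNIV"
      proof -
        have "compact ((+) (s *\<^sub>R b) ` K)" using K(1) by (rule compact_translation)
        moreover have "\<psi> (x - s *\<^sub>R b) = 0" if "x \<notin> (+) (s *\<^sub>R b) ` K" for x
          using that K(2)[of "x - s *\<^sub>R b"] by (auto simp: image_iff) (metis add.commute diff_add_cancel)
        moreover have "smooth (\<lambda>x. \<psi> (1 *\<^sub>R x + - (s *\<^sub>R b)))"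
          by (rule smooth_affine) (use \<psi> in \<open>auto simp: test_functions_def\<close>)
        ultimately show ?thesis by (auto simp: test_functions_def)
      qed
      have p: "pd b (\<lambda>x. \<psi> (x - s *\<^sub>R b)) = (\<lambda>x. pd b \<psi> (x - s *\<^sub>R b))"
        using pd_affine[OF sm, of b 1 "- (s *\<^sub>R b)"] by simp
      have "(LINT x|lebesgue. u x * pd b (\<lambda>x. \<psi> (x - s *\<^sub>R b)) x) = - (LINT x|lebesgue. w x * \<psi> (x - s *\<^sub>R b))"
        using wd t by (auto simp: has_weak_deriv_iff)
      then have "(LINT x|lebesgue. u x * pd b \<psi> (x - s *\<^sub>R b)) = - (LINT x|lebesgue. w x * \<psi> (x - s *\<^sub>R b))"
        by (simp only: p)
      then show ?thesis by (simp add: integral_completion)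
    qed
    have i1: "integrable lborel (\<lambda>x. u (x + h *\<^sub>R b) * \<psi> x)" and i2: "integrable lborel (\<lambda>x. u x * \<psi> x)"
      using integrable_mult_test_function[OF locu \<psi>] integrable_mult_test_function[OF u \<psi>]
      by (simp_all add: integrable_completion)
    have i3: "integrable lborel (\<lambda>x. u x * \<psi> (x - h *\<^sub>R b))"
      using integrable_translate[OF i1, of "- (h *\<^sub>R b)"] by simp
    have "(LINT x|lborel. (u (x + h *\<^sub>R b) - u x) * \<psi> x) = (LINT x|lborel. u (x + h *\<^sub>R b) * \<psi> x) - (LINT x|lborel. u x * \<psi> x)"
      using i1 i2 by (simp add: left_diff_distrib)
    also have "(LINT x|lborel. u (x + h *\<^sub>R b) * \<psi> x) = (LINT x|lborel. u x * \<psi> (x - h *\<^sub>R b))"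
      using integral_translate[of "\<lambda>x. u x * \<psi> (x - h *\<^sub>R b)" "h *\<^sub>R b"] by simp
    also have "\<dots> - (LINT x|lborel. u x * \<psi> x) = - (LINT x|lborel. u x * (\<psi> x - \<psi> (x - h *\<^sub>R b)))"
      using i2 i3 by (simp add: right_diff_distrib)
    also have "(LINT x|lborel. u x * (\<psi> x - \<psi> (x - h *\<^sub>R b))) =
        (LINT x|lborel. LINT s|lborel. indicator {0..h} s * (u x * pd b \<psi> (x - s *\<^sub>R b)))"
      unfolding dpsi[symmetric] by (simp add: mult.left_commute)
    also have "\<dots> = (LINT s|lborel. LINT x|lborel. indicator {0..h} s * (u x * pd b \<psi> (x - s *\<^sub>R b)))"
      by (rule lborel_pair.Fubini_integral[OF shear_integrable(1)[OF u assms(3) _ K1]]) simp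
    also have "- \<dots> = (LINT x|lborel. W x * \<psi> x)"
      unfolding W\<psi> using weak by simp
    finally show "(LINT x|lebesgue. (u (x + h *\<^sub>R b) - u x) * \<psi> x) = (LINT x|lebesgue. W x * \<psi> x)"
      by (simp add: integral_completion)
  qed
  then have "AE x in lborel. u (x + h *\<^sub>R b) - u x = W x" by (simp add: AE_completion_iff)
  with int show ?thesis by eventually_elim (simp add: W_def)
qed

text \<open>Hence difference quotients converge to the weak derivative locally in the mean: they are
  averages of translates of it.\<close>

lemma difference_quotient_mean:
  fixes u w :: "'a::euclidean_space \<Rightarrow> real" and h :: "nat \<Rightarrow> real"
  assumes wd: "has_weak_deriv UNIV [b] u w" and b: "b \<in> Basis"
    and [measurable]: "u \<in> borel_measurable borel" "w \<in> borel_measurable borel"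
    and h: "\<And>n. 0 < h n" "h \<longlonglongrightarrow> 0" and K: "compact K"
  shows "(\<lambda>n. \<integral>\<^sup>+x. indicator K x * ennreal \<bar>(u (x + h n *\<^sub>R b) - u x) / h n - w x\<bar> \<partial>lborel) \<longlonglongrightarrow> 0"
proof -
  have w: "locally_integrable UNIV w" using wd by (auto simp: has_weak_deriv_iff)
  have [measurable]: "K \<in> sets borel" using K by (simp add: compact_imp_closed)
  define K' where "K' = (\<lambda>(s, x). x + s *\<^sub>R b) ` ({0..1} \<times> K)"
  have [measurable]: "K' \<in> sets borel" unfolding K'_def by (intro borel_closed compact_imp_closed compact_sweep K)
  \<comment> \<open>an integrable function that agrees with \<open>w\<close> on \<open>K + s b\<close> for all \<open>0 \<le> s \<le> 1\<close>\<close>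
  define v where "v x = indicator K' x * w x" for x
  have iv: "integrable lborel v" unfolding v_def K'_def by (intro locally_integrable_lborel w assms(4) compact_sweep K)
  have [measurable]: "v \<in> borel_measurable borel" using iv by auto
  define T where "T s = (LINT x|lborel. \<bar>v (x + s *\<^sub>R b) - v x\<bar>)" for s
  have T: "(T \<longlongrightarrow> 0) (at 0)"
    unfolding tendsto_at_iff_sequentially
  proof (intro allI impI)
    fix X :: "nat \<Rightarrow> real" assume "X \<longlonglongrightarrow> 0"
    then have "(\<lambda>n. X n *\<^sub>R b) \<longlonglongrightarrow> 0 *\<^sub>R b" by (intro tendsto_intros)
    then show "(T \<circ> X) \<longlonglongrightarrow> 0"
      using integrable_mean_continuous[OF iv] by (simp add: mean_continuous_def T_def o_def)
  qed
  have Tnn: "(\<integral>\<^sup>+x. ennreal \<bar>v (x + s *\<^sub>R b) - v x\<bar> \<partial>lborel) = ennreal (T s)" for s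
    unfolding T_def by (rule nn_integral_eq_integral) (auto intro!: Bochner_Integration.integrable_diff integrable_translate iv)
  show ?thesis
  proof (rule order_tendstoI)
    fix e :: ennreal assume "0 < e"
    then obtain \<epsilon> :: real where \<epsilon>: "\<epsilon> > 0" "ennreal \<epsilon> < e"
      using dense[of 0 e] by (metis ennreal_less_zero_iff less_top_ennreal not_less top_greatest order.strict_trans2)
    from T \<epsilon>(1) obtain d where d: "d > 0" "\<And>s. s \<noteq> 0 \<Longrightarrow> \<bar>s\<bar> < d \<Longrightarrow> \<bar>T s\<bar> < \<epsilon>"
      by (auto simp: tendsto_iff eventually_at dist_real_def)
    have T\<epsilon>: "T s \<le> \<epsilon>" if "0 \<le> s" "s < d" for s
    proof (cases "s = 0")
      case True then show ?thesis using \<epsilon> by (simp add: T_def)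
    next
      case False then show ?thesis using d(2)[of s] that by simp
    qed
    have "\<forall>\<^sub>F n in sequentially. h n < min d 1" using h(2) d(1) by (intro order_tendstoD) auto
    then show "\<forall>\<^sub>F n in sequentially. (\<integral>\<^sup>+x. indicator K x * ennreal \<bar>(u (x + h n *\<^sub>R b) - u x) / h n - w x\<bar> \<partial>lborel) < e"
    proof eventually_elim
      case (elim n)
      define k where "k = h n"
      have k: "0 < k" "k < d" "k \<le> 1" using h(1)[of n] elim by (auto simp: k_def)
      have "AE x in lborel. indicator K x * ennreal \<bar>(u (x + k *\<^sub>R b) - u x) / k - w x\<bar> \<le>
         ennreal (1 / k) * (\<integral>\<^sup>+s. indicator {0..k} s * ennreal \<bar>v (x + s *\<^sub>R b) - v x\<bar> \<partial>lborel)"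
        using weak_increment[OF wd b assms(3,4) less_imp_le[OF k(1)]]
      proof eventually_elim
        case (elim x)
        show ?case
        proof (cases "x \<in> K")
          case True
          have vx: "v (x + s *\<^sub>R b) = w (x + s *\<^sub>R b)" if "s \<in> {0..k}" for s
            using sweep_mem[of s 1 x K b] that k True by (simp add: v_def K'_def)
          have vx0: "v x = w x" using vx[of 0] k by simp
          have i: "integrable lborel (\<lambda>s. indicator {0..k} s * w (x + s *\<^sub>R b))" using elim by blast
          have ik: "integrable lborel (indicator {0..k} :: real \<Rightarrow> real)"
            by (intro integrable_real_indicator) (auto simp: emeasure_lborel_Icc_eq)
          have eq: "(u (x + k *\<^sub>R b) - u x) / k - w x = (1 / k) * (LINT s|lborel. indicator {0..k} s * (v (x + s *\<^sub>R b) - v x))"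
          proof -
            have "(LINT s|lborel. indicator {0..k} s * (v (x + s *\<^sub>R b) - v x)) =
               (LINT s|lborel. indicator {0..k} s * w (x + s *\<^sub>R b) - indicator {0..k} s * w x)"
              by (rule Bochner_Integration.integral_cong) (auto simp: indicator_def vx vx0)
            also have "\<dots> = (u (x + k *\<^sub>R b) - u x) - k * w x"
              using elim k i ik by (subst Bochner_Integration.integral_diff) auto
            finally show ?thesis using k by (simp add: field_simps)
          qed
          have i': "integrable lborel (\<lambda>s. indicator {0..k} s * (v (x + s *\<^sub>R b) - v x))"
          proof -
            have "integrable lborel (\<lambda>s. indicator {0..k} s * w (x + s *\<^sub>R b) - indicator {0..k} s * w x)"
              using i ik by (intro Bochner_Integration.integrable_diff) auto
            then show ?thesis
              by (rule back_subst[where P="integrable lborel"]) (auto simp: fun_eq_iff indicator_def vx vx0)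
          qed
          have "ennreal \<bar>(u (x + k *\<^sub>R b) - u x) / k - w x\<bar> =
            ennreal (1 / k) * ennreal (norm (LINT s|lborel. indicator {0..k} s * (v (x + s *\<^sub>R b) - v x)))"
            unfolding eq using k by (simp add: abs_mult ennreal_mult'[symmetric])
          also have "\<dots> \<le> ennreal (1 / k) * (\<integral>\<^sup>+s. ennreal (norm (indicator {0..k} s * (v (x + s *\<^sub>R b) - v x))) \<partial>lborel)"
            by (intro mult_left_mono integral_norm_bound_ennreal i') simp
          also have "(\<integral>\<^sup>+s. ennreal (norm (indicator {0..k} s * (v (x + s *\<^sub>R b) - v x))) \<partial>lborel) =
            (\<integral>\<^sup>+s. indicator {0..k} s * ennreal \<bar>v (x + s *\<^sub>R b) - v x\<bar> \<partial>lborel)"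
            by (rule nn_integral_cong) (auto simp: indicator_def)
          finally show ?thesis using True by simp
        qed simp
      qed
      then have "(\<integral>\<^sup>+x. indicator K x * ennreal \<bar>(u (x + k *\<^sub>R b) - u x) / k - w x\<bar> \<partial>lborel) \<le>
        (\<integral>\<^sup>+x. ennreal (1 / k) * (\<integral>\<^sup>+s. indicator {0..k} s * ennreal \<bar>v (x + s *\<^sub>R b) - v x\<bar> \<partial>lborel) \<partial>lborel)"
        by (rule nn_integral_mono_AE)
      also have "\<dots> = ennreal (1 / k) * (\<integral>\<^sup>+x. \<integral>\<^sup>+s. indicator {0..k} s * ennreal \<bar>v (x + s *\<^sub>R b) - v x\<bar> \<partial>lborel \<partial>lborel)"
        by (rule nn_integral_cmult) measurable
      also have "(\<integral>\<^sup>+x. \<integral>\<^sup>+s. indicator {0..k} s * ennreal \<bar>v (x + s *\<^sub>R b) - v x\<bar> \<partial>lborel \<partial>lborel) =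
        (\<integral>\<^sup>+s. \<integral>\<^sup>+x. indicator {0..k} s * ennreal \<bar>v (x + s *\<^sub>R b) - v x\<bar> \<partial>lborel \<partial>lborel)"
        by (rule lborel_pair.Fubini') measurable
      also have "\<dots> = (\<integral>\<^sup>+s. indicator {0..k} s * ennreal (T s) \<partial>lborel)"
        by (simp add: nn_integral_cmult Tnn)
      also have "\<dots> \<le> (\<integral>\<^sup>+s. ennreal \<epsilon> * indicator {0..k} s \<partial>lborel)"
        by (rule nn_integral_mono) (use T\<epsilon> k in \<open>auto simp: indicator_def intro!: ennreal_leI\<close>)
      also have "\<dots> = ennreal \<epsilon> * ennreal k" using k by (simp add: nn_integral_cmult_indicator)
      also have "ennreal (1 / k) * (ennreal \<epsilon> * ennreal k) = ennreal \<epsilon>"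
        using k \<epsilon> by (simp add: ennreal_mult'[symmetric])
      finally show ?case using \<epsilon>(2) by (simp add: k_def mult_left_mono)
    qed
  qed simp
qed

section \<open>Chain rule for weak derivatives\<close>

lemma integrable_mult_compact_support:
  fixes f g :: "'a::euclidean_space \<Rightarrow> real"
  assumes "locally_integrable UNIV f" "f \<in> borel_measurable borel" "g \<in> borel_measurable borel"
    and "compact K" "\<And>x. x \<notin> K \<Longrightarrow> g x = 0" "\<And>x. \<bar>g x\<bar> \<le> C"
  shows "integrable lborel (\<lambda>x. f x * g x)"
proof -
  have "integrable lebesgue (\<lambda>x. f x * g x)"
    by (rule integrable_locally_integrable_mult[OF assms(1) _ assms(4)])
      (use assms in \<open>auto intro: measurable_completion\<close>)
  then show ?thesis using assms(2,3) by (subst (asm) integrable_completion) auto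
qed

lemma locally_integrable_of_components:
  fixes f :: "'a::euclidean_space \<Rightarrow> real" and u :: "'a \<Rightarrow> 'e::euclidean_space"
  assumes f: "f \<in> borel_measurable borel"
    and u: "\<And>c. c \<in> Basis \<Longrightarrow> locally_integrable UNIV (\<lambda>x. u x \<bullet> c)"
    and le: "\<And>x. \<bar>f x\<bar> \<le> A + L * norm (u x)" and "0 \<le> L" "0 \<le> A"
  shows "locally_integrable UNIV f"
  unfolding locally_integrable_def
proof (intro allI impI, elim conjE)
  fix K :: "'a set" assume K: "compact K"
  then have Km: "K \<in> sets lebesgue" by (intro fmeasurableD lmeasurable_compact)
  have "integrable lebesgue (\<lambda>x. A * indicator K x + L * (\<Sum>c\<in>Basis. \<bar>indicator K x *\<^sub>R (u x \<bullet> c)\<bar>))"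
  proof (intro Bochner_Integration.integrable_add integrable_mult_right Bochner_Integration.integrable_sum integrable_abs)
    show "integrable lebesgue (indicator K :: 'a \<Rightarrow> real)"
    proof (rule integrable_real_indicator[OF Km])
      show "emeasure lebesgue K < \<infinity>"
        using lmeasurable_compact[OF K] unfolding fmeasurable_def by blast
    qed
    show "integrable lebesgue (\<lambda>x. indicator K x *\<^sub>R (u x \<bullet> c))" if "c \<in> Basis" for c
      using u[OF that] K by (simp add: locally_integrable_def set_integrable_def)
  qed
  then show "set_integrable lebesgue K f"
    unfolding set_integrable_def
  proof (rule Bochner_Integration.integrable_bound)
    show "(\<lambda>x. indicator K x *\<^sub>R f x) \<in> borel_measurable lebesgue"
      by (rule borel_measurable_scaleR[OF borel_measurable_indicator[OF Km]])
        (use f in \<open>auto intro: measurable_completion\<close>)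
    show "AE x in lebesgue. norm (indicator K x *\<^sub>R f x) \<le>
        norm (A * indicator K x + L * (\<Sum>c\<in>Basis. \<bar>indicator K x *\<^sub>R (u x \<bullet> c)\<bar>))"
    proof (intro AE_I2)
      fix x
      have "\<bar>f x\<bar> \<le> A + L * (\<Sum>c\<in>Basis. \<bar>u x \<bullet> c\<bar>)"
        using le[of x] mult_left_mono[OF norm_le_l1[of "u x"] \<open>0 \<le> L\<close>] by linarith
      moreover have "0 \<le> A + L * (\<Sum>c\<in>Basis. \<bar>u x \<bullet> c\<bar>)"
        using assms(4,5) by (intro add_nonneg_nonneg mult_nonneg_nonneg sum_nonneg) auto
      ultimately show "norm (indicator K x *\<^sub>R f x) \<le>
        norm (A * indicator K x + L * (\<Sum>c\<in>Basis. \<bar>indicator K x *\<^sub>R (u x \<bullet> c)\<bar>))"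
        by (auto simp: indicator_def)
    qed
  qed
qed

text \<open>The chain rule for a differentiable function with bounded derivative.  Difference
  quotients of \<open>\<Phi> \<circ> u\<close> are compared with \<open>(\<Phi>(u + h w) - \<Phi>(u)) / h\<close>; the error is
  controlled in the mean by the Lipschitz bound, and the latter converge pointwise.\<close>

lemma weak_chain_rule:
  fixes u w :: "'a::euclidean_space \<Rightarrow> 'e::euclidean_space" and \<Phi> :: "'e \<Rightarrow> real"
  assumes b: "b \<in> Basis"
    and wd: "\<And>c. c \<in> Basis \<Longrightarrow> has_weak_deriv UNIV [b] (\<lambda>x. u x \<bullet> c) (\<lambda>x. w x \<bullet> c)"
    and [measurable]: "u \<in> borel_measurable borel" "w \<in> borel_measurable borel"
    and der: "\<And>p. (\<Phi> has_derivative \<Phi>' p) (at p)"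
    and bd: "\<And>p v. \<bar>\<Phi>' p v\<bar> \<le> L * norm v"
  shows "has_weak_deriv UNIV [b] (\<lambda>x. \<Phi> (u x)) (\<lambda>x. \<Phi>' (u x) (w x))"
    and "(\<lambda>x. \<Phi>' (u x) (w x)) \<in> borel_measurable borel"
proof -
  obtain e :: 'e where "e \<in> Basis" using nonempty_Basis by blast
  then have L: "0 \<le> L" using order_trans[OF abs_ge_zero bd[of 0 e]] by simp
  have lip: "\<bar>\<Phi> p - \<Phi> p'\<bar> \<le> L * norm (p - p')" for p p'
  proof -
    have "norm (\<Phi> p - \<Phi> p') \<le> L * norm (p - p')"
      by (rule differentiable_bound[of UNIV _ \<Phi>'])
        (use der bd L in \<open>auto intro: has_derivative_at_withinI onorm_bound\<close>)
    then show ?thesis by simp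
  qed
  have "continuous_on UNIV \<Phi>"
    by (intro continuous_at_imp_continuous_on ballI has_derivative_continuous[OF der])
  then have [measurable]: "\<Phi> \<in> borel_measurable borel" by (rule borel_measurable_continuous_onI)
  have uc: "locally_integrable UNIV (\<lambda>x. u x \<bullet> c)" and wc: "locally_integrable UNIV (\<lambda>x. w x \<bullet> c)"
    if "c \<in> Basis" for c using wd[OF that] by (auto simp: has_weak_deriv_iff)
  define h where "h n = inverse (real (Suc n))" for n
  have h: "0 < h n" "h n \<le> 1" "h n \<noteq> 0" for n by (auto simp: h_def field_simps)
  have h0: "h \<longlonglongrightarrow> 0" unfolding h_def by (rule LIMSEQ_inverse_real_of_nat)
  have dq: "(\<lambda>n. (\<Phi> (u x + h n *\<^sub>R w x) - \<Phi> (u x)) / h n) \<longlonglongrightarrow> \<Phi>' (u x) (w x)" for x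
  proof -
    have "\<Phi> differentiable (at (u x))" using der by (auto simp: differentiable_def)
    from difference_quotient_tendsto[OF this h0 h(3), of "w x"] show ?thesis
      by (simp add: pd_eqI[OF der])
  qed
  show r_meas[measurable]: "(\<lambda>x. \<Phi>' (u x) (w x)) \<in> borel_measurable borel"
    by (rule borel_measurable_LIMSEQ_real[OF dq]) measurable
  have loc\<Phi>: "locally_integrable UNIV (\<lambda>x. \<Phi> (u x))"
  proof (rule locally_integrable_of_components[OF _ uc _ L])
    show "\<bar>\<Phi> (u x)\<bar> \<le> \<bar>\<Phi> 0\<bar> + L * norm (u x)" for x using lip[of "u x" 0] by simp
  qed auto
  have locr: "locally_integrable UNIV (\<lambda>x. \<Phi>' (u x) (w x))"
    by (rule locally_integrable_of_components[OF _ wc _ L, where A=0]) (use bd in auto)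
  have locw: "locally_integrable UNIV (\<lambda>x. norm (w x))"
    by (rule locally_integrable_of_components[OF _ wc _ zero_le_one, where A=0]) auto
  define \<delta> where "\<delta> n x = (1 / h n) *\<^sub>R (u (x + h n *\<^sub>R b) - u x) - w x" for n x
  have \<delta>_meas[measurable]: "\<delta> n \<in> borel_measurable borel" for n
    unfolding \<delta>_def[abs_def] by measurable
  have mean: "(\<lambda>n. \<integral>\<^sup>+x. indicator K x * ennreal (norm (\<delta> n x)) \<partial>lborel) \<longlonglongrightarrow> 0"
    if K: "compact K" for K
  proof (rule tendsto_sandwich[OF _ _ tendsto_const])
    have [measurable]: "K \<in> sets borel" using K by (simp add: compact_imp_closed)
    let ?q = "\<lambda>n c x. indicator K x * ennreal \<bar>(u (x + h n *\<^sub>R b) \<bullet> c - u x \<bullet> c) / h n - w x \<bullet> c\<bar>"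
    have "(\<lambda>n. \<Sum>c\<in>Basis. \<integral>\<^sup>+x. ?q n c x \<partial>lborel) \<longlonglongrightarrow> (\<Sum>c\<in>(Basis::'e set). 0)"
      by (intro tendsto_sum difference_quotient_mean[OF wd b _ _ h(1) h0 K]) auto
    then show "(\<lambda>n. \<Sum>c\<in>Basis. \<integral>\<^sup>+x. ?q n c x \<partial>lborel) \<longlonglongrightarrow> 0" by simp
    have "(\<integral>\<^sup>+x. indicator K x * ennreal (norm (\<delta> n x)) \<partial>lborel) \<le>
        (\<integral>\<^sup>+x. (\<Sum>c\<in>Basis. ?q n c x) \<partial>lborel)" for n
    proof (rule nn_integral_mono)
      fix x
      have "norm (\<delta> n x) \<le> (\<Sum>c\<in>Basis. \<bar>\<delta> n x \<bullet> c\<bar>)" by (rule norm_le_l1)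
      also have "\<dots> = (\<Sum>c\<in>Basis. \<bar>(u (x + h n *\<^sub>R b) \<bullet> c - u x \<bullet> c) / h n - w x \<bullet> c\<bar>)"
        by (simp add: \<delta>_def inner_diff_left)
      finally have "indicator K x * ennreal (norm (\<delta> n x)) \<le>
        indicator K x * ennreal (\<Sum>c\<in>Basis. \<bar>(u (x + h n *\<^sub>R b) \<bullet> c - u x \<bullet> c) / h n - w x \<bullet> c\<bar>)"
        by (intro mult_left_mono ennreal_leI) auto
      also have "\<dots> = (\<Sum>c\<in>Basis. ?q n c x)"
        unfolding sum_distrib_left[symmetric] by (subst sum_ennreal) simp_all
      finally show "indicator K x * ennreal (norm (\<delta> n x)) \<le> (\<Sum>c\<in>Basis. ?q n c x)" .
    qed
    also have "(\<integral>\<^sup>+x. (\<Sum>c\<in>Basis. ?q n c x) \<partial>lborel) = (\<Sum>c\<in>Basis. \<integral>\<^sup>+x. ?q n c x \<partial>lborel)" for n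
      by (rule nn_integral_sum) auto
    finally show "\<forall>\<^sub>F n in sequentially.
      (\<integral>\<^sup>+x. indicator K x * ennreal (norm (\<delta> n x)) \<partial>lborel) \<le>
      (\<Sum>c\<in>Basis. \<integral>\<^sup>+x. ?q n c x \<partial>lborel)" by simp
  qed simp
  have "(LINT x|lebesgue. \<Phi> (u x) * pd b \<psi> x) = - (LINT x|lebesgue. \<Phi>' (u x) (w x) * \<psi> x)"
    if \<psi>: "\<psi> \<in> test_functions UNIV" for \<psi>
  proof -
    note [measurable] = test_function_measurable[OF \<psi>] test_function_measurable[OF pd_test_function[OF \<psi> b]]
    obtain K C where K: "compact K" "\<And>x. x \<notin> K \<Longrightarrow> \<psi> x = 0" "\<And>x. \<bar>\<psi> x\<bar> \<le> C" "C \<ge> 0"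
      using test_function_support[OF \<psi>] by metis
    obtain C1 where C1: "\<And>x. \<bar>pd b \<psi> x\<bar> \<le> C1" "C1 \<ge> 0"
      using test_function_support[OF pd_test_function[OF \<psi> b]] by metis
    have sm: "\<psi> differentiable (at x)" for x using \<psi> by (auto simp: test_functions_def smooth_differentiable)
    have pdm: "pd (- b) \<psi> x = - pd b \<psi> x" for x using pd_scaleR[OF sm, of "-1" b] by simp
    \<comment> \<open>\<open>A n\<close> tends to minus the left-hand side, by moving the difference quotient to \<open>\<psi>\<close>; \<open>B n\<close> tends
      to minus the right-hand side, by the pointwise chain rule; and \<open>A n - B n\<close> tends to 0\<close>
    define A where "A n = (LINT x|lborel. (\<Phi> (u (x + h n *\<^sub>R b)) - \<Phi> (u x)) / h n * \<psi> x)" for n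
    define B where "B n = (LINT x|lborel. (\<Phi> (u x + h n *\<^sub>R w x) - \<Phi> (u x)) / h n * \<psi> x)" for n
    define K' where "K' = (\<lambda>(s, x). x + s *\<^sub>R b) ` ({0..1} \<times> K)"
    have K': "compact K'" unfolding K'_def by (rule compact_sweep[OF K(1)])
    have supp: "\<psi> (x - s *\<^sub>R b) = 0" if "x \<notin> K'" "0 \<le> s" "s \<le> 1" for x s
      using sweep_mem[of s 1 "x - s *\<^sub>R b" K b] that K(2)[of "x - s *\<^sub>R b"] by (auto simp: K'_def)
    have supp0: "\<psi> x = 0" if "x \<notin> K'" for x using supp[OF that, of 0] by simp
    have i1: "integrable lborel (\<lambda>x. \<Phi> (u x) * \<psi> (x - h n *\<^sub>R b))" for n
      by (rule integrable_mult_compact_support[OF loc\<Phi> _ _ K']) (use supp h K in \<open>auto simp: less_imp_le\<close>)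
    have i2: "integrable lborel (\<lambda>x. \<Phi> (u x) * \<psi> x)"
      by (rule integrable_mult_compact_support[OF loc\<Phi> _ _ K(1)]) (use K in auto)
    have i3: "integrable lborel (\<lambda>x. \<Phi> (u (x + h n *\<^sub>R b)) * \<psi> x)" for n
      using integrable_translate[OF i1[of n], of "h n *\<^sub>R b"] by simp
    have iA: "integrable lborel (\<lambda>x. (\<Phi> (u (x + h n *\<^sub>R b)) - \<Phi> (u x)) / h n * \<psi> x)" for n
      using Bochner_Integration.integrable_diff[OF i3[of n] i2, THEN integrable_mult_right, of "1 / h n"]
      by (simp add: algebra_simps diff_divide_distrib)
    have iw: "integrable lborel (\<lambda>x. norm (w x) * (L * \<bar>\<psi> x\<bar>))"
      by (rule integrable_mult_compact_support[OF locw _ _ K(1), where C="L * C"])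
        (use K L in \<open>auto simp: abs_mult intro: mult_left_mono\<close>)
    have qbound: "\<bar>(\<Phi> (u x + h n *\<^sub>R w x) - \<Phi> (u x)) / h n * \<psi> x\<bar> \<le> norm (w x) * (L * \<bar>\<psi> x\<bar>)" for n x
    proof -
      have "\<bar>\<Phi> (u x + h n *\<^sub>R w x) - \<Phi> (u x)\<bar> \<le> L * norm (w x) * h n"
        using lip[of "u x + h n *\<^sub>R w x" "u x"] h[of n] by (simp add: ac_simps)
      then have "\<bar>(\<Phi> (u x + h n *\<^sub>R w x) - \<Phi> (u x)) / h n\<bar> \<le> L * norm (w x)"
        using h[of n] by (simp add: abs_divide pos_divide_le_eq ac_simps)
      from mult_right_mono[OF this abs_ge_zero[of "\<psi> x"]] show ?thesis by (simp add: abs_mult ac_simps)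
    qed
    have iB: "integrable lborel (\<lambda>x. (\<Phi> (u x + h n *\<^sub>R w x) - \<Phi> (u x)) / h n * \<psi> x)" for n
      by (rule Bochner_Integration.integrable_bound[OF iw])
        (use qbound L in \<open>auto simp: abs_of_nonneg\<close>)
    have Alim: "A \<longlonglongrightarrow> (LINT x|lborel. \<Phi> (u x) * (- pd b \<psi> x))"
    proof -
      have Aeq: "A n = (LINT x|lborel. \<Phi> (u x) * ((\<psi> (x - h n *\<^sub>R b) - \<psi> x) / h n))" for n
      proof -
        have "A n = (1 / h n) * ((LINT x|lborel. \<Phi> (u (x + h n *\<^sub>R b)) * \<psi> x) - (LINT x|lborel. \<Phi> (u x) * \<psi> x))"
          unfolding A_def Bochner_Integration.integral_diff[OF i3 i2, symmetric] integral_mult_right_zero[symmetric]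
          by (rule Bochner_Integration.integral_cong) (auto simp: field_simps)
        also have "(LINT x|lborel. \<Phi> (u (x + h n *\<^sub>R b)) * \<psi> x) = (LINT x|lborel. \<Phi> (u x) * \<psi> (x - h n *\<^sub>R b))"
          using integral_translate[of "\<lambda>x. \<Phi> (u x) * \<psi> (x - h n *\<^sub>R b)" "h n *\<^sub>R b"] by simp
        also have "(1 / h n) * ((LINT x|lborel. \<Phi> (u x) * \<psi> (x - h n *\<^sub>R b)) - (LINT x|lborel. \<Phi> (u x) * \<psi> x)) =
          (LINT x|lborel. \<Phi> (u x) * ((\<psi> (x - h n *\<^sub>R b) - \<psi> x) / h n))"
          unfolding Bochner_Integration.integral_diff[OF i1 i2, symmetric] integral_mult_right_zero[symmetric]
          by (rule Bochner_Integration.integral_cong) (auto simp: field_simps)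
        finally show ?thesis .
      qed
      show ?thesis
        unfolding Aeq
      proof (rule integral_dominated_convergence[where w="\<lambda>x. \<bar>C1 * (indicator K' x * \<Phi> (u x))\<bar>"])
        show "integrable lborel (\<lambda>x. \<bar>C1 * (indicator K' x * \<Phi> (u x))\<bar>)"
          by (intro integrable_abs integrable_mult_right locally_integrable_lborel[OF loc\<Phi> _ K']) measurable
        show "AE x in lborel. (\<lambda>n. \<Phi> (u x) * ((\<psi> (x - h n *\<^sub>R b) - \<psi> x) / h n)) \<longlonglongrightarrow> \<Phi> (u x) * (- pd b \<psi> x)"
        proof (intro AE_I2 tendsto_mult tendsto_const)
          fix x
          show "(\<lambda>n. (\<psi> (x - h n *\<^sub>R b) - \<psi> x) / h n) \<longlonglongrightarrow> - pd b \<psi> x"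
            using difference_quotient_tendsto[OF sm h0 h(3), of x "- b"] by (simp add: pdm)
        qed
        show "AE x in lborel. norm (\<Phi> (u x) * ((\<psi> (x - h n *\<^sub>R b) - \<psi> x) / h n)) \<le> \<bar>C1 * (indicator K' x * \<Phi> (u x))\<bar>" for n
        proof (intro AE_I2)
          fix x
          show "norm (\<Phi> (u x) * ((\<psi> (x - h n *\<^sub>R b) - \<psi> x) / h n)) \<le> \<bar>C1 * (indicator K' x * \<Phi> (u x))\<bar>"
          proof (cases "x \<in> K'")
            case True
            have "norm (\<psi> (x + h n *\<^sub>R (- b)) - \<psi> x) \<le> C1 * h n"
              by (rule increment_bound[OF sm]) (use h C1 in \<open>auto simp: pdm less_imp_le\<close>)
            then have "\<bar>(\<psi> (x - h n *\<^sub>R b) - \<psi> x) / h n\<bar> \<le> C1"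
              using h[of n] by (simp add: abs_divide pos_divide_le_eq)
            from mult_left_mono[OF this abs_ge_zero[of "\<Phi> (u x)"]] show ?thesis
              using True C1(2) by (simp only: real_norm_def abs_mult) (simp add: mult.commute)
          next
            case False
            then show ?thesis using supp[OF False, of "h n"] supp0[OF False] h[of n] by simp
          qed
        qed
      qed measurable
    qed
    have Blim: "B \<longlonglongrightarrow> (LINT x|lborel. \<Phi>' (u x) (w x) * \<psi> x)"
      unfolding B_def
    proof (rule integral_dominated_convergence[OF _ _ iw])
      show "AE x in lborel. (\<lambda>n. (\<Phi> (u x + h n *\<^sub>R w x) - \<Phi> (u x)) / h n * \<psi> x) \<longlonglongrightarrow> \<Phi>' (u x) (w x) * \<psi> x"
        by (intro AE_I2 tendsto_mult tendsto_const dq)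
      show "AE x in lborel. norm ((\<Phi> (u x + h n *\<^sub>R w x) - \<Phi> (u x)) / h n * \<psi> x) \<le> norm (w x) * (L * \<bar>\<psi> x\<bar>)" for n
        unfolding real_norm_def by (intro AE_I2 qbound)
    qed measurable
    have "(\<lambda>n. \<bar>A n - B n\<bar>) \<longlonglongrightarrow> 0"
    proof -
      have le: "ennreal \<bar>A n - B n\<bar> \<le> ennreal (L * C) *
          (\<integral>\<^sup>+x. indicator K x * ennreal (norm (\<delta> n x)) \<partial>lborel)" for n
      proof -
        have [measurable]: "K \<in> sets borel" using K(1) by (simp add: compact_imp_closed)
        have "A n - B n = (LINT x|lborel. (\<Phi> (u (x + h n *\<^sub>R b)) - \<Phi> (u x)) / h n * \<psi> x -
            (\<Phi> (u x + h n *\<^sub>R w x) - \<Phi> (u x)) / h n * \<psi> x)"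
          unfolding A_def B_def by (rule Bochner_Integration.integral_diff[OF iA iB, symmetric])
        also have "\<dots> = (LINT x|lborel. (\<Phi> (u (x + h n *\<^sub>R b)) - \<Phi> (u x + h n *\<^sub>R w x)) / h n * \<psi> x)"
          by (rule Bochner_Integration.integral_cong) (auto simp: diff_divide_distrib algebra_simps)
        finally have AB: "A n - B n = (LINT x|lborel. (\<Phi> (u (x + h n *\<^sub>R b)) - \<Phi> (u x + h n *\<^sub>R w x)) / h n * \<psi> x)" .
        have "ennreal \<bar>A n - B n\<bar> \<le> (\<integral>\<^sup>+x. ennreal (norm ((\<Phi> (u (x + h n *\<^sub>R b)) - \<Phi> (u x + h n *\<^sub>R w x)) / h n * \<psi> x)) \<partial>lborel)"
        proof -
          have "integrable lborel (\<lambda>x. (\<Phi> (u (x + h n *\<^sub>R b)) - \<Phi> (u x + h n *\<^sub>R w x)) / h n * \<psi> x)"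
            using Bochner_Integration.integrable_diff[OF iA[of n] iB[of n]]
            by (rule back_subst[where P="integrable lborel"]) (auto simp: fun_eq_iff diff_divide_distrib algebra_simps)
          from integral_norm_bound_ennreal[OF this] show ?thesis unfolding AB by simp
        qed
        also have "\<dots> \<le> (\<integral>\<^sup>+x. ennreal (L * C) * (indicator K x * ennreal (norm (\<delta> n x))) \<partial>lborel)"
        proof (rule nn_integral_mono)
          fix x
          show "ennreal (norm ((\<Phi> (u (x + h n *\<^sub>R b)) - \<Phi> (u x + h n *\<^sub>R w x)) / h n * \<psi> x)) \<le>
            ennreal (L * C) * (indicator K x * ennreal (norm (\<delta> n x)))"
          proof (cases "x \<in> K")
            case True
            have "norm (u (x + h n *\<^sub>R b) - (u x + h n *\<^sub>R w x)) =
                h n * norm (\<delta> n x)"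
            proof -
              have "u (x + h n *\<^sub>R b) - (u x + h n *\<^sub>R w x) =
                h n *\<^sub>R \<delta> n x"
                using h[of n] by (simp add: \<delta>_def scaleR_right_diff_distrib)
              then show ?thesis using h[of n] by simp
            qed
            then have "\<bar>\<Phi> (u (x + h n *\<^sub>R b)) - \<Phi> (u x + h n *\<^sub>R w x)\<bar> \<le>
                L * norm (\<delta> n x) * h n"
              using lip[of "u (x + h n *\<^sub>R b)" "u x + h n *\<^sub>R w x"] by (simp add: ac_simps)
            then have "\<bar>(\<Phi> (u (x + h n *\<^sub>R b)) - \<Phi> (u x + h n *\<^sub>R w x)) / h n\<bar> \<le>
                L * norm (\<delta> n x)"
              using h[of n] by (simp only: abs_divide abs_of_pos pos_divide_le_eq)
            then have "\<bar>(\<Phi> (u (x + h n *\<^sub>R b)) - \<Phi> (u x + h n *\<^sub>R w x)) / h n\<bar> * \<bar>\<psi> x\<bar> \<le>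
                (L * norm (\<delta> n x)) * C"
              using K(3)[of x] L by (intro mult_mono) auto
            then have "norm ((\<Phi> (u (x + h n *\<^sub>R b)) - \<Phi> (u x + h n *\<^sub>R w x)) / h n * \<psi> x) \<le>
                L * C * norm (\<delta> n x)"
              by (simp only: real_norm_def abs_mult mult.assoc mult.commute)
            then show ?thesis
              using True L K(4) by (simp only: indicator_simps mult_1 ennreal_mult'[symmetric] mult_nonneg_nonneg ennreal_leI)
          next
            case False
            then show ?thesis using K(2) by simp
          qed
        qed
        also have "\<dots> = ennreal (L * C) *
          (\<integral>\<^sup>+x. indicator K x * ennreal (norm (\<delta> n x)) \<partial>lborel)"
          by (rule nn_integral_cmult) measurable
        finally show ?thesis .
      qed
      have "(\<lambda>n. ennreal (L * C) *
          (\<integral>\<^sup>+x. indicator K x * ennreal (norm (\<delta> n x)) \<partial>lborel)) \<longlonglongrightarrow> ennreal (L * C) * 0"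
        by (intro ennreal_tendsto_cmult mean K(1)) simp
      then have up: "(\<lambda>n. ennreal (L * C) *
          (\<integral>\<^sup>+x. indicator K x * ennreal (norm (\<delta> n x)) \<partial>lborel)) \<longlonglongrightarrow> 0"
        by simp
      have "(\<lambda>n. ennreal \<bar>A n - B n\<bar>) \<longlonglongrightarrow> 0"
      proof (rule tendsto_sandwich[OF _ _ tendsto_const up])
        show "\<forall>\<^sub>F n in sequentially. ennreal \<bar>A n - B n\<bar> \<le> ennreal (L * C) *
          (\<integral>\<^sup>+x. indicator K x * ennreal (norm (\<delta> n x)) \<partial>lborel)"
          by (intro always_eventually allI le)
      qed simp
      then show ?thesis by (subst (asm) ennreal_tendsto_0_iff) auto
    qed
    then have "(\<lambda>n. A n - B n) \<longlonglongrightarrow> 0" by (rule tendsto_rabs_zero_cancel)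
    from tendsto_unique[OF _ tendsto_diff[OF Alim Blim] this]
    have "(LINT x|lborel. \<Phi> (u x) * (- pd b \<psi> x)) = (LINT x|lborel. \<Phi>' (u x) (w x) * \<psi> x)" by simp
    then show ?thesis by (simp add: integral_completion)
  qed
  then show "has_weak_deriv UNIV [b] (\<lambda>x. \<Phi> (u x)) (\<lambda>x. \<Phi>' (u x) (w x))"
    using loc\<Phi> locr by (simp add: has_weak_deriv_iff)
qed

section \<open>The curvature operator\<close>

text \<open>The curvature term of the Bernoulli condition is the divergence of this field, taken at the
  slope \<open>p = \<nabla>\<eta>\<close>.\<close>

definition unit_slope :: "'a::real_inner \<Rightarrow> 'a" where
  "unit_slope p = (1 / sqrt (1 + (norm p)\<^sup>2)) *\<^sub>R p"

definition unit_slope_deriv :: "'a::real_inner \<Rightarrow> 'a \<Rightarrow> 'a" where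
  "unit_slope_deriv p v =
     (1 / sqrt (1 + (norm p)\<^sup>2)) *\<^sub>R v - ((p \<bullet> v) / sqrt (1 + (norm p)\<^sup>2) ^ 3) *\<^sub>R p"

lemma unit_slope_has_derivative:
  fixes p :: "'a::real_inner"
  shows "(unit_slope has_derivative unit_slope_deriv p) (at p)"
proof -
  have pos: "0 < 1 + (norm q)\<^sup>2" for q :: 'a by (simp add: add_pos_nonneg)
  have d1: "((\<lambda>p::'a. 1 + (norm p)\<^sup>2) has_derivative (\<lambda>v. 2 * (p \<bullet> v))) (at p)"
    unfolding power2_norm_eq_inner
    by (auto intro!: derivative_eq_intros simp: inner_commute)
  have d2: "((\<lambda>r::real. 1 / sqrt r) has_real_derivative - (1 / (2 * sqrt r ^ 3))) (at r)" if "0 < r" for r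
    using that by (auto intro!: derivative_eq_intros simp: field_simps power3_eq_cube)
  have d3: "((\<lambda>p::'a. 1 / sqrt (1 + (norm p)\<^sup>2)) has_derivative
      (\<lambda>v. - (p \<bullet> v) / sqrt (1 + (norm p)\<^sup>2) ^ 3)) (at p)"
    using has_derivative_compose[OF d1 d2[OF pos, unfolded has_field_derivative_def]] by simp
  have "((\<lambda>p::'a. (1 / sqrt (1 + (norm p)\<^sup>2)) *\<^sub>R p) has_derivative
      (\<lambda>v. (1 / sqrt (1 + (norm p)\<^sup>2)) *\<^sub>R v + (- (p \<bullet> v) / sqrt (1 + (norm p)\<^sup>2) ^ 3) *\<^sub>R p)) (at p)"
    by (rule has_derivative_scaleR[OF d3 has_derivative_ident])
  then show ?thesis by (simp add: unit_slope_def[abs_def] unit_slope_deriv_def[abs_def])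
qed

lemma unit_slope_sqrt_bounds:
  fixes p :: "'a::real_inner"
  defines "S \<equiv> sqrt (1 + (norm p)\<^sup>2)"
  shows "1 \<le> S" "norm p \<le> S" "S \<le> 1 + norm p"
proof -
  show "1 \<le> S" by (simp add: S_def)
  show "norm p \<le> S" unfolding S_def by (rule real_le_rsqrt) simp
  show "S \<le> 1 + norm p" unfolding S_def
    by (rule real_le_lsqrt) (auto simp: power2_sum)
qed

text \<open>The second bound makes the curvature minus the Laplacian quadratic in \<open>\<eta>\<close>.  The bound linear
  in \<open>p\<close>, weaker near 0 than the true order \<open>\<bar>p\<bar>\<^sup>2\<close>, is valid for all slopes and leads to the product
  of two square integrable functions.\<close>

lemma norm_unit_slope_deriv_le:
  fixes p v :: "'a::real_inner"
  shows "norm (unit_slope_deriv p v) \<le> 2 * norm v"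
    and "norm (unit_slope_deriv p v - v) \<le> 2 * norm p * norm v"
proof -
  define S where "S = sqrt (1 + (norm p)\<^sup>2)"
  have S: "1 \<le> S" "norm p \<le> S" "S \<le> 1 + norm p"
    using unit_slope_sqrt_bounds[of p] by (auto simp: S_def)
  have S0: "0 < S" using S by simp
  have pv: "\<bar>p \<bullet> v\<bar> \<le> norm p * norm v" by (rule Cauchy_Schwarz_ineq2)
  have rank1: "norm (((p \<bullet> v) / S ^ 3) *\<^sub>R p) \<le> (norm p)\<^sup>2 / S ^ 3 * norm v"
  proof -
    have "norm (((p \<bullet> v) / S ^ 3) *\<^sub>R p) = \<bar>p \<bullet> v\<bar> / S ^ 3 * norm p" using S0 by simp
    also have "\<dots> \<le> (norm p * norm v) / S ^ 3 * norm p"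
      using pv S0 by (intro mult_right_mono divide_right_mono) auto
    finally show ?thesis by (simp add: power2_eq_square ac_simps)
  qed
  have q: "(norm p)\<^sup>2 / S ^ 3 \<le> norm p / S" 
  proof -
    have "(norm p)\<^sup>2 / S ^ 3 = (norm p / S) * (norm p / (S * S))"
      using S0 by (simp add: power2_eq_square power3_eq_cube)
    also have "\<dots> \<le> (norm p / S) * 1"
    proof (rule mult_left_mono)
      have "norm p \<le> S * S" using S mult_mono[OF S(1) S(2)] S0 by simp
      then show "norm p / (S * S) \<le> 1" using S0 by (simp add: divide_le_eq)
    qed (use S0 in auto)
    finally show ?thesis by simp
  qed
  have q1: "norm p / S \<le> 1" using S S0 by (simp add: divide_le_eq)
  have q2: "norm p / S \<le> norm p" using S S0 by (simp add: divide_le_eq mult_left_le mult_le_cancel_left1)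
  have u: "unit_slope_deriv p v = (1 / S) *\<^sub>R v - ((p \<bullet> v) / S ^ 3) *\<^sub>R p"
    by (simp add: unit_slope_deriv_def S_def)
  have "norm (unit_slope_deriv p v) \<le> norm ((1 / S) *\<^sub>R v) + norm (((p \<bullet> v) / S ^ 3) *\<^sub>R p)"
    unfolding u by (rule norm_triangle_ineq4)
  also have "norm ((1 / S) *\<^sub>R v) \<le> norm v" using S S0 by (simp add: divide_le_eq mult_le_cancel_left1)
  also have "norm (((p \<bullet> v) / S ^ 3) *\<^sub>R p) \<le> norm v"
    using rank1 mult_right_mono[OF order_trans[OF q q1] norm_ge_zero[of v]] by simp
  finally show "norm (unit_slope_deriv p v) \<le> 2 * norm v" by simp
  have "unit_slope_deriv p v - v = (1 / S - 1) *\<^sub>R v - ((p \<bullet> v) / S ^ 3) *\<^sub>R p"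
    unfolding u by (simp add: scaleR_left_diff_distrib)
  then have "norm (unit_slope_deriv p v - v) \<le> norm ((1 / S - 1) *\<^sub>R v) + norm (((p \<bullet> v) / S ^ 3) *\<^sub>R p)"
    by (simp only: norm_triangle_ineq4)
  also have "norm ((1 / S - 1) *\<^sub>R v) \<le> norm p * norm v"
  proof -
    have "1 - 1 / S \<le> norm p"
    proof -
      have "S - 1 \<le> norm p * S" using S mult_left_mono[OF S(1) norm_ge_zero[of p]] by simp
      then show ?thesis using S0 by (simp add: field_simps)
    qed
    moreover have "1 / S \<le> 1" using S S0 by simp
    ultimately have "\<bar>1 / S - 1\<bar> \<le> norm p" by simp
    then show ?thesis by (simp add: mult_right_mono)
  qed
  also have "norm (((p \<bullet> v) / S ^ 3) *\<^sub>R p) \<le> norm p * norm v"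
    using rank1 mult_right_mono[OF order_trans[OF q q2] norm_ge_zero[of v]] by simp
  finally show "norm (unit_slope_deriv p v - v) \<le> 2 * norm p * norm v" by simp
qed

text \<open>The chain rule yields one weak divergence of the field, and by the du Bois-Reymond lemma every
  other one agrees with it almost everywhere.\<close>

lemma weak_div_unit_slope:
  fixes u :: "'a::euclidean_space \<Rightarrow> 'a" and w :: "'a \<Rightarrow> 'a \<Rightarrow> 'a"
  assumes wd: "\<And>b c. b \<in> Basis \<Longrightarrow> c \<in> Basis \<Longrightarrow> has_weak_deriv UNIV [b] (\<lambda>x. u x \<bullet> c) (\<lambda>x. w b x \<bullet> c)"
    and u: "u \<in> borel_measurable borel" and w: "\<And>b. b \<in> Basis \<Longrightarrow> w b \<in> borel_measurable borel"
    and V: "AE x in lebesgue. V x = unit_slope (u x)"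
    and div: "has_weak_div V r"
  shows "AE x in lebesgue. r x = (\<Sum>b\<in>Basis. unit_slope_deriv (u x) (w b x) \<bullet> b)"
proof (rule du_Bois_Reymond_eq)
  show r: "locally_integrable UNIV r" using div by (simp add: has_weak_div_def)
  have chain: "has_weak_deriv UNIV [b] (\<lambda>x. unit_slope (u x) \<bullet> b) (\<lambda>x. unit_slope_deriv (u x) (w b x) \<bullet> b)"
    if b: "b \<in> Basis" for b
  proof (rule weak_chain_rule(1)[where \<Phi>="\<lambda>p. unit_slope p \<bullet> b" and \<Phi>'="\<lambda>p v. unit_slope_deriv p v \<bullet> b" and L=2])
    show "((\<lambda>p. unit_slope p \<bullet> b) has_derivative (\<lambda>v. unit_slope_deriv p v \<bullet> b)) (at p)" for p
      by (rule has_derivative_inner_left[OF unit_slope_has_derivative])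
    show "\<bar>unit_slope_deriv p v \<bullet> b\<bar> \<le> 2 * norm v" for p v
      using Cauchy_Schwarz_ineq2[of "unit_slope_deriv p v" b] norm_unit_slope_deriv_le(1)[of p v] b by simp
  qed (use b wd u w in auto)
  let ?R = "\<lambda>x. \<Sum>b\<in>Basis. unit_slope_deriv (u x) (w b x) \<bullet> b"
  show "locally_integrable UNIV ?R"
    unfolding locally_integrable_def set_integrable_def
  proof (intro allI impI, elim conjE)
    fix K :: "'a set" assume "compact K"
    then have "integrable lebesgue (\<lambda>x. indicator K x *\<^sub>R (unit_slope_deriv (u x) (w b x) \<bullet> b))" if "b \<in> Basis" for b
      using chain[OF that] by (auto simp: has_weak_deriv_iff locally_integrable_def set_integrable_def)
    then show "integrable lebesgue (\<lambda>x. indicator K x *\<^sub>R ?R x)"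
      unfolding scaleR_right.sum by (intro Bochner_Integration.integrable_sum)
  qed
  fix \<psi> :: "'a \<Rightarrow> real" assume \<psi>: "\<psi> \<in> test_functions UNIV"
  have "(LINT x|lebesgue. ?R x * \<psi> x) = (\<Sum>b\<in>Basis. LINT x|lebesgue. (unit_slope_deriv (u x) (w b x) \<bullet> b) * \<psi> x)"
    unfolding sum_distrib_right
    by (rule Bochner_Integration.integral_sum)
      (use chain \<psi> in \<open>auto simp: has_weak_deriv_iff intro!: integrable_mult_test_function\<close>)
  also have "\<dots> = (\<Sum>b\<in>Basis. - (LINT x|lebesgue. (unit_slope (u x) \<bullet> b) * pd b \<psi> x))"
    by (rule sum.cong) (use chain \<psi> in \<open>auto simp: has_weak_deriv_iff\<close>)
  also have "\<dots> = - (LINT x|lebesgue. (\<Sum>b\<in>Basis. (unit_slope (u x) \<bullet> b) * pd b \<psi> x))"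
    unfolding sum_negf
    by (subst Bochner_Integration.integral_sum)
      (use chain \<psi> in \<open>auto simp: has_weak_deriv_iff intro!: integrable_mult_test_function pd_test_function\<close>)
  also have "(LINT x|lebesgue. (\<Sum>b\<in>Basis. (unit_slope (u x) \<bullet> b) * pd b \<psi> x)) =
      (LINT x|lebesgue. (\<Sum>b\<in>Basis. (V x \<bullet> b) * pd b \<psi> x))"
  proof (rule integral_cong_AE)
    show "(\<lambda>x. \<Sum>b\<in>Basis. (unit_slope (u x) \<bullet> b) * pd b \<psi> x) \<in> borel_measurable lebesgue"
      using chain \<psi>
      by (intro borel_measurable_sum borel_measurable_times locally_integrable_measurable
          test_function_measurable_lebesgue[OF pd_test_function]) (auto simp: has_weak_deriv_iff)
    show "(\<lambda>x. \<Sum>b\<in>Basis. (V x \<bullet> b) * pd b \<psi> x) \<in> borel_measurable lebesgue"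
      using div \<psi>
      by (intro borel_measurable_sum borel_measurable_times locally_integrable_measurable
          test_function_measurable_lebesgue[OF pd_test_function]) (auto simp: has_weak_div_def)
    show "AE x in lebesgue. (\<Sum>b\<in>Basis. (unit_slope (u x) \<bullet> b) * pd b \<psi> x) = (\<Sum>b\<in>Basis. (V x \<bullet> b) * pd b \<psi> x)"
      using V by eventually_elim simp
  qed
  also have "- \<dots> = (LINT x|lebesgue. r x * \<psi> x)"
    using div \<psi> by (simp add: has_weak_div_def)
  finally show "(LINT x|lebesgue. r x * \<psi> x) = (LINT x|lebesgue. ?R x * \<psi> x)" by simp
qed

section \<open>Functions of polynomial growth in the mean\<close>

text \<open>The exponent makes the weight itself integrable, so that this class contains both the
  integrable and the square integrable functions; its members pair with Schwartz functions.\<close>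

definition weighted_integrable :: "('a::euclidean_space \<Rightarrow> real) \<Rightarrow> bool" where
  "weighted_integrable f \<longleftrightarrow> integrable lebesgue (\<lambda>x. f x / (1 + norm x) ^ (DIM('a) + 2))"

lemma weighted_integrable_measurable:
  fixes f :: "'a::euclidean_space \<Rightarrow> real"
  assumes "weighted_integrable f" shows "f \<in> borel_measurable lebesgue"
proof -
  let ?N = "DIM('a) + 2"
  have 1: "(\<lambda>x. f x / (1 + norm x) ^ ?N) \<in> borel_measurable lebesgue"
    using assms unfolding weighted_integrable_def by (rule borel_measurable_integrable)
  have 2: "(\<lambda>x::'a. (1 + norm x) ^ ?N) \<in> borel_measurable lebesgue"
    by (rule measurable_completion) measurable
  have "(\<lambda>x. f x / (1 + norm x) ^ ?N * (1 + norm x) ^ ?N) = f"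
  proof (rule ext)
    fix x
    have "f x / W * W = f x" if "0 < W" for W :: real using that by simp
    then show "f x / (1 + norm x) ^ ?N * (1 + norm x) ^ ?N = f x" using weight_pos by blast
  qed
  with borel_measurable_times[OF 1 2] show ?thesis by simp
qed

lemma weighted_integrable_mult:
  fixes f :: "'a::euclidean_space \<Rightarrow> real" and g :: "'a \<Rightarrow> 'b::{banach, second_countable_topology}"
  assumes f: "weighted_integrable f" and g: "g \<in> borel_measurable borel"
    and le: "\<And>x. norm (g x) \<le> C / (1 + norm x) ^ (DIM('a) + 2)"
  shows "integrable lebesgue (\<lambda>x. f x *\<^sub>R g x)"
proof (rule Bochner_Integration.integrable_bound)
  show "integrable lebesgue (\<lambda>x. C * (f x / (1 + norm x) ^ (DIM('a) + 2)))"
    using f unfolding weighted_integrable_def by (rule integrable_mult_right)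
  show "(\<lambda>x. f x *\<^sub>R g x) \<in> borel_measurable lebesgue"
    by (intro borel_measurable_scaleR weighted_integrable_measurable f) (use g in \<open>auto intro: measurable_completion\<close>)
  show "AE x in lebesgue. norm (f x *\<^sub>R g x) \<le> norm (C * (f x / (1 + norm x) ^ (DIM('a) + 2)))"
  proof (intro AE_I2)
    fix x
    have "norm (f x *\<^sub>R g x) \<le> \<bar>f x\<bar> * (C / (1 + norm x) ^ (DIM('a) + 2))"
      unfolding norm_scaleR by (intro mult_left_mono le) simp
    also have "\<dots> \<le> \<bar>f x\<bar> * \<bar>C / (1 + norm x) ^ (DIM('a) + 2)\<bar>"
      by (intro mult_left_mono abs_ge_self abs_ge_zero)
    finally show "norm (f x *\<^sub>R g x) \<le> norm (C * (f x / (1 + norm x) ^ (DIM('a) + 2)))"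
      by (simp add: abs_mult mult.commute)
  qed
qed

lemma weighted_integrable_mult_schwartz:
  fixes f :: "'a::euclidean_space \<Rightarrow> real"
  assumes "weighted_integrable f" "\<omega> \<in> schwartz"
  shows "integrable lebesgue (\<lambda>x. complex_of_real (f x) * \<omega> x)"
proof -
  obtain C where "\<And>x. norm (\<omega> x) \<le> C / (1 + norm x) ^ (DIM('a) + 2)"
    using rapidD[OF schwartz_rapid[OF assms(2)]] by metis
  from weighted_integrable_mult[OF assms(1) schwartz_measurable[OF assms(2)] this]
  show ?thesis by (simp add: scaleR_conv_of_real)
qed

lemma integrable_decay_lebesgue:
  "integrable lebesgue (\<lambda>x::'a::euclidean_space. 1 / (1 + norm x) ^ (DIM('a) + 2))"
  using integrable_polynomial_decay by (subst integrable_completion) measurable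

lemma decay_le_1: "1 / (1 + norm x) ^ N \<le> 1"
  using weight_pos[of x N] by (simp add: divide_le_eq one_le_power)

lemma weighted_integrable_of_square:
  fixes f :: "'a::euclidean_space \<Rightarrow> real"
  assumes f: "f \<in> borel_measurable lebesgue" and sq: "integrable lebesgue (\<lambda>x. (f x)\<^sup>2)"
  shows "weighted_integrable f"
  unfolding weighted_integrable_def
proof (rule Bochner_Integration.integrable_bound)
  let ?N = "DIM('a) + 2"
  show "integrable lebesgue (\<lambda>x. (f x)\<^sup>2 + 1 / (1 + norm x) ^ ?N)"
    by (intro Bochner_Integration.integrable_add sq integrable_decay_lebesgue)
  have "(\<lambda>x::'a. (1 + norm x) ^ ?N) \<in> borel_measurable lebesgue"
    by (rule measurable_completion) measurable
  then show "(\<lambda>x. f x / (1 + norm x) ^ ?N) \<in> borel_measurable lebesgue"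
    using f by (rule borel_measurable_divide[rotated])
  show "AE x in lebesgue. norm (f x / (1 + norm x) ^ ?N) \<le> norm ((f x)\<^sup>2 + 1 / (1 + norm x) ^ ?N)"
  proof (intro AE_I2)
    fix x :: 'a
    define d where "d = 1 / (1 + norm x) ^ ?N"
    have d: "0 \<le> d" "d \<le> 1" unfolding d_def using weight_pos[of x ?N] decay_le_1[of x ?N] by auto
    have "\<bar>f x\<bar> * d \<le> (f x)\<^sup>2 + d"
    proof (cases "\<bar>f x\<bar> \<le> 1")
      case True
      then have "\<bar>f x\<bar> * d \<le> 1 * d" using d by (intro mult_right_mono)
      then show ?thesis by (simp add: add_increasing)
    next
      case False
      then have "\<bar>f x\<bar> * d \<le> \<bar>f x\<bar> * \<bar>f x\<bar>" using d by (intro mult_left_mono) auto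
      then show ?thesis using d by (simp add: power2_eq_square)
    qed
    moreover have "norm (f x / (1 + norm x) ^ ?N) = \<bar>f x\<bar> * d"
      unfolding d_def using weight_pos[of x ?N] by (simp add: abs_divide)
    moreover have "norm ((f x)\<^sup>2 + 1 / (1 + norm x) ^ ?N) = (f x)\<^sup>2 + d"
      unfolding d_def[symmetric] using d by simp
    ultimately show "norm (f x / (1 + norm x) ^ ?N) \<le> norm ((f x)\<^sup>2 + 1 / (1 + norm x) ^ ?N)" by simp
  qed
qed

lemma weighted_integrable_of_integrable:
  fixes f :: "'a::euclidean_space \<Rightarrow> real"
  assumes f: "integrable lebesgue f"
  shows "weighted_integrable f"
  unfolding weighted_integrable_def
proof (rule Bochner_Integration.integrable_bound[OF f])
  let ?N = "DIM('a) + 2"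
  have "(\<lambda>x::'a. (1 + norm x) ^ ?N) \<in> borel_measurable lebesgue"
    by (rule measurable_completion) measurable
  then show "(\<lambda>x. f x / (1 + norm x) ^ ?N) \<in> borel_measurable lebesgue"
    using f by (intro borel_measurable_divide) auto
  show "AE x in lebesgue. norm (f x / (1 + norm x) ^ ?N) \<le> norm (f x)"
  proof (intro AE_I2)
    fix x :: 'a
    have "\<bar>f x\<bar> * (1 / (1 + norm x) ^ ?N) \<le> \<bar>f x\<bar> * 1" by (intro mult_left_mono decay_le_1) simp
    then show "norm (f x / (1 + norm x) ^ ?N) \<le> norm (f x)"
      using weight_pos[of x ?N] by (simp add: abs_divide)
  qed
qed

lemma weighted_integrable_add:
  "weighted_integrable f \<Longrightarrow> weighted_integrable g \<Longrightarrow> weighted_integrable (\<lambda>x. f x + g x)"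
  unfolding weighted_integrable_def add_divide_distrib by (rule Bochner_Integration.integrable_add)

lemma weighted_integrable_scale:
  "weighted_integrable f \<Longrightarrow> weighted_integrable (\<lambda>x. c * f x)"
  unfolding weighted_integrable_def times_divide_eq_right[symmetric] by (rule integrable_mult_right)

lemma weighted_integrable_sum:
  "(\<And>i. i \<in> I \<Longrightarrow> weighted_integrable (f i)) \<Longrightarrow> weighted_integrable (\<lambda>x. \<Sum>i\<in>I. f i x)"
  unfolding weighted_integrable_def sum_divide_distrib by (rule Bochner_Integration.integrable_sum)

lemma weighted_integrable_cong_AE:
  fixes f g :: "'a::euclidean_space \<Rightarrow> real"
  assumes f: "weighted_integrable f" and eq: "AE x in lebesgue. f x = g x"
  shows "weighted_integrable g"
  unfolding weighted_integrable_def
proof (rule integrable_cong_AE_imp)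
  show "integrable lebesgue (\<lambda>x. f x / (1 + norm x) ^ (DIM('a) + 2))"
    using f by (simp add: weighted_integrable_def)
  show "AE x in lebesgue. f x / (1 + norm x) ^ (DIM('a) + 2) = g x / (1 + norm x) ^ (DIM('a) + 2)"
    using eq by eventually_elim simp
  have "g \<in> borel_measurable lebesgue"
    by (rule borel_measurable_AE[OF weighted_integrable_measurable[OF f] eq])
  moreover have "(\<lambda>x::'a. (1 + norm x) ^ (DIM('a) + 2)) \<in> borel_measurable lebesgue"
    by (rule measurable_completion) measurable
  ultimately show "(\<lambda>x. g x / (1 + norm x) ^ (DIM('a) + 2)) \<in> borel_measurable lebesgue"
    by (rule borel_measurable_divide)
qed

lemma finite_indices [simp]: "finite (indices j :: 'a::euclidean_space list set)"
  unfolding indices_def by (rule finite_lists_length_eq) simp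

lemma weighted_integrable_tempered:
  fixes f :: "'a::euclidean_space \<Rightarrow> real"
  assumes f: "weighted_integrable f"
  shows "is_tempered_function (\<lambda>x. complex_of_real (f x))"
  unfolding is_tempered_function_def tempered_distribution_def
proof (intro conjI ballI allI)
  note int = weighted_integrable_mult_schwartz[OF f]
  show "integrable lebesgue (\<lambda>x. complex_of_real (f x) * \<psi> x)" if "\<psi> \<in> schwartz" for \<psi>
    by (rule int[OF that])
  show "dist_of (\<lambda>x. complex_of_real (f x)) (\<lambda>x. c * \<psi> x + \<omega> x) =
      c * dist_of (\<lambda>x. complex_of_real (f x)) \<psi> + dist_of (\<lambda>x. complex_of_real (f x)) \<omega>"
    if "\<psi> \<in> schwartz" "\<omega> \<in> schwartz" for \<psi> \<omega> :: "'a \<Rightarrow> complex" and c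
  proof -
    have "(LINT x|lebesgue. complex_of_real (f x) * (c * \<psi> x + \<omega> x)) =
        (LINT x|lebesgue. c * (complex_of_real (f x) * \<psi> x) + complex_of_real (f x) * \<omega> x)"
      by (rule Bochner_Integration.integral_cong) (auto simp: algebra_simps)
    then show ?thesis using int that by (simp add: dist_of_def)
  qed
  let ?N = "DIM('a) + 2"
  define W where "W = (LINT x|lebesgue. \<bar>f x / (1 + norm x) ^ ?N\<bar>)"
  have W: "0 \<le> W" unfolding W_def by (rule Bochner_Integration.integral_nonneg) simp
  have "cmod (dist_of (\<lambda>x. complex_of_real (f x)) \<psi>) \<le> W * (\<Sum>j\<le>?N. \<Sum>bs\<in>indices j. schwartz_seminorm ?N bs \<psi>)"
    if \<psi>: "\<psi> \<in> schwartz" for \<psi>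
  proof -
    have bdd: "bdd_above (range (\<lambda>x. (1 + norm x) ^ ?N * cmod (pds bs \<psi> x)))" if bs: "set bs \<subseteq> Basis" for bs
    proof -
      obtain C where "\<And>x. norm ((1 + norm x) ^ ?N *\<^sub>R pds bs \<psi> x) \<le> C"
        using \<psi> bs unfolding schwartz_def bounded_iff by blast
      then show ?thesis by (intro bdd_aboveI2[where M=C]) simp
    qed
    have nonneg: "0 \<le> schwartz_seminorm ?N bs \<psi>" if "set bs \<subseteq> Basis" for bs
      unfolding schwartz_seminorm_def
      by (rule order_trans[OF _ cSUP_upper[OF UNIV_I bdd[OF that], of 0]]) simp
    have pt: "(1 + norm x) ^ ?N * cmod (\<psi> x) \<le> schwartz_seminorm ?N [] \<psi>" for x
      using cSUP_upper[OF UNIV_I bdd[of "[]"], of x] by (simp add: schwartz_seminorm_def)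
    have "cmod (dist_of (\<lambda>x. complex_of_real (f x)) \<psi>) \<le>
        (LINT x|lebesgue. \<bar>f x / (1 + norm x) ^ ?N\<bar> * schwartz_seminorm ?N [] \<psi>)"
      unfolding dist_of_def
    proof (rule order_trans[OF integral_norm_bound integral_mono])
      show "integrable lebesgue (\<lambda>x. norm (complex_of_real (f x) * \<psi> x))"
        by (intro integrable_norm int \<psi>)
      show "integrable lebesgue (\<lambda>x. \<bar>f x / (1 + norm x) ^ ?N\<bar> * schwartz_seminorm ?N [] \<psi>)"
        using f unfolding weighted_integrable_def by (intro integrable_mult_left integrable_abs)
      fix x :: 'a
      have "norm (complex_of_real (f x) * \<psi> x) = \<bar>f x / (1 + norm x) ^ ?N\<bar> * ((1 + norm x) ^ ?N * cmod (\<psi> x))"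
      proof -
        have "\<bar>f x\<bar> * z = \<bar>f x / W\<bar> * (W * z)" if "0 < W" for W z :: real
          using that by (simp add: abs_divide)
        from this[OF weight_pos] show ?thesis by (simp only: norm_mult norm_of_real)
      qed
      also have "\<dots> \<le> \<bar>f x / (1 + norm x) ^ ?N\<bar> * schwartz_seminorm ?N [] \<psi>"
        by (intro mult_left_mono pt) simp
      finally show "norm (complex_of_real (f x) * \<psi> x) \<le> \<bar>f x / (1 + norm x) ^ ?N\<bar> * schwartz_seminorm ?N [] \<psi>" .
    qed
    also have "\<dots> = W * schwartz_seminorm ?N [] \<psi>"
      unfolding W_def by (rule integral_mult_left_zero)
    also have "\<dots> \<le> W * (\<Sum>j\<le>?N. \<Sum>bs\<in>indices j. schwartz_seminorm ?N bs \<psi>)"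
    proof (rule mult_left_mono[OF _ W])
      have "schwartz_seminorm ?N [] \<psi> \<le> (\<Sum>bs\<in>indices 0. schwartz_seminorm ?N bs \<psi>)"
        by (rule member_le_sum) (use nonneg in \<open>auto simp: indices_def finite_indices\<close>)
      also have "\<dots> \<le> (\<Sum>j\<le>?N. \<Sum>bs\<in>indices j. schwartz_seminorm ?N bs \<psi>)"
        by (rule member_le_sum[where f="\<lambda>j. \<Sum>bs\<in>indices j. schwartz_seminorm ?N bs \<psi>"])
          (use nonneg in \<open>auto simp: indices_def intro!: sum_nonneg\<close>)
      finally show "schwartz_seminorm ?N [] \<psi> \<le> (\<Sum>j\<le>?N. \<Sum>bs\<in>indices j. schwartz_seminorm ?N bs \<psi>)" .
    qed
    finally show ?thesis .
  qed
  then show "\<exists>C N. \<forall>\<psi>\<in>schwartz. cmod (dist_of (\<lambda>x. complex_of_real (f x)) \<psi>) \<le>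
      C * (\<Sum>j\<le>N. \<Sum>bs\<in>indices j. schwartz_seminorm N bs \<psi>)" by blast
qed

text \<open>Integration by parts against Schwartz functions: multiply by the cutoff \<open>\<theta>(x/n)\<close> and let
  \<open>n\<close> tend to infinity; the derivative of the cutoff is \<open>O(1/n)\<close>.\<close>

lemma weak_deriv_rapid:
  fixes u w f :: "'a::euclidean_space \<Rightarrow> real"
  assumes wd: "has_weak_deriv UNIV [b] u w" and b: "b \<in> Basis"
    and u: "weighted_integrable u" and w: "weighted_integrable w"
    and f: "smooth f" "rapid f" "rapid (pd b f)"
  shows "(LINT x|lebesgue. u x * pd b f x) = - (LINT x|lebesgue. w x * f x)"
proof -
  define \<theta> :: "'a \<Rightarrow> real" where "\<theta> = box_bump (- One) One 0"
  have \<theta>: "\<theta> \<in> test_functions UNIV" unfolding \<theta>_def by (rule box_bump_test_function)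
  have \<theta>0: "\<theta> 0 \<noteq> 0" unfolding \<theta>_def box_bump_nonzero_iff by (simp add: mem_box)
  have sm\<theta>: "smooth \<theta>" using \<theta> by (simp add: test_functions_def)
  obtain K where K: "compact K" "\<And>x. x \<notin> K \<Longrightarrow> \<theta> x = 0" using test_function_support[OF \<theta>] by metis
  obtain C0 where C0: "\<And>x. \<bar>\<theta> x\<bar> \<le> C0" using test_function_support[OF \<theta>] by metis
  obtain C1 where C1: "\<And>x. \<bar>pd b \<theta> x\<bar> \<le> C1" using test_function_support[OF pd_test_function[OF \<theta> b]] by metis
  define r where "r n = inverse (real (Suc n))" for n
  have r: "0 < r n" "r n \<le> 1" for n by (auto simp: r_def field_simps)
  have r0: "r \<longlonglongrightarrow> 0" unfolding r_def by (rule LIMSEQ_inverse_real_of_nat)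
  define \<theta>n where "\<theta>n n x = \<theta> (r n *\<^sub>R x)" for n x
  have sm\<theta>n: "smooth (\<theta>n n)" for n using smooth_affine[OF sm\<theta>, of "r n" 0] by (simp add: \<theta>n_def[abs_def])
  have pd\<theta>n: "pd b (\<theta>n n) = (\<lambda>x. r n * pd b \<theta> (r n *\<^sub>R x))" for n
    using pd_affine[OF smooth_differentiable[OF sm\<theta>], of b "r n" 0] by (simp add: \<theta>n_def[abs_def])
  have pdp: "pd b (\<lambda>x. \<theta>n n x * f x) = (\<lambda>x. r n * pd b \<theta> (r n *\<^sub>R x) * f x + \<theta>n n x * pd b f x)" for n
    using pd_mult[OF smooth_differentiable[OF sm\<theta>n] smooth_differentiable[OF f(1)], of b n] by (simp add: pd\<theta>n)
  have test: "(\<lambda>x. \<theta>n n x * f x) \<in> test_functions UNIV" for n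
  proof -
    have "compact ((*\<^sub>R) (1 / r n) ` K)" using K(1) by (rule compact_scaling)
    moreover have "\<theta>n n x * f x = 0" if "x \<notin> (*\<^sub>R) (1 / r n) ` K" for x
    proof -
      have "x = (1 / r n) *\<^sub>R (r n *\<^sub>R x)" using r[of n] by simp
      then have "r n *\<^sub>R x \<notin> K" using that by blast
      then show ?thesis using K(2) by (simp add: \<theta>n_def)
    qed
    ultimately show ?thesis using smooth_mult[OF sm\<theta>n[of n] f(1)] by (auto simp: test_functions_def)
  qed
  obtain F0 where F0: "F0 \<ge> 0" "\<And>x. norm (f x) \<le> F0 / (1 + norm x) ^ (DIM('a) + 2)" using rapidD[OF f(2)] by metis
  obtain F1 where F1: "F1 \<ge> 0" "\<And>x. norm (pd b f x) \<le> F1 / (1 + norm x) ^ (DIM('a) + 2)" using rapidD[OF f(3)] by metis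
  have cont: "g \<in> borel_measurable borel" if "smooth g" for g :: "'a \<Rightarrow> real"
    by (intro borel_measurable_continuous_onI continuous_at_imp_continuous_on ballI
        differentiable_imp_continuous_within smooth_differentiable that)
  have fm: "f \<in> borel_measurable borel" "pd b f \<in> borel_measurable borel"
    using cont f(1) smooth_pd[OF f(1) b] by auto
  have i: "integrable lebesgue (\<lambda>x. u x * f x)" "integrable lebesgue (\<lambda>x. u x * pd b f x)" "integrable lebesgue (\<lambda>x. w x * f x)"
    using weighted_integrable_mult[OF u fm(1) F0(2)] weighted_integrable_mult[OF u fm(2) F1(2)]
      weighted_integrable_mult[OF w fm(1) F0(2)] by simp_all
  have lim\<theta>: "(\<lambda>n. \<theta> (r n *\<^sub>R x)) \<longlonglongrightarrow> \<theta> 0" for x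
  proof -
    have "(\<lambda>n. r n *\<^sub>R x) \<longlonglongrightarrow> 0 *\<^sub>R x" by (intro tendsto_intros r0)
    then have "(\<lambda>n. r n *\<^sub>R x) \<longlonglongrightarrow> 0" by simp
    then show ?thesis
      by (rule isCont_tendsto_compose[rotated])
        (use differentiable_imp_continuous_within[OF smooth_differentiable[OF sm\<theta>]] in blast)
  qed
  have m\<theta>: "(\<lambda>x. \<theta> (r n *\<^sub>R x)) \<in> borel_measurable lebesgue" "(\<lambda>x. pd b \<theta> (r n *\<^sub>R x)) \<in> borel_measurable lebesgue" for n
    using cont[OF sm\<theta>] cont[OF smooth_pd[OF sm\<theta> b]] by (auto intro!: measurable_completion)
  have L: "(\<lambda>n. LINT x|lebesgue. u x * pd b (\<lambda>x. \<theta>n n x * f x) x) \<longlonglongrightarrow> (LINT x|lebesgue. \<theta> 0 * (u x * pd b f x))"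
  proof (rule integral_dominated_convergence[where w="\<lambda>x. C1 * \<bar>u x * f x\<bar> + C0 * \<bar>u x * pd b f x\<bar>"])
    show "integrable lebesgue (\<lambda>x. C1 * \<bar>u x * f x\<bar> + C0 * \<bar>u x * pd b f x\<bar>)"
      by (intro Bochner_Integration.integrable_add integrable_mult_right integrable_abs i)
    show "(\<lambda>x. \<theta> 0 * (u x * pd b f x)) \<in> borel_measurable lebesgue" using i by auto
    show "(\<lambda>x. u x * pd b (\<lambda>x. \<theta>n n x * f x) x) \<in> borel_measurable lebesgue" for n
      by (intro borel_measurable_times weighted_integrable_measurable u
          test_function_measurable_lebesgue[OF pd_test_function[OF test b]])
    show "AE x in lebesgue. (\<lambda>n. u x * pd b (\<lambda>x. \<theta>n n x * f x) x) \<longlonglongrightarrow> \<theta> 0 * (u x * pd b f x)"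
    proof (intro AE_I2)
      fix x
      have "(\<lambda>n. r n * pd b \<theta> (r n *\<^sub>R x)) \<longlonglongrightarrow> 0"
      proof (rule Lim_null_comparison)
        show "\<forall>\<^sub>F n in sequentially. norm (r n * pd b \<theta> (r n *\<^sub>R x)) \<le> r n * C1"
          using r C1 by (auto simp: abs_mult abs_of_pos less_imp_le intro!: always_eventually mult_left_mono)
        show "(\<lambda>n. r n * C1) \<longlonglongrightarrow> 0" by (rule tendsto_mult_left_zero[OF r0])
      qed
      then have "(\<lambda>n. u x * (r n * pd b \<theta> (r n *\<^sub>R x) * f x + \<theta>n n x * pd b f x)) \<longlonglongrightarrow> u x * (0 * f x + \<theta> 0 * pd b f x)"
        unfolding \<theta>n_def by (intro tendsto_intros lim\<theta>)
      then show "(\<lambda>n. u x * pd b (\<lambda>x. \<theta>n n x * f x) x) \<longlonglongrightarrow> \<theta> 0 * (u x * pd b f x)"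
        unfolding pdp by (simp add: mult.left_commute)
    qed
    show "AE x in lebesgue. norm (u x * pd b (\<lambda>x. \<theta>n n x * f x) x) \<le> C1 * \<bar>u x * f x\<bar> + C0 * \<bar>u x * pd b f x\<bar>" for n
    proof (intro AE_I2)
      fix x
      have "\<bar>r n * pd b \<theta> (r n *\<^sub>R x)\<bar> \<le> 1 * C1"
        unfolding abs_mult using r[of n] C1 by (intro mult_mono) auto
      then have "\<bar>r n * pd b \<theta> (r n *\<^sub>R x)\<bar> * \<bar>u x * f x\<bar> + \<bar>\<theta>n n x\<bar> * \<bar>u x * pd b f x\<bar> \<le> C1 * \<bar>u x * f x\<bar> + C0 * \<bar>u x * pd b f x\<bar>"
        using C0[of "r n *\<^sub>R x"] by (intro add_mono mult_right_mono) (auto simp: \<theta>n_def)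
      moreover have "\<bar>u x * (r n * pd b \<theta> (r n *\<^sub>R x) * f x + \<theta>n n x * pd b f x)\<bar> \<le>
          \<bar>r n * pd b \<theta> (r n *\<^sub>R x)\<bar> * \<bar>u x * f x\<bar> + \<bar>\<theta>n n x\<bar> * \<bar>u x * pd b f x\<bar>"
      proof -
        have "u x * (r n * pd b \<theta> (r n *\<^sub>R x) * f x + \<theta>n n x * pd b f x) =
          (r n * pd b \<theta> (r n *\<^sub>R x)) * (u x * f x) + \<theta>n n x * (u x * pd b f x)" by (simp add: algebra_simps)
        then show ?thesis by (metis abs_mult abs_triangle_ineq)
      qed
      ultimately show "norm (u x * pd b (\<lambda>x. \<theta>n n x * f x) x) \<le> C1 * \<bar>u x * f x\<bar> + C0 * \<bar>u x * pd b f x\<bar>"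
        unfolding pdp real_norm_def by linarith
    qed
  qed
  have R: "(\<lambda>n. LINT x|lebesgue. w x * (\<theta>n n x * f x)) \<longlonglongrightarrow> (LINT x|lebesgue. \<theta> 0 * (w x * f x))"
  proof (rule integral_dominated_convergence[where w="\<lambda>x. C0 * \<bar>w x * f x\<bar>"])
    show "integrable lebesgue (\<lambda>x. C0 * \<bar>w x * f x\<bar>)"
      by (intro integrable_mult_right integrable_abs i)
    show "(\<lambda>x. \<theta> 0 * (w x * f x)) \<in> borel_measurable lebesgue" using i by auto
    show "(\<lambda>x. w x * (\<theta>n n x * f x)) \<in> borel_measurable lebesgue" for n
      by (intro borel_measurable_times[OF weighted_integrable_measurable[OF w]] test_function_measurable_lebesgue[OF test])
    show "AE x in lebesgue. (\<lambda>n. w x * (\<theta>n n x * f x)) \<longlonglongrightarrow> \<theta> 0 * (w x * f x)"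
    proof (intro AE_I2)
      fix x
      have "(\<lambda>n. w x * (\<theta>n n x * f x)) \<longlonglongrightarrow> w x * (\<theta> 0 * f x)"
        unfolding \<theta>n_def by (intro tendsto_intros lim\<theta>)
      then show "(\<lambda>n. w x * (\<theta>n n x * f x)) \<longlonglongrightarrow> \<theta> 0 * (w x * f x)" by (simp add: ac_simps)
    qed
    show "AE x in lebesgue. norm (w x * (\<theta>n n x * f x)) \<le> C0 * \<bar>w x * f x\<bar>" for n
    proof (intro AE_I2)
      fix x
      show "norm (w x * (\<theta>n n x * f x)) \<le> C0 * \<bar>w x * f x\<bar>"
        using mult_right_mono[OF C0[of "r n *\<^sub>R x"] abs_ge_zero[of "w x * f x"]]
        by (simp add: \<theta>n_def abs_mult ac_simps)
    qed
  qed
  have "(LINT x|lebesgue. u x * pd b (\<lambda>x. \<theta>n n x * f x) x) = - (LINT x|lebesgue. w x * (\<theta>n n x * f x))" for n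
    using wd test[of n] by (auto simp: has_weak_deriv_iff)
  then have "(LINT x|lebesgue. \<theta> 0 * (u x * pd b f x)) = - (LINT x|lebesgue. \<theta> 0 * (w x * f x))"
    using L tendsto_minus[OF R] by (simp add: LIMSEQ_unique)
  then have "\<theta> 0 * (LINT x|lebesgue. u x * pd b f x) = \<theta> 0 * - (LINT x|lebesgue. w x * f x)" by simp
  then show ?thesis using \<theta>0 by (simp only: mult_cancel_left) simp
qed

lemma weak_deriv_schwartz:
  fixes u w :: "'a::euclidean_space \<Rightarrow> real"
  assumes wd: "has_weak_deriv UNIV [b] u w" and b: "b \<in> Basis"
    and u: "weighted_integrable u" and w: "weighted_integrable w" and \<omega>: "\<omega> \<in> schwartz"
  shows "(LINT x|lebesgue. complex_of_real (u x) * pd b \<omega> x) = - (LINT x|lebesgue. complex_of_real (w x) * \<omega> x)"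
proof -
  have *: "(LINT x|lebesgue. u x * T (pd b \<omega> x)) = - (LINT x|lebesgue. w x * T (\<omega> x))"
    if T: "bounded_linear T" "\<And>z. \<bar>T z\<bar> \<le> cmod z" for T
  proof -
    have p: "pd b (\<lambda>x. T (\<omega> x)) = (\<lambda>x. T (pd b \<omega> x))"
      by (rule pd_bounded_linear[OF T(1) schwartz_differentiable[OF \<omega>]])
    have rap: "rapid (\<lambda>x. T (g x))" if "rapid g" for g :: "'a \<Rightarrow> complex"
    proof (rule rapidI)
      fix N
      obtain C where C: "\<And>x. norm (g x) \<le> C / (1 + norm x) ^ N" using rapidD[OF \<open>rapid g\<close>] by metis
      have "(1 + norm x) ^ N * norm (T (g x)) \<le> C" for x
        using order_trans[OF T(2) C[of x]] weight_pos[of x N] by (simp add: pos_le_divide_eq mult.commute)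
      then show "\<exists>C. \<forall>x. (1 + norm x) ^ N * norm (T (g x)) \<le> C" by blast
    qed
    show ?thesis
      using weak_deriv_rapid[OF wd b u w smooth_bounded_linear[OF T(1) schwartz_smooth[OF \<omega>]] rap[OF schwartz_rapid[OF \<omega>]]]
        rap[OF schwartz_rapid[OF schwartz_pd[OF \<omega> b]]] by (simp add: p)
  qed
  have iu: "integrable lebesgue (\<lambda>x. complex_of_real (u x) * pd b \<omega> x)"
    and iw: "integrable lebesgue (\<lambda>x. complex_of_real (w x) * \<omega> x)"
    by (intro weighted_integrable_mult_schwartz u w schwartz_pd \<omega> b)+
  show ?thesis
  proof (rule complex_eqI)
    show "Re (LINT x|lebesgue. complex_of_real (u x) * pd b \<omega> x) = Re (- (LINT x|lebesgue. complex_of_real (w x) * \<omega> x))"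
      using *[OF bounded_linear_Re abs_Re_le_cmod] iu iw by (simp flip: integral_Re)
    show "Im (LINT x|lebesgue. complex_of_real (u x) * pd b \<omega> x) = Im (- (LINT x|lebesgue. complex_of_real (w x) * \<omega> x))"
      using *[OF bounded_linear_Im abs_Im_le_cmod] iu iw by (simp flip: integral_Im)
  qed
qed

section \<open>The linearised Bernoulli condition\<close>

lemma indices_0: "indices 0 = {[]}"
  by (auto simp: indices_def)

lemma sum_indices_1:
  "(\<Sum>bs\<in>indices 1. F bs) = (\<Sum>c\<in>(Basis::'a::euclidean_space set). F [c])"
proof -
  have "indices 1 = (\<lambda>c. [c]) ` (Basis::'a set)"
    by (auto simp: indices_def length_Suc_conv)
  then show ?thesis by (simp add: sum.reindex inj_on_def)
qed

lemma sum_indices_2: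
  "(\<Sum>bs\<in>indices 2. F bs) = (\<Sum>b\<in>(Basis::'a::euclidean_space set). \<Sum>c\<in>Basis. F [c, b])"
proof -
  have "indices 2 = (\<lambda>(b, c). [c, b]) ` ((Basis::'a set) \<times> Basis)"
    by (auto simp: indices_def length_Suc_conv numeral_2_eq_2 image_iff)
  then have "(\<Sum>bs\<in>indices 2. F bs) = (\<Sum>(b, c)\<in>(Basis::'a set) \<times> Basis. F [c, b])"
    by (simp add: sum.reindex inj_on_def case_prod_beta)
  then show ?thesis by (simp add: sum.cartesian_product)
qed

lemma nn_integral_norm_sq_components:
  fixes v :: "'a::euclidean_space \<Rightarrow> 'e::euclidean_space"
  assumes "v \<in> borel_measurable lebesgue"
  shows "(\<integral>\<^sup>+x. ennreal ((norm (v x))\<^sup>2) \<partial>lebesgue) = (\<Sum>c\<in>Basis. \<integral>\<^sup>+x. ennreal ((v x \<bullet> c)\<^sup>2) \<partial>lebesgue)"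
proof -
  have "(norm (v x))\<^sup>2 = (\<Sum>c\<in>Basis. (v x \<bullet> c)\<^sup>2)" for x
    unfolding power2_norm_eq_inner by (subst euclidean_inner) (simp add: power2_eq_square)
  then have "(\<integral>\<^sup>+x. ennreal ((norm (v x))\<^sup>2) \<partial>lebesgue) = (\<integral>\<^sup>+x. (\<Sum>c\<in>Basis. ennreal ((v x \<bullet> c)\<^sup>2)) \<partial>lebesgue)"
    by (simp add: sum_ennreal)
  also have "\<dots> = (\<Sum>c\<in>Basis. \<integral>\<^sup>+x. ennreal ((v x \<bullet> c)\<^sup>2) \<partial>lebesgue)"
  proof (rule nn_integral_sum)
    show "(\<lambda>x. ennreal ((v x \<bullet> c)\<^sup>2)) \<in> borel_measurable lebesgue" for c
      using assms by measurable
  qed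
  finally show ?thesis .
qed

lemma integrable_of_nn_integral:
  fixes f :: "'a::euclidean_space \<Rightarrow> real"
  assumes "f \<in> borel_measurable lebesgue" "\<And>x. 0 \<le> f x" "(\<integral>\<^sup>+x. ennreal (f x) \<partial>lebesgue) < \<infinity>"
  shows "integrable lebesgue f" "(\<integral>\<^sup>+x. ennreal (f x) \<partial>lebesgue) = ennreal (LINT x|lebesgue. f x)"
proof -
  show "integrable lebesgue f" by (rule integrableI_nonneg) (use assms in auto)
  then show "(\<integral>\<^sup>+x. ennreal (f x) \<partial>lebesgue) = ennreal (LINT x|lebesgue. f x)"
    by (rule nn_integral_eq_integral) (use assms in auto)
qed

text \<open>Borel representatives \<open>u\<close> of the weak gradient and \<open>w b\<close> of its derivative in direction
  \<open>b\<close>, for a function in the Sobolev space of order 2.\<close>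

lemma sobolev_2_derivatives:
  fixes f :: "'a::euclidean_space \<Rightarrow> real"
  assumes f: "f \<in> sobolev_space 2 UNIV" and norm: "sobolev_norm 2 UNIV f < \<epsilon>"
  obtains u :: "'a \<Rightarrow> 'a" and w :: "'a \<Rightarrow> 'a \<Rightarrow> 'a"
  where "u \<in> borel_measurable borel" "\<And>b. b \<in> Basis \<Longrightarrow> w b \<in> borel_measurable borel"
    and "f \<in> borel_measurable lebesgue" "integrable lebesgue (\<lambda>x. (f x)\<^sup>2)"
    and "\<And>c. c \<in> Basis \<Longrightarrow> has_weak_deriv UNIV [c] f (\<lambda>x. u x \<bullet> c)"
    and "\<And>b c. b \<in> Basis \<Longrightarrow> c \<in> Basis \<Longrightarrow> has_weak_deriv UNIV [b] (\<lambda>x. u x \<bullet> c) (\<lambda>x. w b x \<bullet> c)"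
    and "integrable lebesgue (\<lambda>x. (norm (u x))\<^sup>2)"
    and "\<And>b. b \<in> Basis \<Longrightarrow> integrable lebesgue (\<lambda>x. (norm (w b x))\<^sup>2)"
    and "(LINT x|lebesgue. (norm (u x))\<^sup>2) + (\<Sum>b\<in>Basis. LINT x|lebesgue. (norm (w b x))\<^sup>2) \<le> \<epsilon>\<^sup>2"
proof -
  define X where "X = sobolev_norm_sq 2 UNIV f"
  have Xfin: "X < \<infinity>" using f by (simp add: X_def sobolev_space_def)
  have sq: "sqrt (enn2real X) < \<epsilon>" using norm by (simp add: sobolev_norm_def X_def)
  have "(sqrt (enn2real X))\<^sup>2 < \<epsilon>\<^sup>2" by (rule power_strict_mono[OF sq]) auto
  then have lt2: "enn2real X < \<epsilon>\<^sup>2" by simp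
  have "ennreal (enn2real X) < ennreal (\<epsilon>\<^sup>2)"
    by (rule ennreal_lessI[OF le_less_trans[OF enn2real_nonneg lt2] lt2])
  then have "X < ennreal (\<epsilon>\<^sup>2)" using Xfin by (simp add: ennreal_enn2real)
  then obtain D where D: "\<forall>j\<le>2. \<forall>bs\<in>indices j. has_weak_deriv UNIV bs f (D bs)"
    and lt: "(\<Sum>j\<le>2. \<Sum>bs\<in>indices j. \<integral>\<^sup>+x. ennreal ((D bs x)\<^sup>2) \<partial>lebesgue) < ennreal (\<epsilon>\<^sup>2)"
    unfolding X_def sobolev_norm_sq_def Let_def INF_less_iff by auto
  let ?I = "\<lambda>bs. \<integral>\<^sup>+x. ennreal ((D bs x)\<^sup>2) \<partial>lebesgue"
  have "(\<Sum>j\<le>2. \<Sum>bs\<in>indices j. ?I bs) = ?I [] + (\<Sum>c\<in>Basis. ?I [c]) + (\<Sum>b\<in>Basis. \<Sum>c\<in>Basis. ?I [c, b])"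
    by (simp add: numeral_2_eq_2 atMost_Suc indices_0 sum_indices_1[unfolded One_nat_def]
        sum_indices_2[unfolded numeral_2_eq_2] ac_simps)
  with lt have tot: "?I [] + (\<Sum>c\<in>Basis. ?I [c]) + (\<Sum>b\<in>Basis. \<Sum>c\<in>Basis. ?I [c, b]) < ennreal (\<epsilon>\<^sup>2)" by simp
  have D0: "has_weak_deriv UNIV [] f (D [])" using D by (auto simp: indices_def)
  have D1: "has_weak_deriv UNIV [c] f (D [c])" if "c \<in> Basis" for c
    using D[rule_format, of 1 "[c]"] that by (auto simp: indices_def)
  have D2: "has_weak_deriv UNIV [c, b] f (D [c, b])" if "b \<in> Basis" "c \<in> Basis" for b c
    using D[rule_format, of 2 "[c, b]"] that by (auto simp: indices_def)
  have fD: "AE x in lebesgue. f x = D [] x"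
    by (rule du_Bois_Reymond_eq) (use D0 in \<open>auto simp: has_weak_deriv_iff\<close>)
  have f_meas: "f \<in> borel_measurable lebesgue"
    using D0 by (auto simp: has_weak_deriv_iff intro: locally_integrable_measurable)
  have D0_meas: "D [] \<in> borel_measurable lebesgue"
    using D0 by (auto simp: has_weak_deriv_iff intro: locally_integrable_measurable)
  have f_sq: "integrable lebesgue (\<lambda>x. (f x)\<^sup>2)"
  proof (rule integrable_of_nn_integral)
    have "(\<integral>\<^sup>+x. ennreal ((f x)\<^sup>2) \<partial>lebesgue) = ?I []"
      by (rule nn_integral_cong_AE) (use fD in \<open>auto elim: eventually_mono\<close>)
    also have "\<dots> \<le> ?I [] + (\<Sum>c\<in>Basis. ?I [c]) + (\<Sum>b\<in>Basis. \<Sum>c\<in>Basis. ?I [c, b])"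
      by (simp add: add.assoc)
    also have "\<dots> < \<infinity>" using tot by (rule order.strict_trans) simp
    finally show "(\<integral>\<^sup>+x. ennreal ((f x)\<^sup>2) \<partial>lebesgue) < \<infinity>" .
  qed (use f_meas in auto)
  have D1m: "D [c] \<in> borel_measurable lebesgue" if "c \<in> Basis" for c
    using D1[OF that] by (auto simp: has_weak_deriv_iff intro: locally_integrable_measurable)
  have D2m: "D [c, b] \<in> borel_measurable lebesgue" if "b \<in> Basis" "c \<in> Basis" for b c
    using D2[OF that] by (auto simp: has_weak_deriv_iff intro: locally_integrable_measurable)
  have "\<forall>c\<in>Basis. \<exists>d. d \<in> borel_measurable borel \<and> (AE x in lebesgue. D [c] x = d x)"
    using borel_representative[OF D1m] by metis
  then obtain d1 where d1: "\<And>c. c \<in> Basis \<Longrightarrow> d1 c \<in> borel_measurable borel"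
    "\<And>c. c \<in> Basis \<Longrightarrow> AE x in lebesgue. D [c] x = d1 c x" by metis
  have "\<forall>b\<in>Basis. \<forall>c\<in>Basis. \<exists>d. d \<in> borel_measurable borel \<and> (AE x in lebesgue. D [c, b] x = d x)"
    using borel_representative[OF D2m] by metis
  then obtain d2 where d2: "\<And>b c. b \<in> Basis \<Longrightarrow> c \<in> Basis \<Longrightarrow> d2 b c \<in> borel_measurable borel"
    "\<And>b c. b \<in> Basis \<Longrightarrow> c \<in> Basis \<Longrightarrow> AE x in lebesgue. D [c, b] x = d2 b c x" by metis
  define u where "u x = (\<Sum>c\<in>Basis. d1 c x *\<^sub>R c)" for x
  define w where "w b x = (\<Sum>c\<in>Basis. d2 b c x *\<^sub>R c)" for b x
  have uc: "u x \<bullet> c = d1 c x" if "c \<in> Basis" for x c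
    using that by (simp add: u_def inner_sum_left_Basis)
  have wc: "w b x \<bullet> c = d2 b c x" if "c \<in> Basis" for x b c
    using that by (simp add: w_def inner_sum_left_Basis)
  have um: "u \<in> borel_measurable borel"
    unfolding u_def[abs_def] using d1 by (intro borel_measurable_sum borel_measurable_scaleR) auto
  have wm: "w b \<in> borel_measurable borel" if "b \<in> Basis" for b
    unfolding w_def[abs_def] using d2 that by (intro borel_measurable_sum borel_measurable_scaleR) auto
  have leb: "g \<in> borel_measurable lebesgue" if "g \<in> borel_measurable borel" for g :: "'a \<Rightarrow> 'b::euclidean_space"
    using that by (intro measurable_completion) simp
  have wd1: "has_weak_deriv UNIV [c] f (\<lambda>x. u x \<bullet> c)" if c: "c \<in> Basis" for c
    unfolding uc[OF c]
    by (rule has_weak_deriv_cong_AE[OF D1[OF c] c f_meas]) (use d1 c leb in auto)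
  have wd2: "has_weak_deriv UNIV [b] (\<lambda>x. u x \<bullet> c) (\<lambda>x. w b x \<bullet> c)" if b: "b \<in> Basis" and c: "c \<in> Basis" for b c
    unfolding uc[OF c] wc[OF c]
  proof (rule has_weak_deriv_cong_AE[OF _ b])
    have "(LINT x|lebesgue. D [c] x * pd b \<psi> x) = - (LINT x|lebesgue. D [c, b] x * \<psi> x)"
      if \<psi>: "\<psi> \<in> test_functions UNIV" for \<psi>
    proof -
      have "(LINT x|lebesgue. f x * pd c (pd b \<psi>) x) = - (LINT x|lebesgue. D [c] x * pd b \<psi> x)"
        using D1[OF c] pd_test_function[OF \<psi> b] by (auto simp: has_weak_deriv_iff)
      moreover have "(LINT x|lebesgue. f x * pd c (pd b \<psi>) x) = (LINT x|lebesgue. D [c, b] x * \<psi> x)"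
        using D2[OF b c] \<psi> by (auto simp: has_weak_deriv_iff)
      ultimately show ?thesis by simp
    qed
    then show "has_weak_deriv UNIV [b] (D [c]) (D [c, b])"
      using D1[OF c] D2[OF b c] by (simp add: has_weak_deriv_iff)
  qed (intro leb[OF d1(1)[OF c]] leb[OF d2(1)[OF b c]] d1(2)[OF c] d2(2)[OF b c])+
  have eq1: "(\<integral>\<^sup>+x. ennreal ((norm (u x))\<^sup>2) \<partial>lebesgue) = (\<Sum>c\<in>Basis. ?I [c])"
    unfolding nn_integral_norm_sq_components[OF leb[OF um]]
  proof (intro sum.cong refl nn_integral_cong_AE)
    fix c :: 'a assume c: "c \<in> Basis"
    from d1(2)[OF c] show "AE x in lebesgue. ennreal ((u x \<bullet> c)\<^sup>2) = ennreal ((D [c] x)\<^sup>2)"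
      by eventually_elim (simp add: uc[OF c])
  qed
  have eq2: "(\<integral>\<^sup>+x. ennreal ((norm (w b x))\<^sup>2) \<partial>lebesgue) = (\<Sum>c\<in>Basis. ?I [c, b])" if b: "b \<in> Basis" for b
    unfolding nn_integral_norm_sq_components[OF leb[OF wm[OF b]]]
  proof (intro sum.cong refl nn_integral_cong_AE)
    fix c :: 'a assume c: "c \<in> Basis"
    from d2(2)[OF b c] show "AE x in lebesgue. ennreal ((w b x \<bullet> c)\<^sup>2) = ennreal ((D [c, b] x)\<^sup>2)"
      by eventually_elim (simp add: wc[OF c])
  qed
  have le: "(\<integral>\<^sup>+x. ennreal ((norm (u x))\<^sup>2) \<partial>lebesgue) + (\<Sum>b\<in>Basis. \<integral>\<^sup>+x. ennreal ((norm (w b x))\<^sup>2) \<partial>lebesgue) \<le> ennreal (\<epsilon>\<^sup>2)"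
  proof -
    have "(\<Sum>c\<in>Basis. ?I [c]) + (\<Sum>b\<in>Basis. \<Sum>c\<in>Basis. ?I [c, b]) \<le>
        ?I [] + (\<Sum>c\<in>Basis. ?I [c]) + (\<Sum>b\<in>Basis. \<Sum>c\<in>Basis. ?I [c, b])"
      by (simp add: add.assoc)
    also note tot
    finally show ?thesis using eq1 eq2 by (simp add: less_imp_le)
  qed
  have fin1: "(\<integral>\<^sup>+x. ennreal ((norm (u x))\<^sup>2) \<partial>lebesgue) < \<infinity>"
    by (rule le_less_trans[OF order_trans[OF _ le]]) auto
  have fin2: "(\<integral>\<^sup>+x. ennreal ((norm (w b x))\<^sup>2) \<partial>lebesgue) < \<infinity>" if "b \<in> Basis" for b
  proof -
    have "(\<integral>\<^sup>+x. ennreal ((norm (w b x))\<^sup>2) \<partial>lebesgue) \<le> (\<Sum>b\<in>Basis. \<integral>\<^sup>+x. ennreal ((norm (w b x))\<^sup>2) \<partial>lebesgue)"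
      by (rule member_le_sum) (use that in auto)
    also have "\<dots> \<le> ennreal (\<epsilon>\<^sup>2)" by (rule order_trans[OF _ le]) simp
    finally show ?thesis by (rule le_less_trans) simp
  qed
  have m1: "(\<lambda>x. (norm (u x))\<^sup>2) \<in> borel_measurable lebesgue" using leb[OF um] by measurable
  have m2: "(\<lambda>x. (norm (w b x))\<^sup>2) \<in> borel_measurable lebesgue" if "b \<in> Basis" for b
    using leb[OF wm[OF that]] by measurable
  note int1 = integrable_of_nn_integral[OF m1 _ fin1]
  note int2 = integrable_of_nn_integral[OF m2 _ fin2]
  have "ennreal ((LINT x|lebesgue. (norm (u x))\<^sup>2) + (\<Sum>b\<in>Basis. LINT x|lebesgue. (norm (w b x))\<^sup>2)) \<le> ennreal (\<epsilon>\<^sup>2)"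
    using le int1(2) int2(2)
    by (simp add: ennreal_plus[symmetric] sum_nonneg sum_ennreal del: ennreal_plus)
  then have "(LINT x|lebesgue. (norm (u x))\<^sup>2) + (\<Sum>b\<in>Basis. LINT x|lebesgue. (norm (w b x))\<^sup>2) \<le> \<epsilon>\<^sup>2"
    by (subst (asm) ennreal_le_iff) auto
  then show thesis
    using that[OF um wm f_meas f_sq wd1 wd2] int1(1) int2(1) by simp
qed

lemma weighted_integrable_component:
  fixes v :: "'a::euclidean_space \<Rightarrow> 'e::euclidean_space"
  assumes "v \<in> borel_measurable lebesgue" "integrable lebesgue (\<lambda>x. (norm (v x))\<^sup>2)" "c \<in> Basis"
  shows "weighted_integrable (\<lambda>x. v x \<bullet> c)"
proof (rule weighted_integrable_of_square)
  show m: "(\<lambda>x. v x \<bullet> c) \<in> borel_measurable lebesgue" using assms(1) by measurable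
  show "integrable lebesgue (\<lambda>x. (v x \<bullet> c)\<^sup>2)"
  proof (rule Bochner_Integration.integrable_bound[OF assms(2)])
    show "(\<lambda>x. (v x \<bullet> c)\<^sup>2) \<in> borel_measurable lebesgue" using m by measurable
    show "AE x in lebesgue. norm ((v x \<bullet> c)\<^sup>2) \<le> norm ((norm (v x))\<^sup>2)"
      using Basis_le_norm[OF assms(3)] by (intro AE_I2) (simp add: abs_le_square_iff[symmetric])
  qed
qed

text \<open>By the Cauchy-Schwarz inequality for \<open>(1, p)\<close> and \<open>(e, r)\<close> the factor \<open>1 + \<bar>p\<bar>\<^sup>2\<close> cancels, so
  the bound is uniform in the slope \<open>p\<close>.\<close>

lemma kinetic_term_le:
  fixes p r :: "'a::real_inner" and e :: real
  shows "\<bar>- (1/2) * (norm r)\<^sup>2 + (e + p \<bullet> r)\<^sup>2 / (2 * (1 + (norm p)\<^sup>2))\<bar> \<le> (norm r)\<^sup>2 + 1/2 * e\<^sup>2"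
proof -
  have pos: "0 < 1 + (norm p)\<^sup>2" by (simp add: add_pos_nonneg)
  have "\<bar>e + p \<bullet> r\<bar> \<le> \<bar>e\<bar> + norm p * norm r" using Cauchy_Schwarz_ineq2[of p r] by linarith
  then have "(e + p \<bullet> r)\<^sup>2 \<le> (\<bar>e\<bar> + norm p * norm r)\<^sup>2" by (simp add: abs_le_square_iff[symmetric])
  also have "\<dots> \<le> (1 + (norm p)\<^sup>2) * (e\<^sup>2 + (norm r)\<^sup>2)"
  proof -
    have "0 \<le> (\<bar>e\<bar> * norm p - norm r)\<^sup>2" by simp
    then show ?thesis by (simp add: power2_eq_square algebra_simps)
  qed
  finally have le: "(e + p \<bullet> r)\<^sup>2 \<le> (1 + (norm p)\<^sup>2) * (e\<^sup>2 + (norm r)\<^sup>2)" .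
  define z where "z = (e + p \<bullet> r)\<^sup>2 / (2 * (1 + (norm p)\<^sup>2))"
  have "z \<le> (e\<^sup>2 + (norm r)\<^sup>2) / 2"
    using le pos unfolding z_def by (simp add: divide_le_eq field_simps)
  moreover have "0 \<le> z" unfolding z_def using pos by simp
  moreover have "\<bar>- (1/2) * B + y\<bar> \<le> B + 1/2 * A" if "y \<le> (A + B) / 2" "0 \<le> y" "0 \<le> A" "0 \<le> B" for A B y :: real
    using that by (simp add: abs_le_iff)
  ultimately show ?thesis unfolding z_def by simp
qed

lemma curvature_remainder_le:
  fixes p :: "'a::euclidean_space" and v :: "'a \<Rightarrow> 'a"
  shows "\<bar>\<Sum>b\<in>Basis. (unit_slope_deriv p (v b) - v b) \<bullet> b\<bar> \<le>
     real DIM('a) * (norm p)\<^sup>2 + (\<Sum>b\<in>Basis. (norm (v b))\<^sup>2)"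
proof -
  have "\<bar>\<Sum>b\<in>Basis. (unit_slope_deriv p (v b) - v b) \<bullet> b\<bar> \<le> (\<Sum>b\<in>Basis. \<bar>(unit_slope_deriv p (v b) - v b) \<bullet> b\<bar>)"
    by (rule sum_abs)
  also have "\<dots> \<le> (\<Sum>b\<in>(Basis::'a set). (norm p)\<^sup>2 + (norm (v b))\<^sup>2)"
  proof (rule sum_mono)
    fix b :: 'a assume b: "b \<in> Basis"
    have "\<bar>(unit_slope_deriv p (v b) - v b) \<bullet> b\<bar> \<le> norm (unit_slope_deriv p (v b) - v b)"
      by (rule Basis_le_norm[OF b])
    also have "\<dots> \<le> 2 * norm p * norm (v b)" by (rule norm_unit_slope_deriv_le)
    also have "\<dots> \<le> (norm p)\<^sup>2 + (norm (v b))\<^sup>2"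
      using sum_squares_bound[of "norm p" "norm (v b)"] by simp
    finally show "\<bar>(unit_slope_deriv p (v b) - v b) \<bullet> b\<bar> \<le> (norm p)\<^sup>2 + (norm (v b))\<^sup>2" .
  qed
  finally show ?thesis by (simp add: sum.distrib)
qed

lemma square_integrable_L2_norm_less:
  assumes "square_integrable f" "L2_norm f < \<epsilon>"
  shows "integrable lebesgue (\<lambda>x. (norm (f x))\<^sup>2)" "(LINT x|lebesgue. (norm (f x))\<^sup>2) \<le> \<epsilon>\<^sup>2"
proof -
  show "integrable lebesgue (\<lambda>x. (norm (f x))\<^sup>2)" using assms by (simp add: square_integrable_def)
  have "0 \<le> (LINT x|lebesgue. (norm (f x))\<^sup>2)" by (rule Bochner_Integration.integral_nonneg) simp
  moreover have "(L2_norm f)\<^sup>2 \<le> \<epsilon>\<^sup>2"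
    by (rule power_mono) (use assms in \<open>auto simp: L2_norm_def\<close>)
  ultimately show "(LINT x|lebesgue. (norm (f x))\<^sup>2) \<le> \<epsilon>\<^sup>2" by (simp add: L2_norm_def)
qed

text \<open>The remainder \<open>F\<close> of the Bernoulli condition consists of the kinetic terms and of the curvature
  minus the Laplacian.  The kinetic terms contribute \<open>3/2\<close> to the constant; the curvature contributes
  \<open>\<bar>\<nabla>\<eta>\<bar>\<^sup>2\<close> once for each of the \<open>d\<close> coordinates, and the squares of the second derivatives once.\<close>

lemma bernoulli_remainder:
  fixes \<eta> q :: "'a::euclidean_space \<Rightarrow> real \<Rightarrow> real"
  assumes bern: "bernoulli_condition g \<sigma> \<rho> q \<eta> t" and \<sigma>: "\<sigma> \<ge> 0" and \<rho>: "\<rho> > 0"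
    and \<eta>t: "square_integrable (\<lambda>x. deriv (\<lambda>s. \<eta> x s) t)" "L2_norm (\<lambda>x. deriv (\<lambda>s. \<eta> x s) t) < \<epsilon>"
    and Dq: "square_integrable (weak_grad (\<lambda>x. q x t))" "L2_norm (weak_grad (\<lambda>x. q x t)) < \<epsilon>"
    and um: "u \<in> borel_measurable borel" and wm: "\<And>b. b \<in> Basis \<Longrightarrow> w b \<in> borel_measurable borel"
    and wd1: "\<And>c. c \<in> Basis \<Longrightarrow> has_weak_deriv UNIV [c] (\<lambda>x. \<eta> x t) (\<lambda>x. u x \<bullet> c)"
    and wd2: "\<And>b c. b \<in> Basis \<Longrightarrow> c \<in> Basis \<Longrightarrow> has_weak_deriv UNIV [b] (\<lambda>x. u x \<bullet> c) (\<lambda>x. w b x \<bullet> c)"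
    and iu: "integrable lebesgue (\<lambda>x. (norm (u x))\<^sup>2)"
    and iw: "\<And>b. b \<in> Basis \<Longrightarrow> integrable lebesgue (\<lambda>x. (norm (w b x))\<^sup>2)"
    and le: "(LINT x|lebesgue. (norm (u x))\<^sup>2) + (\<Sum>b\<in>Basis. LINT x|lebesgue. (norm (w b x))\<^sup>2) \<le> \<epsilon>\<^sup>2"
  obtains F where "integrable lebesgue F"
    and "(LINT x|lebesgue. \<bar>F x\<bar>) \<le> (3/2 + \<sigma> / \<rho> * (real DIM('a) + 1)) * \<epsilon>\<^sup>2"
    and "AE x in lebesgue. deriv (\<lambda>s. q x s) t = F x - g * \<eta> x t + \<sigma> / \<rho> * (\<Sum>b\<in>Basis. w b x \<bullet> b)"
proof -
  define \<eta>' where "\<eta>' x = deriv (\<lambda>s. \<eta> x s) t" for x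
  define P where "P = weak_grad (\<lambda>x. q x t)"
  define G where "G = weak_grad (\<lambda>x. \<eta> x t)"
  define V where "V x = (1 / sqrt (1 + (norm (G x))\<^sup>2)) *\<^sub>R G x" for x
  define r where "r = weak_div V"
  have exG: "\<exists>G. has_weak_grad (\<lambda>x. \<eta> x t) G" and exr: "\<exists>r. has_weak_div V r"
    and B: "AE x in lebesgue. deriv (\<lambda>s. q x s) t + 1/2 * (norm (P x))\<^sup>2 + g * \<eta> x t
              - (\<eta>' x + G x \<bullet> P x)\<^sup>2 / (2 * (1 + (norm (G x))\<^sup>2)) = \<sigma> / \<rho> * r x"
    using bern by (simp_all add: bernoulli_condition_def Let_def \<eta>'_def P_def G_def V_def[abs_def] r_def)
  have "has_weak_grad (\<lambda>x. \<eta> x t) G" unfolding G_def weak_grad_def by (rule someI_ex[OF exG])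
  then have Gc: "AE x in lebesgue. G x \<bullet> c = u x \<bullet> c" if "c \<in> Basis" for c
    using wd1[OF that] that
    by (intro du_Bois_Reymond_eq) (auto simp: has_weak_grad_def has_weak_deriv_iff)
  have "AE x in lebesgue. \<forall>c\<in>Basis. G x \<bullet> c = u x \<bullet> c"
    by (rule AE_finite_allI[OF finite_Basis Gc])
  then have Gu: "AE x in lebesgue. G x = u x"
    by eventually_elim (auto intro: euclidean_eqI)
  then have Vu: "AE x in lebesgue. V x = unit_slope (u x)"
    by eventually_elim (simp add: V_def unit_slope_def)
  have "has_weak_div V r" unfolding r_def weak_div_def by (rule someI_ex[OF exr])
  from weak_div_unit_slope[OF wd2 um wm Vu this]
  have ru: "AE x in lebesgue. r x = (\<Sum>b\<in>Basis. unit_slope_deriv (u x) (w b x) \<bullet> b)" by blast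
  define F1 where "F1 x = - (1/2) * (norm (P x))\<^sup>2 + (\<eta>' x + u x \<bullet> P x)\<^sup>2 / (2 * (1 + (norm (u x))\<^sup>2))" for x
  define F2 where "F2 x = (\<Sum>b\<in>Basis. (unit_slope_deriv (u x) (w b x) - w b x) \<bullet> b)" for x
  define F where "F x = F1 x + \<sigma> / \<rho> * F2 x" for x
  define M where "M x = ((norm (P x))\<^sup>2 + 1/2 * (norm (\<eta>' x))\<^sup>2) +
      \<sigma> / \<rho> * (real DIM('a) * (norm (u x))\<^sup>2 + (\<Sum>b\<in>Basis. (norm (w b x))\<^sup>2))" for x
  have s0: "0 \<le> \<sigma> / \<rho>" using \<sigma> \<rho> by simp
  have \<eta>'_meas: "\<eta>' \<in> borel_measurable lebesgue" and Pm: "P \<in> borel_measurable lebesgue"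
    using \<eta>t(1) Dq(1) by (auto simp: square_integrable_def \<eta>'_def[abs_def] P_def)
  have i\<eta>': "integrable lebesgue (\<lambda>x. (norm (\<eta>' x))\<^sup>2)" "(LINT x|lebesgue. (norm (\<eta>' x))\<^sup>2) \<le> \<epsilon>\<^sup>2"
    using square_integrable_L2_norm_less[OF \<eta>t] by (simp_all add: \<eta>'_def)
  have iP: "integrable lebesgue (\<lambda>x. (norm (P x))\<^sup>2)" "(LINT x|lebesgue. (norm (P x))\<^sup>2) \<le> \<epsilon>\<^sup>2"
    using square_integrable_L2_norm_less[OF Dq] by (simp_all add: P_def)
  have FM: "\<bar>F x\<bar> \<le> M x" for x
  proof -
    have "\<bar>F1 x\<bar> \<le> (norm (P x))\<^sup>2 + 1/2 * (norm (\<eta>' x))\<^sup>2"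
      unfolding F1_def using kinetic_term_le[of "P x" "\<eta>' x" "u x"] by simp
    moreover have "\<bar>\<sigma> / \<rho> * F2 x\<bar> \<le> \<sigma> / \<rho> * (real DIM('a) * (norm (u x))\<^sup>2 + (\<Sum>b\<in>Basis. (norm (w b x))\<^sup>2))"
      unfolding abs_mult F2_def using curvature_remainder_le[of "u x" "\<lambda>b. w b x"] s0
      by (simp only: abs_of_nonneg) (rule mult_left_mono)
    ultimately show ?thesis unfolding F_def M_def by linarith
  qed
  have iM: "integrable lebesgue M"
    unfolding M_def using iP(1) i\<eta>'(1) iu iw
    by (intro Bochner_Integration.integrable_add integrable_mult_right Bochner_Integration.integrable_sum) auto
  have um': "u \<in> borel_measurable lebesgue" using um by (intro measurable_completion) simp
  have F1m: "F1 \<in> borel_measurable lebesgue"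
    unfolding F1_def[abs_def] using \<eta>'_meas Pm um' by measurable
  have F2m: "F2 \<in> borel_measurable lebesgue"
  proof (rule measurable_completion)
    have "(\<lambda>x. (unit_slope_deriv (u x) (w b x) - w b x) \<bullet> b) \<in> borel_measurable lborel" if "b \<in> Basis" for b
      unfolding unit_slope_deriv_def using um wm[OF that] by measurable
    then show "F2 \<in> borel_measurable lborel" unfolding F2_def[abs_def] by (rule borel_measurable_sum)
  qed
  have iF: "integrable lebesgue F"
  proof (rule Bochner_Integration.integrable_bound[OF iM])
    show "F \<in> borel_measurable lebesgue" unfolding F_def[abs_def] using F1m F2m by measurable
    show "AE x in lebesgue. norm (F x) \<le> norm (M x)"
    proof (intro AE_I2)
      fix x show "norm (F x) \<le> norm (M x)" using FM[of x] by simp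
    qed
  qed
  have "(LINT x|lebesgue. \<bar>F x\<bar>) \<le> (LINT x|lebesgue. M x)"
    by (rule integral_mono[OF integrable_abs[OF iF] iM FM])
  also have "(LINT x|lebesgue. M x) = (LINT x|lebesgue. (norm (P x))\<^sup>2) + 1/2 * (LINT x|lebesgue. (norm (\<eta>' x))\<^sup>2) +
      \<sigma> / \<rho> * (real DIM('a) * (LINT x|lebesgue. (norm (u x))\<^sup>2) + (\<Sum>b\<in>Basis. LINT x|lebesgue. (norm (w b x))\<^sup>2))"
  proof -
    have a: "integrable lebesgue (\<lambda>x. \<Sum>b\<in>Basis. (norm (w b x))\<^sup>2)" using iw by (intro Bochner_Integration.integrable_sum)
    have "(LINT x|lebesgue. M x) = (LINT x|lebesgue. (norm (P x))\<^sup>2 + 1/2 * (norm (\<eta>' x))\<^sup>2) +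
      (LINT x|lebesgue. \<sigma> / \<rho> * (real DIM('a) * (norm (u x))\<^sup>2 + (\<Sum>b\<in>Basis. (norm (w b x))\<^sup>2)))"
      unfolding M_def using a iP(1) i\<eta>'(1) iu
      by (intro Bochner_Integration.integral_add Bochner_Integration.integrable_add integrable_mult_right)
    also have "(LINT x|lebesgue. (norm (P x))\<^sup>2 + 1/2 * (norm (\<eta>' x))\<^sup>2) =
        (LINT x|lebesgue. (norm (P x))\<^sup>2) + 1/2 * (LINT x|lebesgue. (norm (\<eta>' x))\<^sup>2)"
      using iP(1) i\<eta>'(1) by (subst Bochner_Integration.integral_add) (auto simp del: real_norm_def)
    also have "(LINT x|lebesgue. \<sigma> / \<rho> * (real DIM('a) * (norm (u x))\<^sup>2 + (\<Sum>b\<in>Basis. (norm (w b x))\<^sup>2))) =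
      \<sigma> / \<rho> * (real DIM('a) * (LINT x|lebesgue. (norm (u x))\<^sup>2) + (\<Sum>b\<in>Basis. LINT x|lebesgue. (norm (w b x))\<^sup>2))"
      unfolding integral_mult_right_zero
      using a iu iw by (subst Bochner_Integration.integral_add) (auto simp: Bochner_Integration.integral_sum)
    finally show ?thesis .
  qed
  also have "\<dots> \<le> \<epsilon>\<^sup>2 + 1/2 * \<epsilon>\<^sup>2 + \<sigma> / \<rho> * (real DIM('a) * \<epsilon>\<^sup>2 + \<epsilon>\<^sup>2)"
  proof -
    have "0 \<le> (LINT x|lebesgue. (norm (u x))\<^sup>2)" by (rule Bochner_Integration.integral_nonneg) simp
    moreover have "0 \<le> (\<Sum>b\<in>Basis. LINT x|lebesgue. (norm (w b x))\<^sup>2)"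
      by (intro sum_nonneg Bochner_Integration.integral_nonneg) simp
    ultimately have "(LINT x|lebesgue. (norm (u x))\<^sup>2) \<le> \<epsilon>\<^sup>2" "(\<Sum>b\<in>Basis. LINT x|lebesgue. (norm (w b x))\<^sup>2) \<le> \<epsilon>\<^sup>2"
      using le by linarith+
    then show ?thesis
      using s0 iP(2) i\<eta>'(2) by (intro add_mono mult_left_mono) auto
  qed
  also have "\<dots> = (3/2 + \<sigma> / \<rho> * (real DIM('a) + 1)) * \<epsilon>\<^sup>2" by (simp add: algebra_simps)
  finally have leF: "(LINT x|lebesgue. \<bar>F x\<bar>) \<le> (3/2 + \<sigma> / \<rho> * (real DIM('a) + 1)) * \<epsilon>\<^sup>2" .
  have "AE x in lebesgue. deriv (\<lambda>s. q x s) t = F x - g * \<eta> x t + \<sigma> / \<rho> * (\<Sum>b\<in>Basis. w b x \<bullet> b)"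
    using B Gu ru
  proof eventually_elim
    case (elim x)
    have "r x = F2 x + (\<Sum>b\<in>Basis. w b x \<bullet> b)"
      unfolding F2_def elim(3) by (simp add: inner_diff_left sum_subtractf)
    then have "\<sigma> / \<rho> * r x = \<sigma> / \<rho> * F2 x + \<sigma> / \<rho> * (\<Sum>b\<in>Basis. w b x \<bullet> b)"
      by (simp only: distrib_left)
    then show ?case using elim(1) unfolding elim(2) F_def F1_def by linarith
  qed
  then show thesis using that iF leF by blast
qed

text \<open>The transform of an integrable function is bounded by its integral norm.  The transform is
  taken of a Borel representative, for which Fubini's theorem moves it to the Schwartz function.\<close>

lemma fourier_remainder:
  fixes F :: "'a::euclidean_space \<Rightarrow> real"
  assumes iF: "integrable lebesgue F"
  obtains E where "E \<in> borel_measurable lebesgue" "\<And>k. cmod (E k) \<le> (LINT x|lebesgue. \<bar>F x\<bar>)"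
    and "\<And>\<psi>. \<psi> \<in> schwartz \<Longrightarrow> (LINT x|lebesgue. complex_of_real (F x) * fourier \<psi> x) = (LINT k|lebesgue. E k * \<psi> k)"
proof -
  have Fm: "F \<in> borel_measurable lebesgue" using iF by auto
  obtain F' where F'[measurable]: "F' \<in> borel_measurable borel" and eq: "AE x in lebesgue. F x = F' x"
    using borel_representative[OF Fm] .
  have F'm: "F' \<in> borel_measurable lebesgue" by (intro measurable_completion) simp
  have "integrable lebesgue F'" by (rule integrable_cong_AE_imp[OF iF F'm eq])
  then have iF': "integrable lborel F'" by (simp add: integrable_completion)
  then have iF'c: "integrable lborel (\<lambda>x. complex_of_real (F' x))" by simp
  define E where "E = fourier (\<lambda>x. complex_of_real (F' x))"
  have Em[measurable]: "E \<in> borel_measurable borel" unfolding E_def by (rule fourier_measurable) measurable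
  have "cmod (E k) \<le> (LINT x|lebesgue. \<bar>F x\<bar>)" for k
  proof -
    have "cmod (E k) \<le> (LINT x|lborel. cmod (complex_of_real (F' x)))"
      unfolding E_def by (rule norm_fourier_le[OF iF'c])
    also have "\<dots> = (LINT x|lebesgue. \<bar>F' x\<bar>)" by (simp add: integral_completion)
    also have "\<dots> = (LINT x|lebesgue. \<bar>F x\<bar>)"
      by (rule integral_cong_AE) (use eq Fm F'm in \<open>auto elim: eventually_mono\<close>)
    finally show ?thesis .
  qed
  moreover have "(LINT x|lebesgue. complex_of_real (F x) * fourier \<psi> x) = (LINT k|lebesgue. E k * \<psi> k)"
    if \<psi>: "\<psi> \<in> schwartz" for \<psi>
  proof -
    have [measurable]: "fourier \<psi> \<in> borel_measurable borel" "\<psi> \<in> borel_measurable borel"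
      by (intro schwartz_measurable fourier_schwartz \<psi>)+
    have fl: "fourier \<psi> \<in> borel_measurable lebesgue" by (intro measurable_completion) simp
    have "(LINT x|lebesgue. complex_of_real (F x) * fourier \<psi> x) = (LINT x|lebesgue. complex_of_real (F' x) * fourier \<psi> x)"
      by (rule integral_cong_AE) (use eq Fm F'm fl in \<open>auto elim: eventually_mono\<close>)
    also have "\<dots> = (LINT x|lborel. complex_of_real (F' x) * fourier \<psi> x)" by (rule integral_completion) measurable
    also have "\<dots> = (LINT k|lborel. E k * \<psi> k)"
      unfolding E_def by (rule fourier_swap[OF iF'c schwartz_integrable[OF \<psi>]])
    also have "\<dots> = (LINT k|lebesgue. E k * \<psi> k)" by (rule integral_completion[symmetric]) measurable
    finally show ?thesis .
  qed
  moreover have "E \<in> borel_measurable lebesgue" using Em by (intro measurable_completion) simp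
  ultimately show thesis using that by blast
qed

text \<open>Paired with the transform \<open>\<omega>\<close> of a Schwartz function, the multiplier \<open>\<kappa>\<^sup>2\<close> becomes minus the
  Laplacian of \<open>\<omega>\<close>, which two integrations by parts move to \<open>\<eta>\<close>; there it cancels the linear part
  of the curvature, and only the remainder is left.\<close>

lemma linearised_bernoulli:
  fixes \<eta> q :: "'a::euclidean_space \<Rightarrow> real \<Rightarrow> real"
  assumes bern: "bernoulli_condition g \<sigma> \<rho> q \<eta> t" and \<sigma>: "\<sigma> \<ge> 0" and \<rho>: "\<rho> > 0"
    and \<eta>t: "square_integrable (\<lambda>x. deriv (\<lambda>s. \<eta> x s) t)" "L2_norm (\<lambda>x. deriv (\<lambda>s. \<eta> x s) t) < \<epsilon>"
    and \<eta>: "(\<lambda>x. \<eta> x t) \<in> sobolev_space 2 UNIV" "sobolev_norm 2 UNIV (\<lambda>x. \<eta> x t) < \<epsilon>"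
    and Dq: "square_integrable (weak_grad (\<lambda>x. q x t))" "L2_norm (weak_grad (\<lambda>x. q x t)) < \<epsilon>"
  shows "is_tempered_function (\<lambda>x. complex_of_real (deriv (\<lambda>s. q x s) t)) \<and>
      (\<exists>E. E \<in> borel_measurable lebesgue \<and>
        (\<forall>k. cmod (E k) \<le> (3/2 + \<sigma> / \<rho> * (real DIM('a) + 1)) * \<epsilon>\<^sup>2) \<and>
        (\<forall>\<psi>\<in>schwartz.
           fourier_dist (dist_of (\<lambda>x. complex_of_real (deriv (\<lambda>s. q x s) t))) \<psi>
           + complex_of_real g * fourier_dist (dist_of (\<lambda>x. complex_of_real (\<eta> x t))) \<psi>
           + complex_of_real (\<sigma> / \<rho>) *
               mult_dist (\<lambda>k. complex_of_real ((norm k)\<^sup>2))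
                 (fourier_dist (dist_of (\<lambda>x. complex_of_real (\<eta> x t)))) \<psi>
           = dist_of E \<psi>))"
proof -
  obtain u :: "'a \<Rightarrow> 'a" and w :: "'a \<Rightarrow> 'a \<Rightarrow> 'a" where
    um: "u \<in> borel_measurable borel" and wm: "\<And>b. b \<in> Basis \<Longrightarrow> w b \<in> borel_measurable borel"
    and \<eta>m: "(\<lambda>x. \<eta> x t) \<in> borel_measurable lebesgue" and \<eta>sq: "integrable lebesgue (\<lambda>x. (\<eta> x t)\<^sup>2)"
    and wd1: "\<And>c. c \<in> Basis \<Longrightarrow> has_weak_deriv UNIV [c] (\<lambda>x. \<eta> x t) (\<lambda>x. u x \<bullet> c)"
    and wd2: "\<And>b c. b \<in> Basis \<Longrightarrow> c \<in> Basis \<Longrightarrow> has_weak_deriv UNIV [b] (\<lambda>x. u x \<bullet> c) (\<lambda>x. w b x \<bullet> c)"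
    and iu: "integrable lebesgue (\<lambda>x. (norm (u x))\<^sup>2)"
    and iw: "\<And>b. b \<in> Basis \<Longrightarrow> integrable lebesgue (\<lambda>x. (norm (w b x))\<^sup>2)"
    and le: "(LINT x|lebesgue. (norm (u x))\<^sup>2) + (\<Sum>b\<in>Basis. LINT x|lebesgue. (norm (w b x))\<^sup>2) \<le> \<epsilon>\<^sup>2"
    by (rule sobolev_2_derivatives[OF \<eta>]) blast
  obtain F where iF: "integrable lebesgue F"
    and leF: "(LINT x|lebesgue. \<bar>F x\<bar>) \<le> (3/2 + \<sigma> / \<rho> * (real DIM('a) + 1)) * \<epsilon>\<^sup>2"
    and qt: "AE x in lebesgue. deriv (\<lambda>s. q x s) t = F x - g * \<eta> x t + \<sigma> / \<rho> * (\<Sum>b\<in>Basis. w b x \<bullet> b)"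
    by (rule bernoulli_remainder[OF bern \<sigma> \<rho> \<eta>t Dq um wm wd1 wd2 iu iw le]) auto
  have W\<eta>: "weighted_integrable (\<lambda>x. \<eta> x t)" by (rule weighted_integrable_of_square[OF \<eta>m \<eta>sq])
  have Wu: "weighted_integrable (\<lambda>x. u x \<bullet> c)" if "c \<in> Basis" for c
    by (rule weighted_integrable_component[OF _ iu that]) (use um in \<open>auto intro: measurable_completion\<close>)
  have Ww: "weighted_integrable (\<lambda>x. w b x \<bullet> c)" if "b \<in> Basis" "c \<in> Basis" for b c
    by (rule weighted_integrable_component[OF _ iw[OF that(1)] that(2)]) (use wm that in \<open>auto intro: measurable_completion\<close>)
  define lap where "lap x = (\<Sum>b\<in>Basis. w b x \<bullet> b)" for x
  have WL: "weighted_integrable lap" unfolding lap_def[abs_def] by (intro weighted_integrable_sum Ww)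
  have WF: "weighted_integrable F" by (rule weighted_integrable_of_integrable[OF iF])
  define R where "R x = F x + (- g) * \<eta> x t + \<sigma> / \<rho> * lap x" for x
  have WR: "weighted_integrable R" unfolding R_def[abs_def]
    by (intro weighted_integrable_add weighted_integrable_scale WF W\<eta> WL)
  have eq: "AE x in lebesgue. R x = deriv (\<lambda>s. q x s) t"
    using qt by eventually_elim (simp add: R_def lap_def)
  have Wq: "weighted_integrable (\<lambda>x. deriv (\<lambda>s. q x s) t)" by (rule weighted_integrable_cong_AE[OF WR eq])
  have tempered: "is_tempered_function (\<lambda>x. complex_of_real (deriv (\<lambda>s. q x s) t))"
    by (rule weighted_integrable_tempered[OF Wq])
  obtain E where Em: "E \<in> borel_measurable lebesgue" and Ele: "\<And>k. cmod (E k) \<le> (LINT x|lebesgue. \<bar>F x\<bar>)"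
    and E: "\<And>\<psi>. \<psi> \<in> schwartz \<Longrightarrow> (LINT x|lebesgue. complex_of_real (F x) * fourier \<psi> x) = (LINT k|lebesgue. E k * \<psi> k)"
    using fourier_remainder[OF iF] by blast
  have main: "fourier_dist (dist_of (\<lambda>x. complex_of_real (deriv (\<lambda>s. q x s) t))) \<psi>
           + complex_of_real g * fourier_dist (dist_of (\<lambda>x. complex_of_real (\<eta> x t))) \<psi>
           + complex_of_real (\<sigma> / \<rho>) *
               mult_dist (\<lambda>k. complex_of_real ((norm k)\<^sup>2))
                 (fourier_dist (dist_of (\<lambda>x. complex_of_real (\<eta> x t)))) \<psi>
           = dist_of E \<psi>" if \<psi>: "\<psi> \<in> schwartz" for \<psi>
  proof -
    define \<omega> where "\<omega> = fourier \<psi>"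
    have \<omega>: "\<omega> \<in> schwartz" unfolding \<omega>_def by (rule fourier_schwartz[OF \<psi>])
    note iS = weighted_integrable_mult_schwartz[OF _ \<omega>]
    have q1: "(LINT x|lebesgue. complex_of_real (deriv (\<lambda>s. q x s) t) * \<omega> x) =
      (LINT x|lebesgue. complex_of_real (F x) * \<omega> x) - complex_of_real g * (LINT x|lebesgue. complex_of_real (\<eta> x t) * \<omega> x)
        + complex_of_real (\<sigma> / \<rho>) * (LINT x|lebesgue. complex_of_real (lap x) * \<omega> x)"
    proof -
      have "(LINT x|lebesgue. complex_of_real (deriv (\<lambda>s. q x s) t) * \<omega> x) = (LINT x|lebesgue. complex_of_real (R x) * \<omega> x)"
        by (rule integral_cong_AE) (use eq iS[OF Wq] iS[OF WR] in \<open>auto elim: eventually_mono\<close>)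
      also have "\<dots> = (LINT x|lebesgue. (complex_of_real (F x) * \<omega> x - complex_of_real g * (complex_of_real (\<eta> x t) * \<omega> x))
          + complex_of_real (\<sigma> / \<rho>) * (complex_of_real (lap x) * \<omega> x))"
        by (rule Bochner_Integration.integral_cong) (auto simp: R_def algebra_simps)
      also have "\<dots> = (LINT x|lebesgue. complex_of_real (F x) * \<omega> x - complex_of_real g * (complex_of_real (\<eta> x t) * \<omega> x))
          + (LINT x|lebesgue. complex_of_real (\<sigma> / \<rho>) * (complex_of_real (lap x) * \<omega> x))"
        by (intro Bochner_Integration.integral_add Bochner_Integration.integrable_diff integrable_mult_right iS WF W\<eta> WL)
      also have "(LINT x|lebesgue. complex_of_real (F x) * \<omega> x - complex_of_real g * (complex_of_real (\<eta> x t) * \<omega> x)) =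
         (LINT x|lebesgue. complex_of_real (F x) * \<omega> x) - (LINT x|lebesgue. complex_of_real g * (complex_of_real (\<eta> x t) * \<omega> x))"
        by (intro Bochner_Integration.integral_diff integrable_mult_right iS WF W\<eta>)
      finally show ?thesis by (simp only: integral_mult_right_zero)
    qed
    have q2: "(LINT x|lebesgue. complex_of_real (\<eta> x t) * fourier (\<lambda>k. complex_of_real ((norm k)\<^sup>2) * \<psi> k) x) =
        - (LINT x|lebesgue. complex_of_real (lap x) * \<omega> x)"
    proof -
      have pS: "pd b \<omega> \<in> schwartz" "pd b (pd b \<omega>) \<in> schwartz" if "b \<in> Basis" for b
        using schwartz_pd \<omega> that by auto
      have "(LINT x|lebesgue. complex_of_real (\<eta> x t) * fourier (\<lambda>k. complex_of_real ((norm k)\<^sup>2) * \<psi> k) x) =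
         (LINT x|lebesgue. - (\<Sum>b\<in>Basis. complex_of_real (\<eta> x t) * pd b (pd b \<omega>) x))"
        unfolding fourier_norm_sq_mult[OF \<psi>] \<omega>_def by (simp add: sum_distrib_left)
      also have "\<dots> = - (\<Sum>b\<in>Basis. LINT x|lebesgue. complex_of_real (\<eta> x t) * pd b (pd b \<omega>) x)"
        by (simp add: Bochner_Integration.integral_sum weighted_integrable_mult_schwartz W\<eta> pS)
      also have "(\<Sum>b\<in>Basis. LINT x|lebesgue. complex_of_real (\<eta> x t) * pd b (pd b \<omega>) x) =
          (\<Sum>b\<in>Basis. LINT x|lebesgue. complex_of_real (w b x \<bullet> b) * \<omega> x)"
      proof (rule sum.cong)
        fix b :: 'a assume b: "b \<in> Basis"
        show "(LINT x|lebesgue. complex_of_real (\<eta> x t) * pd b (pd b \<omega>) x) = (LINT x|lebesgue. complex_of_real (w b x \<bullet> b) * \<omega> x)"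
          using weak_deriv_schwartz[OF wd1[OF b] b W\<eta> Wu[OF b] pS(1)[OF b]]
            weak_deriv_schwartz[OF wd2[OF b b] b Wu[OF b] Ww[OF b b] \<omega>] by simp
      qed simp
      also have "\<dots> = (LINT x|lebesgue. (\<Sum>b\<in>Basis. complex_of_real (w b x \<bullet> b) * \<omega> x))"
        by (rule Bochner_Integration.integral_sum[symmetric]) (intro iS Ww)
      also have "\<dots> = (LINT x|lebesgue. complex_of_real (lap x) * \<omega> x)"
        by (simp add: lap_def sum_distrib_right)
      finally show ?thesis .
    qed
    show ?thesis
      unfolding fourier_dist_def mult_dist_def dist_of_def q2
      using q1 E[OF \<psi>] unfolding \<omega>_def by simp
  qed
  show ?thesis
    using tempered Em order_trans[OF Ele leF] main by blast
qed

theorem proposition5: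
  fixes n :: nat and s1 s2 g \<sigma> \<rho> h0 :: real
  assumes "n \<ge> 2" and "CARD('d::finite) = n - 1"
    and "g > 0" and "\<sigma> \<ge> 0" and "\<rho> > 0" and "h0 > 0"
    and "s1 \<ge> real n / 2" and "s2 > real n - 1/2"
  shows "\<exists>C \<epsilon>0. \<epsilon>0 > 0 \<and>
    (\<forall>\<epsilon> T t (\<eta> :: real^'d \<Rightarrow> real \<Rightarrow> real) (\<phi> :: (real^'d) \<times> real \<Rightarrow> real \<Rightarrow> real) (q :: real^'d \<Rightarrow> real \<Rightarrow> real).
      0 < \<epsilon> \<and> \<epsilon> < \<epsilon>0 \<and> t \<in> T \<and>
      free_surface_flow T h0 \<eta> \<phi> q \<and>
      bottom_condition h0 \<eta> \<phi> t \<and>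
      kinematic_condition h0 \<eta> \<phi> t \<and>
      bernoulli_condition g \<sigma> \<rho> q \<eta> t \<and>
      (\<forall>b\<in>Basis. pd b (\<lambda>z. \<phi> z t) \<in> sobolev_space s1 (fluid_domain h0 (\<lambda>x. \<eta> x t))) \<and>
      (\<lambda>x. \<eta> x t) \<in> sobolev_space s2 UNIV \<and>
      square_integrable (\<lambda>x. deriv (\<lambda>s. \<eta> x s) t) \<and>
      (\<lambda>x. \<eta> x t) \<in> sobolev_space 2 UNIV \<and>
      square_integrable (weak_grad (\<lambda>x. q x t)) \<and>
      Max {L2_norm (\<lambda>x. deriv (\<lambda>s. \<eta> x s) t),
           sobolev_norm 2 UNIV (\<lambda>x. \<eta> x t),
           L2_norm (weak_grad (\<lambda>x. q x t))} < \<epsilon>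
      \<longrightarrow>
      is_tempered_function (\<lambda>x. complex_of_real (deriv (\<lambda>s. q x s) t)) \<and>
      (\<exists>E. E \<in> borel_measurable lebesgue \<and> (\<forall>k. cmod (E k) \<le> C * \<epsilon>\<^sup>2) \<and>
        (\<forall>\<psi>\<in>schwartz.
           fourier_dist (dist_of (\<lambda>x. complex_of_real (deriv (\<lambda>s. q x s) t))) \<psi>
           + complex_of_real g * fourier_dist (dist_of (\<lambda>x. complex_of_real (\<eta> x t))) \<psi>
           + complex_of_real (\<sigma> / \<rho>) *
               mult_dist (\<lambda>k. complex_of_real ((norm k)\<^sup>2))
                 (fourier_dist (dist_of (\<lambda>x. complex_of_real (\<eta> x t)))) \<psi>
           = dist_of E \<psi>)))"
  by (rule exI[of _ "3/2 + \<sigma> / \<rho> * (real DIM(real^'d) + 1)"], rule exI[of _ 1],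
      intro conjI[OF zero_less_one] allI impI, elim conjE, rule linearised_bernoulli)
    (use assms in simp_all)

end
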